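(* For every NSP-map $M$, $\phi_M(M)=\phi_T(\mathrm{T}(M))$; that is, $\phi_M=\phi_T\circ\mathrm{T}$.
   Context: $\beta$-(1,0) trees. A $\beta$-(1,0) tree is a rooted plane tree with at least one edge carrying a positive integer label on every node such that every leaf is labeled $1$, the root label equals the sum of the labels of its children, and every other internal node has a label between $1$ and the sum of the labels of its children. $\operatorname{root}(B)$ is the root label. $B_0$ is the one-edge tree (root labeled $1$ with one leaf child). For $1\le i\le\operatorname{root}(B)$, $\Delta_{\mathcal B}(B,i)$ is obtained by attaching the root of $B$ as the only child of a new root and labeling both the old and new root by $i$. For $1\le i\le\operatorname{root}(B_1)$, $\oplus_{\mathcal B}(B_1,i,B_2)$ is obtained from $B_2$ by adding the root of $B_1$ (with its subtree), relabeled $i$, as new leftmost child of the root of $B_2$, and relabeling the root $i+\operatorname{root}(B_2)$. $L(B)$ is obtained by adding a new leaf as leftmost child of the root and increasing the root label by $1$. NSP-maps. A planar map is a connected graph (loops and multiple edges allowed) embedded in the plane, up to orientation-preserving homeomorphism, with a distinguished oriented edge (the root) on the boundary of the outer (unbounded) face, the outer face lying on its left; the face on its right is the core face, the origin of the root is the root vertex. A map is separable if its edges can be partitioned into two nonempty sets with exactly one vertex incident to edges of both; an NSP-map is a non-separable planar map with at least two edges. $\deg(M)$ is the degree of the root vertex minus $1$. $M_0$ is the map with two vertices joined by two parallel edges. For an NSP-map $M$ with root $e=(v\to u)$, contracting $e$ into a vertex $w$ gives $M/e$, whose edges split into blocks (maximal non-separable submaps, a single loop counting as a block) all containing $w$;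 the innermost block is the one containing the edges other than $e$ bounding the core face of $M$. If $M/e$ is non-separable, $\Pi_{\mathcal M}(M)$ is $M/e$ rooted at the edge following $e$ along the boundary of the outer face traversed with the outer face on the left. The map $\phi_M$ from NSP-maps to $\beta$-(1,0) trees is defined recursively: $\phi_M(M_0)=B_0$; if $M/e$ is a single block that is not a loop, $\phi_M(M)=\Delta_{\mathcal B}(\phi_M(\Pi_{\mathcal M}(M)),\deg(M))$; if $M/e$ has at least two blocks and the innermost one is a single loop $e_1$, $\phi_M(M)=L(\phi_M(M\setminus e_1))$ (rooted at $e$); if $M/e$ has at least two blocks and the innermost one is not a loop, let $N_1$ be the submap formed by $e$ and the edges of the innermost block and $M_2$ the submap formed by $e$ and all remaining edges, both rooted at $e$; then $\phi_M(M)=\oplus_{\mathcal B}(\phi_M(\Pi_{\mathcal M}(N_1)),\deg(N_1),\phi_M(M_2))$. Decorated trees. Depth of the root is $0$; traversal order is preorder (left-to-right). A decorated tree is a rooted plane tree with at least one edge, each leaf labeled by an integer $\ge-1$, such that: (1) each leaf label is strictly less than the depth of its parent; (2) every internal node of depth $p>0$ has a descendant leaf with label $\le p-2$; (3) for every internal node $t$ of depth $p$, every subtree $T''$ rooted at a child of $t$ and every leaf $\ell$ of $T''$ labeled $p$, the leaves of $T''$ preceding $\ell$ have labels $\ge p$. Free leaves are those labeled $-1$; $\operatorname{fl}(T)$ counts them. $\Pi_{\mathcal T}(T)$ (for a root with one child) deletes the root and subtracts $1$ from every non-free leaf label. The map $\phi_T$ from decorated trees to $\beta$-(1,0) trees is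 defined recursively: if the root has a single child which is a leaf, $\phi_T(T)=B_0$; if it has a single child which is internal, $\phi_T(T)=\Delta_{\mathcal B}(\phi_T(\Pi_{\mathcal T}(T)),\operatorname{fl}(T))$; if it has at least two children and the leftmost is a leaf, $\phi_T(T)=L(\phi_T(T'))$ with $T'$ being $T$ minus that leaf; if it has at least two children and the leftmost is internal, with $T_{hd}$ the root plus its leftmost child and that child's subtree and $T_{tl}$ the root plus its other children and their subtrees, $\phi_T(T)=\oplus_{\mathcal B}(\phi_T(\Pi_{\mathcal T}(T_{hd})),\operatorname{fl}(T_{hd}),\phi_T(T_{tl}))$. The map $\mathrm{T}$. For an NSP-map $M$ with root $e=(v\to u)$: delete $e$, mark $u$ and $v$ as visited, give $v$ depth $-1$ and $u$ depth $0$; $u$ is the root of the tree. Perform a depth-first search from $u$: when a vertex $x$ is reached (via an edge $f$; for $x=u$ take $f=e$), the edges around $x$ are examined in clockwise order starting just after $f$. An edge not examined before leading to an unvisited vertex $y$ makes $y$ a child of $x$ of depth one more, and the search continues from $y$ before resuming at $x$; an edge not examined before leading to an already visited vertex $z$ creates a leaf child of $x$ labeled by the depth of $z$. The plane structure of the tree is the one inherited from $M$ (equivalently, the children of each node, from left to right, are in reverse order of creation). The result $\mathrm{T}(M)$ is a decorated tree. *)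

theory Defs
  imports "HOL-Combinatorics.Permutations" "HOL-Combinatorics.Orbits"
begin

section \<open>Rooted planar maps\<close>

text \<open>
  A map is encoded by its darts (oriented edges). \<open>rot\<close> sends a dart to the next dart in
  clockwise order around its origin, \<open>opp\<close> reverses a dart, and \<open>root_dart\<close> is the root.
  Vertices are the orbits of \<open>rot\<close> (the darts leaving the vertex), edges the
  orbits of \<open>opp\<close>. Following a dart \<open>d\<close> with a face on the left, the next dart on the boundary
  of that face is \<open>rot (opp d)\<close>, so faces are the orbits of \<open>rot \<circ> opp\<close>, each consisting of the
  darts that have the face on their left. Embeddings in the plane up to orientation-preserving
  homeomorphism correspond to such data with Euler characteristic \<open>2\<close> and a choice of outer face;
  the outer face is the one on the left of the root, so it needs no separate component.
  The dart set may be any subset of the (finite) dart type, so that submaps and minors of a map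
  are maps over the same type.
\<close>

record 'd rmap =
  darts :: "'d set"
  rot :: "'d \<Rightarrow> 'd"
  opp :: "'d \<Rightarrow> 'd"
  root_dart :: 'd

definition vertex_of :: "'d rmap \<Rightarrow> 'd \<Rightarrow> 'd set" where
  "vertex_of M d = orbit (rot M) d"

definition edge_of :: "'d rmap \<Rightarrow> 'd \<Rightarrow> 'd set" where
  "edge_of M d = {d, opp M d}"

definition face_of :: "'d rmap \<Rightarrow> 'd \<Rightarrow> 'd set" where
  "face_of M d = orbit (rot M \<circ> opp M) d"

definition vertices :: "'d rmap \<Rightarrow> 'd set set" where
  "vertices M = vertex_of M ` darts M"

definition edges :: "'d rmap \<Rightarrow> 'd set set" where
  "edges M = edge_of M ` darts M"

definition faces :: "'d rmap \<Rightarrow> 'd set set" where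
  "faces M = face_of M ` darts M"

definition map_connected :: "'d rmap \<Rightarrow> bool" where
  "map_connected M \<longleftrightarrow>
    (\<forall>x\<in>darts M. \<forall>y\<in>darts M.
      (x, y) \<in> ({(d, rot M d) | d. d \<in> darts M} \<union> {(d, opp M d) | d. d \<in> darts M})\<^sup>*)"

definition planar_map :: "'d rmap \<Rightarrow> bool" where
  "planar_map M \<longleftrightarrow>
    finite (darts M) \<and> root_dart M \<in> darts M \<and>
    rot M permutes darts M \<and> opp M permutes darts M \<and>
    (\<forall>d\<in>darts M. opp M d \<noteq> d \<and> opp M (opp M d) = d) \<and>
    map_connected M \<and>
    card (vertices M) + card (faces M) = card (edges M) + 2"

text \<open>A vertex and an edge are incident iff they share a dart.\<close>

definition separable :: "'d rmap \<Rightarrow> bool" where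
  "separable M \<longleftrightarrow>
    (\<exists>A B. A \<union> B = edges M \<and> A \<inter> B = {} \<and> A \<noteq> {} \<and> B \<noteq> {} \<and>
      (\<exists>!v. v \<in> vertices M \<and> (\<exists>a\<in>A. v \<inter> a \<noteq> {}) \<and> (\<exists>b\<in>B. v \<inter> b \<noteq> {})))"

definition nsp_map :: "'d rmap \<Rightarrow> bool" where
  "nsp_map M \<longleftrightarrow> planar_map M \<and> \<not> separable M \<and> 2 \<le> card (edges M)"

definition root_vertex :: "'d rmap \<Rightarrow> 'd set" where
  "root_vertex M = vertex_of M (root_dart M)"

definition root_edge :: "'d rmap \<Rightarrow> 'd set" where
  "root_edge M = edge_of M (root_dart M)"

text \<open>The degree of a vertex is its number of outgoing darts (so a loop counts twice).\<close>

definition map_deg :: "'d rmap \<Rightarrow> nat" where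
  "map_deg M = card (root_vertex M) - 1"

definition is_M0 :: "'d rmap \<Rightarrow> bool" where
  "is_M0 M \<longleftrightarrow> card (vertices M) = 2 \<and> card (edges M) = 2 \<and>
    (\<forall>v\<in>vertices M. \<forall>a\<in>edges M. v \<inter> a \<noteq> {})"

definition is_loop :: "'d rmap \<Rightarrow> 'd set \<Rightarrow> bool" where
  "is_loop M a \<longleftrightarrow> a \<in> edges M \<and> (\<exists>v\<in>vertices M. a \<subseteq> v)"


section \<open>Submaps, contraction and blocks\<close>

definition first_return :: "('d \<Rightarrow> 'd) \<Rightarrow> 'd set \<Rightarrow> 'd \<Rightarrow> 'd" where
  "first_return f S d = (f ^^ (LEAST n. 0 < n \<and> (f ^^ n) d \<in> S)) d"

text \<open>
  The submap formed by the edges in \<open>F\<close>, with the same root dart. The root field is meaningful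
  only if the root edge is in \<open>F\<close>; connectedness and separability do not depend on it.
\<close>

definition submap :: "'d rmap \<Rightarrow> 'd set set \<Rightarrow> 'd rmap" where
  "submap M F =
    \<lparr>darts = \<Union>F,
     rot = (\<lambda>d. if d \<in> \<Union>F then first_return (rot M) (\<Union>F) d else d),
     opp = (\<lambda>d. if d \<in> \<Union>F then opp M d else d),
     root_dart = root_dart M\<rparr>"

text \<open>
  \<open>M/e\<close> for the root edge \<open>e\<close>, rooted at the edge following \<open>e\<close> along the outer face. It thus
  serves both as \<open>M/e\<close> and, when that is non-separable, as \<open>\<Pi>(M)\<close>. Contraction removes
  the two darts of \<open>e\<close> from the face cycles, and the rotation is recovered from the face
  permutation \<open>\<phi> = rot \<circ> opp\<close> as \<open>rot = \<phi> \<circ> opp\<close>. If the root vertex is \<open>(r a\<^sub>1 \<dots> a\<^sub>k)\<close> and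
  the other end of \<open>e\<close> is \<open>(opp r b\<^sub>1 \<dots> b\<^sub>m)\<close>, the merged vertex is
  \<open>(a\<^sub>1 \<dots> a\<^sub>k b\<^sub>1 \<dots> b\<^sub>m)\<close>.
\<close>

definition contract_root :: "'d rmap \<Rightarrow> 'd rmap" where
  "contract_root M =
    (let D = darts M - root_edge M in
      \<lparr>darts = D,
       rot = (\<lambda>d. if d \<in> D then first_return (rot M \<circ> opp M) D (opp M d) else d),
       opp = (\<lambda>d. if d \<in> D then opp M d else d),
       root_dart = rot M (opp M (root_dart M))\<rparr>)"

text \<open>A single loop is non-separable, so it needs no special treatment here.\<close>

definition nonsep_submap :: "'d rmap \<Rightarrow> 'd set set \<Rightarrow> bool" where
  "nonsep_submap M F \<longleftrightarrow>
    F \<subseteq> edges M \<and> F \<noteq> {} \<and> map_connected (submap M F) \<and> \<not> separable (submap M F)"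

definition blocks :: "'d rmap \<Rightarrow> 'd set set set" where
  "blocks M = {F. nonsep_submap M F \<and> (\<forall>G. nonsep_submap M G \<longrightarrow> F \<subseteq> G \<longrightarrow> G = F)}"

text \<open>The core face, on the right of the root, is on the left of the reversed root.\<close>

definition core_edges :: "'d rmap \<Rightarrow> 'd set set" where
  "core_edges M = edge_of M ` face_of M (opp M (root_dart M)) - {root_edge M}"

definition innermost_block :: "'d rmap \<Rightarrow> 'd set set" where
  "innermost_block M = (THE F. F \<in> blocks (contract_root M) \<and> core_edges M \<subseteq> F)"


section \<open>\<open>\<beta>\<close>-(1,0) trees\<close>

datatype btree = BNode (blabel: nat) (bchildren: "btree list")

fun beta_subtree :: "btree \<Rightarrow> bool" where
  "beta_subtree (BNode l ts) \<longleftrightarrow>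
    (if ts = [] then l = 1 else 1 \<le> l \<and> l \<le> sum_list (map blabel ts)) \<and>
    (\<forall>t\<in>set ts. beta_subtree t)"

definition beta_tree :: "btree \<Rightarrow> bool" where
  "beta_tree B \<longleftrightarrow> bchildren B \<noteq> [] \<and> blabel B = sum_list (map blabel (bchildren B)) \<and>
    (\<forall>t\<in>set (bchildren B). beta_subtree t)"

definition B0 :: btree where
  "B0 = BNode 1 [BNode 1 []]"

text \<open>
  The operations are given on all labeled plane trees; on \<open>\<beta>\<close>-(1,0) trees, \<open>Delta_B\<close> and
  \<open>oplus_B\<close> yield \<open>\<beta>\<close>-(1,0) trees for \<open>i\<close> between \<open>1\<close> and the root label of the first argument.
\<close>

definition Delta_B :: "btree \<Rightarrow> nat \<Rightarrow> btree" where
  "Delta_B B i = BNode i [BNode i (bchildren B)]"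

definition oplus_B :: "btree \<Rightarrow> nat \<Rightarrow> btree \<Rightarrow> btree" where
  "oplus_B B1 i B2 = BNode (i + blabel B2) (BNode i (bchildren B1) # bchildren B2)"

definition L_B :: "btree \<Rightarrow> btree" where
  "L_B B = BNode (blabel B + 1) (BNode 1 [] # bchildren B)"


section \<open>The map from NSP-maps to \<open>\<beta>\<close>-(1,0) trees\<close>

lemma edge_of_eqI:
  assumes "planar_map M" "d \<in> darts M" "x \<in> edge_of M d"
  shows "edge_of M x = edge_of M d"
  using assms unfolding planar_map_def edge_of_def by fastforce

lemma edge_of_subset:
  assumes "planar_map M" "d \<in> darts M"
  shows "edge_of M d \<subseteq> darts M"
  using assms unfolding planar_map_def edge_of_def by (auto dest: permutes_in_image)

lemma edges_contract_root_subset: "edges (contract_root M) \<subseteq> edges M"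
  by (auto simp: edges_def edge_of_def contract_root_def Let_def)

lemma darts_submap_edges_subset:
  assumes "planar_map M" "F \<subseteq> edges M"
  shows "darts (submap M F) \<subseteq> darts M"
  using assms edge_of_subset[OF assms(1)] by (auto simp: submap_def edges_def)

lemma darts_delete_block_psubset:
  assumes M: "planar_map M" and b: "b \<in> blocks (contract_root M)"
  shows "darts (submap M (edges M - b)) \<subset> darts M"
proof -
  have sub: "b \<subseteq> edges M" and "b \<noteq> {}"
    using b edges_contract_root_subset[of M] by (auto simp: blocks_def nonsep_submap_def)
  then obtain d where d: "d \<in> darts M" "edge_of M d \<in> b"
    by (auto simp: edges_def)
  have "d \<notin> \<Union>(edges M - b)"
  proof
    assume "d \<in> \<Union>(edges M - b)"
    then obtain x where x: "x \<in> darts M" "edge_of M x \<notin> b" "d \<in> edge_of M x"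
      by (auto simp: edges_def)
    with edge_of_eqI[OF M x(1) x(3)] d show False by simp
  qed
  moreover have "darts (submap M (edges M - b)) \<subseteq> darts M"
    by (rule darts_submap_edges_subset[OF M]) auto
  ultimately show ?thesis using d(1) by (auto simp: submap_def)
qed

lemma darts_contract_submap_psubset:
  assumes M: "planar_map M" and b: "b \<in> blocks (contract_root M)"
  shows "darts (contract_root (submap M (insert (root_edge M) b))) \<subset> darts M"
proof -
  have r: "root_dart M \<in> darts M" using M by (simp add: planar_map_def)
  have "b \<subseteq> edges M"
    using b edges_contract_root_subset[of M] by (auto simp: blocks_def nonsep_submap_def)
  then have "insert (root_edge M) b \<subseteq> edges M"
    using r by (simp add: root_edge_def edges_def)
  from darts_submap_edges_subset[OF M this] r show ?thesis
    by (auto simp: contract_root_def Let_def root_edge_def edge_of_def submap_def)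
qed

lemma darts_contract_root_psubset:
  assumes "planar_map M"
  shows "darts (contract_root M) \<subset> darts M"
  using assms by (auto simp: planar_map_def contract_root_def Let_def root_edge_def edge_of_def)

text \<open>
  The condition \<open>innermost_block M \<in> blocks (contract_root M)\<close> holds for every NSP-map; it is
  there to make termination provable without first showing that the innermost block is well
  defined. When \<open>M/e\<close> is a single block it is not a loop, since \<open>is_M0 M\<close> has been excluded.
\<close>

function phi_M :: "'d rmap \<Rightarrow> btree" where
  "phi_M M =
    (if \<not> (nsp_map M \<and> innermost_block M \<in> blocks (contract_root M)) then undefined
     else if is_M0 M then B0
     else if card (blocks (contract_root M)) = 1 then
       Delta_B (phi_M (contract_root M)) (map_deg M)
     else if \<exists>a. innermost_block M = {a} \<and> is_loop (contract_root M) a then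
       L_B (phi_M (submap M (edges M - innermost_block M)))
     else
       oplus_B
         (phi_M (contract_root (submap M (insert (root_edge M) (innermost_block M)))))
         (map_deg (submap M (insert (root_edge M) (innermost_block M))))
         (phi_M (submap M (edges M - innermost_block M))))"
  by pat_completeness auto
termination
proof (relation "inv_image finite_psubset darts", goal_cases)
  case 1 show ?case by (rule wf_inv_image[OF wf_finite_psubset])
qed (auto simp: nsp_map_def planar_map_def
  intro!: darts_contract_root_psubset darts_delete_block_psubset darts_contract_submap_psubset
  intro: finite_subset)


section \<open>Decorated trees\<close>

datatype dtree = Leaf int | Node "dtree list"

text \<open>Leaf labels in traversal order.\<close>

fun leaf_labels :: "dtree \<Rightarrow> int list" where
  "leaf_labels (Leaf l) = [l]"
| "leaf_labels (Node ts) = concat (map leaf_labels ts)"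

text \<open>
  \<open>decorated_at p t\<close>: the subtree \<open>t\<close>, with root at depth \<open>p\<close>, satisfies the conditions. The
  parent of a leaf at depth \<open>p\<close> has depth \<open>p - 1\<close>.
\<close>

fun decorated_at :: "int \<Rightarrow> dtree \<Rightarrow> bool" where
  "decorated_at p (Leaf l) \<longleftrightarrow> -1 \<le> l \<and> l < p - 1"
| "decorated_at p (Node ts) \<longleftrightarrow>
    ts \<noteq> [] \<and>
    (0 < p \<longrightarrow> (\<exists>l\<in>set (leaf_labels (Node ts)). l \<le> p - 2)) \<and>
    (\<forall>t\<in>set ts. \<forall>i<length (leaf_labels t).
      leaf_labels t ! i = p \<longrightarrow> (\<forall>j<i. p \<le> leaf_labels t ! j)) \<and>
    (\<forall>t\<in>set ts. decorated_at (p + 1) t)"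

definition decorated_tree :: "dtree \<Rightarrow> bool" where
  "decorated_tree t \<longleftrightarrow> (\<exists>ts. t = Node ts) \<and> decorated_at 0 t"

definition free_leaves :: "dtree \<Rightarrow> nat" where
  "free_leaves t = length (filter (\<lambda>l. l = -1) (leaf_labels t))"

fun lower_labels :: "dtree \<Rightarrow> dtree" where
  "lower_labels (Leaf l) = Leaf (if l = -1 then l else l - 1)"
| "lower_labels (Node ts) = Node (map lower_labels ts)"

text \<open>\<open>\<Pi>\<close> on decorated trees; only meaningful when the root has a single child.\<close>

fun Pi_T :: "dtree \<Rightarrow> dtree" where
  "Pi_T (Node (t # ts)) = lower_labels t"
| "Pi_T t = t"

lemma size_lower_labels: "size (lower_labels t) = size t"
  by (induction t) (auto simp: size_list_conv_sum_list comp_def intro!: arg_cong[of _ _ sum_list])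

text \<open>
  The recursion makes sense on all labeled plane trees with at least one edge; the conditions in
  \<open>decorated_tree\<close> are not consulted.
\<close>

function phi_T :: "dtree \<Rightarrow> btree" where
  "phi_T (Node [Leaf l]) = B0"
| "phi_T (Node [Node us]) =
    Delta_B (phi_T (Pi_T (Node [Node us]))) (free_leaves (Node [Node us]))"
| "phi_T (Node (Leaf l # t # ts)) = L_B (phi_T (Node (t # ts)))"
| "phi_T (Node (Node us # t # ts)) =
    oplus_B (phi_T (Pi_T (Node [Node us]))) (free_leaves (Node [Node us])) (phi_T (Node (t # ts)))"
| "phi_T (Node []) = undefined"
| "phi_T (Leaf l) = undefined"
  by pat_completeness auto
termination
  by (relation "measure size") (simp_all add: size_lower_labels del: lower_labels.simps)


section \<open>From maps to decorated trees by depth-first search\<close>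

text \<open>The other darts around the origin of \<open>f\<close>, in clockwise order starting just after \<open>f\<close>.\<close>

definition darts_after :: "'d rmap \<Rightarrow> 'd \<Rightarrow> 'd list" where
  "darts_after M f = map (\<lambda>i. (rot M ^^ i) f) [1..<card (vertex_of M f)]"

text \<open>
  \<open>explore M p ds E \<delta>\<close> examines the darts \<open>ds\<close> leaving a vertex of depth \<open>p\<close>, where \<open>E\<close> is the
  set of edges already examined and \<open>\<delta>\<close> assigns their depths to the visited vertices. It returns
  the children created, in order of creation, and the updated \<open>E\<close> and \<open>\<delta>\<close>. A new vertex \<open>y\<close>
  reached via \<open>d\<close> is explored starting just after \<open>opp M d\<close>, the dart of the same edge that
  leaves \<open>y\<close>. The test \<open>finite (darts M) \<and> d \<in> darts M\<close> always succeeds on a planar map and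
  is only needed for termination.
\<close>

function explore ::
  "'d rmap \<Rightarrow> int \<Rightarrow> 'd list \<Rightarrow> 'd set set \<Rightarrow> ('d set \<rightharpoonup> int) \<Rightarrow>
    dtree list \<times> 'd set set \<times> ('d set \<rightharpoonup> int)" where
  "explore M p [] E \<delta> = ([], E, \<delta>)"
| "explore M p (d # ds) E \<delta> =
    (if edge_of M d \<in> E \<or> \<not> (finite (darts M) \<and> d \<in> darts M) then explore M p ds E \<delta>
     else
       (case \<delta> (vertex_of M (opp M d)) of
          Some k \<Rightarrow>
            (case explore M p ds (insert (edge_of M d) E) \<delta> of
               (ts, E', \<delta>') \<Rightarrow> (Leaf k # ts, E', \<delta>'))
        | None \<Rightarrow>
            (case explore M (p + 1) (darts_after M (opp M d)) (insert (edge_of M d) E)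
                    (\<delta>(vertex_of M (opp M d) \<mapsto> p + 1)) of
               (us, E', \<delta>') \<Rightarrow>
                 (case explore M p ds E' \<delta>' of
                    (ts, E'', \<delta>'') \<Rightarrow> (Node (rev us) # ts, E'', \<delta>'')))))"
  by pat_completeness auto

lemma explore_examined_mono:
  assumes "explore_dom (M, p, ds, E, \<delta>)" "explore M p ds E \<delta> = (ts, E', \<delta>')"
  shows "E \<subseteq> E'"
  using assms
proof (induction M p ds E \<delta> arbitrary: ts E' \<delta>' rule: explore.pinduct)
  case (1 M p E \<delta>)
  then show ?case by (simp add: explore.psimps)
next
  case (2 M p d ds E \<delta>)
  let ?skip = "edge_of M d \<in> E \<or> \<not> (finite (darts M) \<and> d \<in> darts M)"
  let ?E = "insert (edge_of M d) E"
  note step = explore.psimps(2)[OF "2.hyps"]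
  show ?case
  proof (cases ?skip)
    case True
    with "2.prems" have "explore M p ds E \<delta> = (ts, E', \<delta>')" by (simp only: step if_True)
    with "2.IH"(1)[OF True] show ?thesis by blast
  next
    case new: False
    show ?thesis
    proof (cases "\<delta> (vertex_of M (opp M d))")
      case (Some k)
      obtain ts1 E1 \<delta>1 where e: "explore M p ds ?E \<delta> = (ts1, E1, \<delta>1)" by (metis prod_cases3)
      with "2.prems" have "E' = E1" by (simp only: step new if_False Some option.case prod.case) simp
      with "2.IH"(4)[OF new Some e] show ?thesis by blast
    next
      case None
      let ?\<delta> = "\<delta>(vertex_of M (opp M d) \<mapsto> p + 1)"
      obtain us E1 \<delta>1
        where e1: "explore M (p + 1) (darts_after M (opp M d)) ?E ?\<delta> = (us, E1, \<delta>1)"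
        by (metis prod_cases3)
      obtain ts1 E2 \<delta>2 where e2: "explore M p ds E1 \<delta>1 = (ts1, E2, \<delta>2)" by (metis prod_cases3)
      from "2.prems" e1 e2 have "E' = E2"
        by (simp only: step new if_False None option.case prod.case) simp
      with "2.IH"(2)[OF new None e1] "2.IH"(3)[OF new None e1[symmetric] refl e2]
      show ?thesis by blast
    qed
  qed
qed

lemma card_unexamined_less:
  assumes "finite (darts M)" "d \<in> darts M" "edge_of M d \<notin> E" "insert (edge_of M d) E \<subseteq> E'"
  shows "card (edges M - E') < card (edges M - E)"
  using assms by (intro psubset_card_mono) (auto simp: edges_def)

termination
proof (relation "inv_image (less_than <*lex*> less_than)
    (\<lambda>(M, p, ds, E, \<delta>). (card (edges M - E), length ds))", goal_cases)
  case (4 M p d ds E \<delta> us q E' \<delta>')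
  then have "insert (edge_of M d) E \<subseteq> E'" by (metis explore_examined_mono)
  with 4 have "card (edges M - E') < card (edges M - E)" by (intro card_unexamined_less) auto
  then show ?case by simp
qed (auto intro: card_unexamined_less)

definition T_map :: "'d rmap \<Rightarrow> dtree" where
  "T_map M =
    (let r = root_dart M; r' = opp M r in
      Node (rev (fst (explore M 0 (darts_after M r') {root_edge M}
        [vertex_of M r \<mapsto> -1, vertex_of M r' \<mapsto> 0]))))"

end

theory Submission
  imports Defs
begin

text \<open>
  Both sides are computed by recursion on the map. The depth-first search from the head of the root
  edge \<open>e\<close> never leaves a block of \<open>M/e\<close> except through the two ends of \<open>e\<close>, which are already
  visited, so each block contributes exactly one child of the root of the tree. The point where
  planarity enters is that the darts of the innermost block are consecutive around the head of \<open>e\<close>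
  and come last, so that this block contributes the leftmost child: the face of \<open>M/e\<close> at the first
  corner of this run also leaves the block at the tail of \<open>e\<close>, and cutting the contracted vertex
  along this face disconnects the map by Euler's inequality. The search inside the innermost block
  is the search of the contracted block with all depths shifted by one and both ends of \<open>e\<close>
  identified, which is the effect of \<open>\<Pi>\<close> on trees.
\<close>

section \<open>Orbits of permutations\<close>

text \<open>Separability speaks of partitions of edges with a unique common vertex, which is awkward
  to combine with submaps and contraction. It is replaced by \<open>tight\<close>: a set of darts
  closed under reversal, and under rotation at all vertices but one, is trivial. Letting rotation
  fail at both ends of \<open>e\<close> gives \<open>bridge_closed\<close>, whose minimal nonempty
  sets are the bridges of the two ends in the sense of Tutte. Contraction turns the two exceptional
  vertices into one, so a bridge becomes a block of \<open>M/e\<close>, and statements about blocks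
  become statements about closed sets. Two descriptions of the innermost block have to be
  reconciled: the recursion on maps finds it by the core face, the search by the last dart before
  the root. Both lead to the same bridge \<open>A\<close>, because in an NSP-map no face has two
  corners at a vertex. Planarity enters through counting alone. A transposition changes the number
  of cycles of a permutation by one, so the effect of adding an edge, or of cutting a vertex along a
  curve, on the Euler characteristic is read off from permutations.\<close>

lemma card_merge_classes:
  assumes fin: "finite D" and x: "x \<in> D" and y: "y \<in> D"
    and self: "\<And>z. z \<in> D \<Longrightarrow> z \<in> c z"
    and disj: "\<And>z w. z \<in> D \<Longrightarrow> w \<in> D \<Longrightarrow> c z = c w \<or> c z \<inter> c w = {}"
    and xy: "c x \<noteq> c y"
    and c': "\<And>z. z \<in> D \<Longrightarrow> c' z = (if z \<in> c x \<union> c y then c x \<union> c y else c z)"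
    and sub: "\<And>z. z \<in> D \<Longrightarrow> c z \<subseteq> D"
  shows "Suc (card (c' ` D)) = card (c ` D)"
proof -
  have mem: "z \<in> c x \<longleftrightarrow> c z = c x" "z \<in> c y \<longleftrightarrow> c z = c y" if "z \<in> D" for z
    using self[OF that] disj[OF that x] disj[OF that y] by blast+
  have "c x \<union> c y \<notin> c ` D"
  proof
    assume "c x \<union> c y \<in> c ` D"
    then obtain z where z: "z \<in> D" "c z = c x \<union> c y" by auto
    then have "c z = c x" "c z = c y"
      using disj[OF z(1) x] disj[OF z(1) y] self x y by blast+
    with xy show False by simp
  qed
  moreover have "c' ` D = insert (c x \<union> c y) (c ` D - {c x, c y})"
  proof (intro equalityI subsetI)
    fix X assume "X \<in> c' ` D"
    then obtain z where "z \<in> D" "X = c' z" by auto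
    then show "X \<in> insert (c x \<union> c y) (c ` D - {c x, c y})"
      using c' mem by auto
  next
    fix X assume "X \<in> insert (c x \<union> c y) (c ` D - {c x, c y})"
    then show "X \<in> c' ` D"
    proof
      assume "X = c x \<union> c y"
      then have "X = c' x" using c'[OF x] self[OF x] by auto
      then show ?thesis using x by blast
    next
      assume "X \<in> c ` D - {c x, c y}"
      then obtain z where z: "z \<in> D" "X = c z" "c z \<noteq> c x" "c z \<noteq> c y" by auto
      then have "c' z = X" using c' mem by auto
      then show ?thesis using z by blast
    qed
  qed
  moreover have "card (c ` D - {c x, c y}) = card (c ` D) - 2" "2 \<le> card (c ` D)"
  proof -
    have s: "{c x, c y} \<subseteq> c ` D" using x y by auto
    show "card (c ` D - {c x, c y}) = card (c ` D) - 2"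
      using card_Diff_subset[OF _ s] xy by (simp add: card_insert_if)
    show "2 \<le> card (c ` D)"
      using card_mono[OF _ s] fin xy by simp
  qed
  ultimately show ?thesis using fin by simp
qed

locale finite_perm =
  fixes D :: "'d set" and f :: "'d \<Rightarrow> 'd"
  assumes finite_D: "finite D" and permutes_D: "f permutes D"
begin

lemma perm: "permutation f"
  using finite_D permutes_D permutation_permutes by blast

lemma self_in_orbit [simp]: "d \<in> orbit f d"
  by (rule permutation_self_in_orbit[OF perm])

lemma orbit_eq: "y \<in> orbit f x \<Longrightarrow> orbit f y = orbit f x"
  by (meson orbit_cyclic_eq3 cyclic_on_orbit finite_D permutes_D)

lemma orbit_sym: "y \<in> orbit f x \<Longrightarrow> x \<in> orbit f y"
  using orbit_eq by fastforce

lemma orbit_disjoint: "orbit f x = orbit f y \<or> orbit f x \<inter> orbit f y = {}"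
  using orbit_eq by blast

lemma orbit_sub: "x \<in> D \<Longrightarrow> orbit f x \<subseteq> D"
  using permutes_D permutes_orbit_subset by fast

lemma finite_orbit_perm: "finite (orbit f x)"
  by (rule finite_orbit) simp

lemma step_in_D [simp]: "f x \<in> D \<longleftrightarrow> x \<in> D"
  by (rule permutes_in_image[OF permutes_D])

lemma outside_D: "x \<notin> D \<Longrightarrow> f x = x"
  using permutes_D by (simp add: permutes_def)

lemma step_eq_iff [simp]: "f x = f y \<longleftrightarrow> x = y"
  using permutes_inj[OF permutes_D] by (auto dest: injD)

text \<open>The iterates before the first return are distinct and fill the orbit, so the return time
  \<open>funpow_dist1 f x x\<close> is the size of the orbit.\<close>

lemma orbit_enum:
  shows funpow_card_orbit: "(f ^^ card (orbit f x)) x = x"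
    and card_orbit_pos: "0 < card (orbit f x)"
    and inj_on_orbit_enum: "inj_on (\<lambda>n. (f ^^ n) x) {0..<card (orbit f x)}"
    and orbit_enum_image: "orbit f x = (\<lambda>n. (f ^^ n) x) ` {0..<card (orbit f x)}"
proof -
  have x: "x \<in> orbit f x" by simp
  have e: "orbit f x = (\<lambda>n. (f ^^ n) x) ` {0..<funpow_dist1 f x x}"
    by (rule orbit_conv_funpow_dist1[OF x])
  have i: "inj_on (\<lambda>n. (f ^^ n) x) {0..<funpow_dist1 f x x}" by (rule inj_on_funpow_dist1[OF x])
  have c: "card (orbit f x) = funpow_dist1 f x x" using card_image[OF i] e by simp
  show "(f ^^ card (orbit f x)) x = x" unfolding c by (rule funpow_dist1_prop[OF x])
  show "0 < card (orbit f x)" by (simp add: c)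
  show "inj_on (\<lambda>n. (f ^^ n) x) {0..<card (orbit f x)}" unfolding c by (rule i)
  show "orbit f x = (\<lambda>n. (f ^^ n) x) ` {0..<card (orbit f x)}" unfolding c by (rule e)
qed

lemma orbit_least:
  assumes "x \<in> Z" "\<And>z. z \<in> Z \<Longrightarrow> z \<in> orbit f x \<Longrightarrow> f z \<in> Z"
  shows "orbit f x \<subseteq> Z"
proof
  fix y assume "y \<in> orbit f x"
  then show "y \<in> Z" by induction (auto simp: assms orbit.step orbit.base)
qed

text \<open>Forward closure along the orbit suffices: on a finite cycle, every element is an iterate
  of every other one.\<close>

lemma orbit_invariant:
  assumes "\<And>z. z \<in> orbit f x \<Longrightarrow> z \<in> Z \<Longrightarrow> f z \<in> Z" "y \<in> orbit f x" "w \<in> orbit f x"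
  shows "y \<in> Z \<longleftrightarrow> w \<in> Z"
proof -
  have "orbit f a \<subseteq> Z" if "a \<in> Z" "a \<in> orbit f x" for a
    using that assms(1) orbit_eq by (intro orbit_least) blast+
  then show ?thesis using assms(2,3) orbit_eq by (metis self_in_orbit subsetD)
qed

lemma step_in_orbit_iff [simp]: "f y \<in> orbit f x \<longleftrightarrow> y \<in> orbit f x"
proof
  assume "f y \<in> orbit f x"
  then have "orbit f (f y) = orbit f x" by (rule orbit_eq)
  then show "y \<in> orbit f x" using orbit_sym[OF orbit.base[of f y]] by simp
qed (rule orbit.step)

end

lemma finite_perm_comp_transpose:
  assumes "finite_perm D f" "x \<in> D" "y \<in> D"
  shows "finite_perm D (f \<circ> transpose x y)"
  using assms by (simp add: finite_perm_def permutes_compose permutes_swap_id)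

text \<open>Precomposition with \<open>transpose x y\<close> exchanges the successors of
  \<open>x\<close> and \<open>y\<close>, which splices two different cycles into one.\<close>

lemma orbit_transpose_merge:
  assumes "finite_perm D f" "x \<in> D" "y \<in> D" and xy: "y \<notin> orbit f x"
  shows "orbit (f \<circ> transpose x y) z =
    (if z \<in> orbit f x \<union> orbit f y then orbit f x \<union> orbit f y else orbit f z)"
proof -
  define g where "g = f \<circ> transpose x y"
  interpret f: finite_perm D f by fact
  interpret g: finite_perm D g
    unfolding g_def by (rule finite_perm_comp_transpose) fact+
  have gx: "g x = f y" and gy: "g y = f x" and go: "\<And>z. z \<noteq> x \<Longrightarrow> z \<noteq> y \<Longrightarrow> g z = f z"
    by (simp_all add: g_def)
  have yx: "x \<notin> orbit f y" using xy f.orbit_sym by blast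
  \<comment> \<open>Under \<open>g\<close>, the element \<open>x\<close> continues with
    \<open>f y\<close> and then follows the cycle of \<open>y\<close> under \<open>f\<close>; a full
    turn of this cycle arrives at \<open>y\<close>.\<close>
  have y_gx: "y \<in> orbit g x"
  proof (rule ccontr)
    assume n: "y \<notin> orbit g x"
    have "f y \<in> orbit g x" using gx by (metis orbit.base)
    have "orbit f (f y) \<subseteq> orbit g x \<inter> orbit f y"
    proof (rule f.orbit_least)
      show "f y \<in> orbit g x \<inter> orbit f y"
        using \<open>f y \<in> orbit g x\<close> by (simp add: orbit.base)
      fix z assume z: "z \<in> orbit g x \<inter> orbit f y"
      then have "z \<noteq> y" "z \<noteq> x" using n yx by auto
      then show "f z \<in> orbit g x \<inter> orbit f y"
        using z go by (metis Int_iff orbit.step)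
    qed
    moreover have "y \<in> orbit f (f y)" using f.orbit_sym orbit.base by fast
    ultimately show False using n by blast
  qed
  have o: "orbit g x = orbit f x \<union> orbit f y"
  proof
    show "orbit g x \<subseteq> orbit f x \<union> orbit f y"
      by (rule g.orbit_least) (use gx gy go in \<open>auto simp: g_def transpose_def\<close>)
  next
    have cl: "f z \<in> orbit g x" if "z \<in> orbit g x" for z
      using that y_gx gx gy go g.step_in_orbit_iff g.self_in_orbit by metis
    have "orbit f x \<subseteq> orbit g x" "orbit f y \<subseteq> orbit g x"
      by (rule f.orbit_least; use y_gx cl in simp)+
    then show "orbit f x \<union> orbit f y \<subseteq> orbit g x" by simp
  qed
  show ?thesis
  proof (cases "z \<in> orbit f x \<union> orbit f y")
    case True
    then have "z \<in> orbit g x" using o by simp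
    then have "orbit g z = orbit g x" by (rule g.orbit_eq)
    then show ?thesis using True o by (simp add: g_def)
  next
    case False
    have "orbit g z = orbit f z"
    proof (rule orbit_cong)
      fix s assume "s \<in> orbit f z"
      then have "s \<noteq> x" "s \<noteq> y" using False f.orbit_sym by auto
      then show "g s = f s" by (rule go)
    qed simp
    then show ?thesis using False by (simp add: g_def)
  qed
qed

text \<open>The arc from \<open>f x\<close> to \<open>y\<close> is closed under the new permutation,
  because \<open>y\<close> is now sent back to \<open>f x\<close>; it does not contain
  \<open>x\<close>.\<close>

lemma orbit_transpose_splits:
  assumes "finite_perm D f" "x \<in> D" "y \<in> D" and xy: "y \<in> orbit f x" "x \<noteq> y"
  shows "y \<notin> orbit (f \<circ> transpose x y) x"
proof -
  define g where "g = f \<circ> transpose x y"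
  interpret f: finite_perm D f by fact
  interpret g: finite_perm D g
    unfolding g_def by (rule finite_perm_comp_transpose) fact+
  define n where "n = funpow_dist1 f x y"
  have n: "(f ^^ n) x = y" "0 < n"
    unfolding n_def using funpow_dist1_prop xy(1) by fast+
  have nx: "(f ^^ i) x \<noteq> x" "i < n \<Longrightarrow> (f ^^ i) x \<noteq> y" if "0 < i" "i \<le> n" for i
  proof -
    show "i < n \<Longrightarrow> (f ^^ i) x \<noteq> y" using that funpow_dist1_least n_def by metis
    show "(f ^^ i) x \<noteq> x"
    proof
      assume e: "(f ^^ i) x = x"
      have "i \<noteq> n" using e n xy(2) by auto
      then have "(f ^^ (n - i)) x = y" using n e that
        by (metis funpow_add le_add_diff_inverse2 o_apply)
      then show False using funpow_dist1_least[of "n - i" f x y] that \<open>i \<noteq> n\<close> n_def by simp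
    qed
  qed
  define S where "S = (\<lambda>i. (f ^^ i) x) ` {1..n}"
  have "orbit g y \<subseteq> S"
  proof (rule g.orbit_least)
    show "y \<in> S" using n unfolding S_def by force
    fix z assume "z \<in> S"
    then obtain i where i: "1 \<le> i" "i \<le> n" "z = (f ^^ i) x" by (auto simp: S_def)
    show "g z \<in> S"
    proof (cases "i = n")
      case True
      then have "g z = (f ^^ 1) x" using i n by (simp add: g_def)
      then show ?thesis unfolding S_def by (rule image_eqI) (use n in simp)
    next
      case False
      then have "g z = (f ^^ Suc i) x" using i nx[of i] by (simp add: g_def)
      then show ?thesis unfolding S_def by (rule image_eqI) (use i False in simp)
    qed
  qed
  moreover have "x \<notin> S"
  proof
    assume "x \<in> S"
    then obtain i where "i \<in> {1..n}" "x = (f ^^ i) x" unfolding S_def by (rule imageE)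
    then show False using nx(1)[of i] by auto
  qed
  ultimately have "x \<notin> orbit g y" by blast
  then show ?thesis using g.orbit_sym unfolding g_def by blast
qed

lemma card_orbits_merge:
  assumes "finite_perm D f" "x \<in> D" "y \<in> D" "y \<notin> orbit f x"
  shows "Suc (card (orbit (f \<circ> transpose x y) ` D)) = card (orbit f ` D)"
proof -
  interpret f: finite_perm D f by fact
  show ?thesis
  proof (rule card_merge_classes)
    show "orbit f x \<noteq> orbit f y" using assms(4) by (metis f.self_in_orbit)
  qed (use assms f.finite_D f.orbit_disjoint f.orbit_sub orbit_transpose_merge[OF assms] in auto)
qed

text \<open>The transposition is an involution, so this is the merging count read backwards.\<close>

lemma card_orbits_split:
  assumes "finite_perm D f" "x \<in> D" "y \<in> D" "y \<in> orbit f x" "x \<noteq> y"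
  shows "card (orbit (f \<circ> transpose x y) ` D) = Suc (card (orbit f ` D))"
  using card_orbits_merge[OF finite_perm_comp_transpose[OF assms(1-3)] assms(2,3)
      orbit_transpose_splits[OF assms]]
  by (simp add: comp_assoc)

lemma card_orbits_transpose_le:
  assumes "finite_perm D f" "x \<in> D" "y \<in> D"
  shows "card (orbit (f \<circ> transpose x y) ` D) \<le> Suc (card (orbit f ` D))"
proof (cases "x = y")
  case False
  then show ?thesis
    using card_orbits_merge[OF assms] card_orbits_split[OF assms] by fastforce
qed simp

section \<open>First-return maps and their orbits\<close>

context finite_perm
begin

lemma first_return_exists:
  assumes "d \<in> S"
  shows "\<exists>n. 0 < n \<and> (f ^^ n) d \<in> S"
  using self_in_orbit[of d] assms by (auto simp: orbit_altdef)

lemma first_return_in_orbit: "first_return f S d \<in> orbit f d"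
  unfolding first_return_def by (metis funpow_in_orbit self_in_orbit)

lemma first_return_in:
  assumes "\<exists>n. 0 < n \<and> (f ^^ n) d \<in> S"
  shows "first_return f S d \<in> S"
  unfolding first_return_def using LeastI_ex[OF assms] by simp

lemma first_return_step: "f d \<in> S \<Longrightarrow> first_return f S d = f d"
proof -
  assume "f d \<in> S"
  then have "(LEAST n. 0 < n \<and> (f ^^ n) d \<in> S) = 1"
    by (intro Least_equality) auto
  then show ?thesis by (simp add: first_return_def)
qed

lemma first_return_skip:
  assumes "f d \<notin> S" and ex: "\<exists>n. 0 < n \<and> (f ^^ n) d \<in> S"
  shows "first_return f S d = first_return f S (f d)"
proof -
  define P where "P = (\<lambda>n. 0 < n \<and> (f ^^ n) d \<in> S)"
  have "\<exists>n. P n" using ex by (simp add: P_def)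
  moreover have "\<not> P 0" by (simp add: P_def)
  ultimately have "(LEAST n. P n) = Suc (LEAST n. P (Suc n))"
    using Least_Suc by blast
  moreover have "P (Suc n) \<longleftrightarrow> 0 < n \<and> (f ^^ n) (f d) \<in> S" for n
    using assms(1) by (cases n) (auto simp: P_def funpow_swap1)
  ultimately show ?thesis
    unfolding first_return_def P_def[symmetric] by (simp add: funpow_swap1)
qed

definition restricted :: "'d set \<Rightarrow> 'd \<Rightarrow> 'd" where
  "restricted S d = (if d \<in> S then first_return f S d else d)"

lemma restricted_in: "d \<in> S \<Longrightarrow> restricted S d \<in> S"
  by (simp add: restricted_def first_return_in first_return_exists)

text \<open>If two points of \<open>S\<close> with return times \<open>n \<le> m\<close> return to
  the same point, the second one passes through the first after \<open>m - n\<close> steps. This is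
  before its first return, so \<open>m = n\<close> and the points agree.\<close>

lemma restricted_permutes:
  assumes "S \<subseteq> D"
  shows "restricted S permutes S"
proof -
  have "inj_on (restricted S) S"
  proof -
    have *: "d = d'" if dd: "d \<in> S" "d' \<in> S" "restricted S d = restricted S d'"
      and le: "(LEAST n. 0 < n \<and> (f ^^ n) d \<in> S) \<le> (LEAST n. 0 < n \<and> (f ^^ n) d' \<in> S)" for d d'
    proof -
      define n where "n = (LEAST n. 0 < n \<and> (f ^^ n) d \<in> S)"
      define m where "m = (LEAST n. 0 < n \<and> (f ^^ n) d' \<in> S)"
      have n: "0 < n" using LeastI_ex[OF first_return_exists[OF dd(1)]] by (simp add: n_def)
      have "(f ^^ n) d = (f ^^ m) d'"
        using dd by (simp add: restricted_def first_return_def n_def m_def)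
      also have "\<dots> = (f ^^ n) ((f ^^ (m - n)) d')"
        using le by (simp add: n_def m_def flip: funpow_add[unfolded o_def, THEN fun_cong])
      finally have e: "d = (f ^^ (m - n)) d'"
        using inj_fn[OF permutes_inj[OF permutes_D]] by (metis injD)
      have "\<not> 0 < m - n"
      proof
        assume "0 < m - n"
        then have "m \<le> m - n" using e dd(1) unfolding m_def by (intro Least_le) auto
        then show False using n \<open>0 < m - n\<close> by simp
      qed
      then show "d = d'" using e by simp
    qed
    show ?thesis
    proof (rule inj_onI)
      fix d d' assume dd: "d \<in> S" "d' \<in> S" "restricted S d = restricted S d'"
      show "d = d'"
      proof (rule linorder_le_cases)
        assume "(LEAST n. 0 < n \<and> (f ^^ n) d \<in> S) \<le> (LEAST n. 0 < n \<and> (f ^^ n) d' \<in> S)"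
        with dd show ?thesis by (rule *)
      next
        assume "(LEAST n. 0 < n \<and> (f ^^ n) d' \<in> S) \<le> (LEAST n. 0 < n \<and> (f ^^ n) d \<in> S)"
        with dd(2,1) dd(3)[symmetric] have "d' = d" by (rule *)
        then show ?thesis ..
      qed
    qed
  qed
  moreover have "restricted S ` S \<subseteq> S" using restricted_in by blast
  moreover have "finite S" using assms finite_D finite_subset by blast
  ultimately have "bij_betw (restricted S) S S"
    by (simp add: bij_betw_def endo_inj_surj)
  then show ?thesis by (rule bij_imp_permutes) (simp add: restricted_def)
qed

lemma restricted_perm: "S \<subseteq> D \<Longrightarrow> finite_perm S (restricted S)"
  using restricted_permutes finite_subset[OF _ finite_D] by (simp add: finite_perm_def)

lemma orbit_restricted:
  assumes "S \<subseteq> D" "d \<in> S"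
  shows "orbit (restricted S) d = orbit f d \<inter> S"
proof
  interpret g: finite_perm S "restricted S" by (rule restricted_perm) fact
  show "orbit (restricted S) d \<subseteq> orbit f d \<inter> S"
  proof (rule g.orbit_least)
    fix z assume z: "z \<in> orbit f d \<inter> S"
    then show "restricted S z \<in> orbit f d \<inter> S"
      using restricted_in first_return_in_orbit[of S z] orbit_eq[of z d]
      by (auto simp: restricted_def first_return_in first_return_exists)
  qed (use assms in simp)
  \<comment> \<open>Induction on the number of steps: a walk that ends in \<open>S\<close> begins
    with a first return, and what remains is shorter.\<close>
  have "\<forall>d\<in>S. (f ^^ n) d \<in> S \<longrightarrow> (f ^^ n) d \<in> orbit (restricted S) d" for n
  proof (induction n rule: less_induct)
    case (less n)
    show ?case
    proof (intro ballI impI)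
      fix d assume d: "d \<in> S" "(f ^^ n) d \<in> S"
      show "(f ^^ n) d \<in> orbit (restricted S) d"
      proof (cases "n = 0")
        case False
        define m where "m = (LEAST n. 0 < n \<and> (f ^^ n) d \<in> S)"
        have m: "0 < m" "m \<le> n" "restricted S d = (f ^^ m) d"
          using LeastI_ex[OF first_return_exists[OF d(1)]] d False
          by (auto simp: m_def restricted_def first_return_def intro!: Least_le)
        then have e: "(f ^^ n) d = (f ^^ (n - m)) (restricted S d)"
          by (simp flip: funpow_add[unfolded o_def, THEN fun_cong])
        have "(f ^^ (n - m)) (restricted S d) \<in> orbit (restricted S) (restricted S d)"
          using less.IH[of "n - m"] m restricted_in[OF d(1)] d(2) e by simp
        then show ?thesis using e permutation_orbit_step[OF g.perm] by simp
      qed simp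
    qed
  qed
  then show "orbit f d \<inter> S \<subseteq> orbit (restricted S) d"
    using assms(2) by (auto simp: orbit_altdef_permutation[OF perm])
qed

text \<open>Intersection with \<open>S\<close> matches the orbits that meet \<open>S\<close> with
  those of the first-return map. This is the source of all counts of vertices and faces under
  deletion and contraction.\<close>

lemma card_orbits_restricted:
  assumes "S \<subseteq> D"
  shows "card (orbit f ` D) = card (orbit (restricted S) ` S) + card {X \<in> orbit f ` D. X \<inter> S = {}}"
proof -
  have "orbit f ` D = orbit f ` S \<union> {X \<in> orbit f ` D. X \<inter> S = {}}"
  proof (intro equalityI subsetI)
    fix X assume "X \<in> orbit f ` D"
    then show "X \<in> orbit f ` S \<union> {X \<in> orbit f ` D. X \<inter> S = {}}"
      using orbit_eq by (cases "X \<inter> S = {}") blast+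
  qed (use assms in auto)
  moreover have "orbit f ` S \<inter> {X \<in> orbit f ` D. X \<inter> S = {}} = {}"
    by auto
  moreover have "finite (orbit f ` D)" using finite_D by simp
  ultimately have "card (orbit f ` D) = card (orbit f ` S) + card {X \<in> orbit f ` D. X \<inter> S = {}}"
    by (metis (no_types, lifting) card_Un_disjoint finite_Un)
  moreover have "card (orbit (restricted S) ` S) = card (orbit f ` S)"
  proof -
    have "orbit (restricted S) ` S = (\<lambda>X. X \<inter> S) ` (orbit f ` S)"
      using orbit_restricted[OF assms] by (auto simp: image_iff)
    moreover have "inj_on (\<lambda>X. X \<inter> S) (orbit f ` S)"
    proof (rule inj_onI, clarsimp)
      fix x y assume "x \<in> S" "y \<in> S" "orbit f x \<inter> S = orbit f y \<inter> S"
      then have "x \<in> orbit f y" using self_in_orbit[of x] by blast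
      then show "orbit f x = orbit f y" by (rule orbit_eq)
    qed
    ultimately show ?thesis by (simp add: card_image)
  qed
  ultimately show ?thesis by simp
qed

end

section \<open>Combinatorial maps and the Euler inequality\<close>

text \<open>These are the conditions that survive every operation below. Connectedness, Euler's
  formula and the position of the root are left out: a map cut along a curve falls apart, and a
  submap may miss the root edge.\<close>

locale comb_map =
  fixes M :: "'d rmap"
  assumes finite_darts: "finite (darts M)"
    and rot_permutes: "rot M permutes darts M"
    and opp_permutes: "opp M permutes darts M"
    and opp_neq: "d \<in> darts M \<Longrightarrow> opp M d \<noteq> d"
    and opp_opp_darts: "d \<in> darts M \<Longrightarrow> opp M (opp M d) = d"
begin

sublocale R: finite_perm "darts M" "rot M"
  by unfold_locales (fact finite_darts rot_permutes)+

sublocale O: finite_perm "darts M" "opp M"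
  by unfold_locales (fact finite_darts opp_permutes)+

sublocale F: finite_perm "darts M" "rot M \<circ> opp M"
  by unfold_locales (simp_all add: finite_darts permutes_compose[OF opp_permutes rot_permutes])

lemma opp_opp [simp]: "opp M (opp M d) = d"
  using opp_opp_darts O.outside_D by (cases "d \<in> darts M") simp_all

lemma opp_eq_iff: "opp M d = d' \<longleftrightarrow> d = opp M d'"
  by auto

lemma self_in_vertex [simp]: "d \<in> vertex_of M d"
  by (simp add: vertex_of_def)

lemma vertex_of_eq: "d' \<in> vertex_of M d \<Longrightarrow> vertex_of M d' = vertex_of M d"
  by (simp add: vertex_of_def R.orbit_eq)

lemma vertex_of_eq_iff: "vertex_of M d' = vertex_of M d \<longleftrightarrow> d' \<in> vertex_of M d"
  using vertex_of_eq self_in_vertex by metis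

lemma in_vertex_sym: "d' \<in> vertex_of M d \<longleftrightarrow> d \<in> vertex_of M d'"
  using vertex_of_eq self_in_vertex by metis

lemma vertex_of_subset: "d \<in> darts M \<Longrightarrow> vertex_of M d \<subseteq> darts M"
  by (simp add: vertex_of_def R.orbit_sub)

lemma finite_vertex_of: "finite (vertex_of M d)"
  by (simp add: vertex_of_def R.finite_orbit_perm)

lemma rot_in_vertex [simp]: "rot M d' \<in> vertex_of M d \<longleftrightarrow> d' \<in> vertex_of M d"
  by (simp add: vertex_of_def)

lemma vertex_of_rot [simp]: "vertex_of M (rot M d) = vertex_of M d"
  by (rule vertex_of_eq) simp

lemma edge_of_opp [simp]: "edge_of M (opp M d) = edge_of M d"
  by (auto simp: edge_of_def)

lemma edge_of_eq_iff: "edge_of M d = edge_of M d' \<longleftrightarrow> d' = d \<or> d' = opp M d"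
  by (auto simp: edge_of_def doubleton_eq_iff)

lemma edge_of_in_edges [simp]: "edge_of M d \<in> edges M \<longleftrightarrow> d \<in> darts M"
  by (auto simp: edges_def edge_of_eq_iff)

lemma Union_edges [simp]: "\<Union> (edges M) = darts M"
  by (auto simp: edges_def edge_of_def)

lemma finite_edges: "finite (edges M)"
  by (simp add: edges_def finite_darts)

lemma in_edge_of: "e \<in> edges M \<Longrightarrow> d \<in> e \<Longrightarrow> e = edge_of M d"
  by (auto simp: edges_def edge_of_def)

lemma in_Union_iff: "F \<subseteq> edges M \<Longrightarrow> d \<in> \<Union>F \<longleftrightarrow> edge_of M d \<in> F"
  using in_edge_of by (auto simp: edge_of_def)

lemma Union_subset_darts: "F \<subseteq> edges M \<Longrightarrow> \<Union>F \<subseteq> darts M"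
  using Union_edges by blast

lemma opp_in_Union [simp]: "F \<subseteq> edges M \<Longrightarrow> opp M d \<in> \<Union>F \<longleftrightarrow> d \<in> \<Union>F"
  by (simp only: in_Union_iff edge_of_opp)

lemma edges_image_Union: "F \<subseteq> edges M \<Longrightarrow> edge_of M ` \<Union>F = F"
proof (intro equalityI subsetI)
  fix e assume F: "F \<subseteq> edges M" "e \<in> F"
  then obtain x where "e = edge_of M x" by (auto simp: edges_def)
  then show "e \<in> edge_of M ` \<Union>F" using in_Union_iff[OF F(1), of x] F(2) by (metis imageI)
next
  fix e assume F: "F \<subseteq> edges M" "e \<in> edge_of M ` \<Union>F"
  then show "e \<in> F" using in_Union_iff[OF F(1)] by blast
qed

lemma orbit_closed:
  assumes "Z \<subseteq> darts M" "\<And>d. d \<in> Z \<Longrightarrow> rot M d \<in> Z" "d \<in> Z"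
  shows "vertex_of M d \<subseteq> Z"
  unfolding vertex_of_def by (rule R.orbit_least) (use assms in auto)

section \<open>The Euler defect of a partial gluing\<close>

definition some_opp :: "'d set set \<Rightarrow> 'd \<Rightarrow> 'd" where
  "some_opp F d = (if d \<in> \<Union>F then opp M d else d)"

text \<open>Darts outside \<open>F\<close> stay as half-edges with trivial reversal, so a vertex
  without edges of \<open>F\<close> still counts as one face. Since the dart set is fixed, adding an
  edge multiplies this permutation by a single transposition.\<close>

definition some_faces :: "'d set set \<Rightarrow> nat" where
  "some_faces F = card (orbit (rot M \<circ> some_opp F) ` darts M)"

definition moves :: "'d set set \<Rightarrow> ('d \<times> 'd) set" where
  "moves F = {(d, rot M d) | d. d \<in> darts M} \<union> {(d, opp M d) | d. d \<in> \<Union>F}"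

definition component :: "'d set set \<Rightarrow> 'd \<Rightarrow> 'd set" where
  "component F d = (moves F)\<^sup>* `` {d}"

definition num_components :: "'d set set \<Rightarrow> nat" where
  "num_components F = card (component F ` darts M)"

text \<open>Nonnegativity of this quantity is the Euler inequality for the darts with the
  identifications in \<open>F\<close>; it is twice the total genus.\<close>

definition defect :: "'d set set \<Rightarrow> int" where
  "defect F = int (card F) + 2 * int (num_components F) - int (card (vertices M)) - int (some_faces F)"

lemma some_perm:
  assumes "F \<subseteq> edges M"
  shows "finite_perm (darts M) (rot M \<circ> some_opp F)"
proof -
  have "some_opp F permutes darts M"
  proof (rule bij_imp_permutes)
    have "some_opp F (some_opp F d) = d" for d
      using assms by (simp add: some_opp_def del: Union_iff)
    moreover have "some_opp F d \<in> darts M" if "d \<in> darts M" for d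
      using that by (simp add: some_opp_def)
    ultimately show "bij_betw (some_opp F) (darts M) (darts M)"
      by (intro bij_betw_byWitness[where f' = "some_opp F"]) auto
    show "some_opp F d = d" if "d \<notin> darts M" for d
      using that O.outside_D by (simp add: some_opp_def)
  qed
  then show ?thesis
    by (simp add: finite_perm_def finite_darts permutes_compose rot_permutes)
qed

lemma vertex_reachable: "d' \<in> vertex_of M d \<Longrightarrow> d \<in> darts M \<Longrightarrow> (d, d') \<in> (moves F)\<^sup>*"
proof -
  assume d: "d \<in> darts M" and "d' \<in> vertex_of M d"
  then have "d' \<in> orbit (rot M) d" by (simp add: vertex_of_def)
  then show "(d, d') \<in> (moves F)\<^sup>*"
  proof induction
    case base
    then show ?case using d by (auto simp: moves_def)
  next
    case (step y)
    then have "y \<in> darts M" using R.orbit_sub[OF d] by blast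
    then show ?case using step by (auto simp: moves_def intro: rtrancl.rtrancl_into_rtrancl)
  qed
qed

lemma moves_sym:
  assumes "F \<subseteq> edges M"
  shows "sym ((moves F)\<^sup>*)"
proof (rule symI)
  fix x y assume "(x, y) \<in> (moves F)\<^sup>*"
  then show "(y, x) \<in> (moves F)\<^sup>*"
  proof induction
    case (step y z)
    have "(z, y) \<in> (moves F)\<^sup>*"
    proof (cases "y \<in> darts M \<and> z = rot M y")
      case True
      then show ?thesis by (intro vertex_reachable) (simp_all add: in_vertex_sym[of y])
    next
      case False
      then have "y \<in> \<Union>F" "z = opp M y" using step by (auto simp: moves_def)
      then have "z \<in> \<Union>F" "y = opp M z" using opp_in_Union[OF assms, of y] by (simp_all only: opp_opp)
      then show ?thesis by (auto simp: moves_def)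
    qed
    then show ?case using step by simp
  qed simp
qed

lemma component_self [simp]: "d \<in> component F d"
  by (simp add: component_def)

lemma component_eq: "F \<subseteq> edges M \<Longrightarrow> y \<in> component F x \<Longrightarrow> component F y = component F x"
  using moves_sym unfolding component_def
  by (auto dest: symD intro: rtrancl_trans)

lemma component_subset:
  assumes "F \<subseteq> edges M" "d \<in> darts M"
  shows "component F d \<subseteq> darts M"
proof
  fix y assume "y \<in> component F d"
  then have "(d, y) \<in> (moves F)\<^sup>*" by (simp add: component_def)
  then show "y \<in> darts M"
    by induction (use assms(2) in \<open>auto simp: moves_def\<close>)
qed

lemma component_empty: "d \<in> darts M \<Longrightarrow> component {} d = vertex_of M d"
proof
  assume d: "d \<in> darts M"
  show "component {} d \<subseteq> vertex_of M d"
  proof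
    fix y assume "y \<in> component {} d"
    then have "(d, y) \<in> (moves {})\<^sup>*" by (simp add: component_def)
    then show "y \<in> vertex_of M d"
      by induction (auto simp: moves_def)
  qed
  show "vertex_of M d \<subseteq> component {} d"
    using vertex_reachable[OF _ d] by (auto simp: component_def)
qed

text \<open>Without edges, the components, the vertices and the faces are all the orbits of
  \<open>rot M\<close>.\<close>

lemma defect_empty: "defect {} = 0"
proof -
  have "component {} ` darts M = vertices M"
    by (simp add: vertices_def component_empty cong: image_cong)
  moreover have "some_opp {} = id" by (auto simp: some_opp_def)
  then have "orbit (rot M \<circ> some_opp {}) ` darts M = vertices M"
    by (auto simp: vertices_def vertex_of_def)
  ultimately show ?thesis by (simp add: defect_def num_components_def some_faces_def)
qed

end

text \<open>This describes connected components after the addition of one undirected edge: a path in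
  the enlarged graph either can do without the new edge or stays in the two classes that it
  joins.\<close>

lemma rtrancl_insert_sym:
  assumes sym: "sym (R\<^sup>*)"
  shows "(R \<union> {(x, y), (y, x)})\<^sup>* `` {z} =
    (if z \<in> R\<^sup>* `` {x} \<union> R\<^sup>* `` {y} then R\<^sup>* `` {x} \<union> R\<^sup>* `` {y} else R\<^sup>* `` {z})"
    (is "?S\<^sup>* `` _ = _")
proof -
  have mono: "R\<^sup>* \<subseteq> ?S\<^sup>*" by (rule rtrancl_mono) auto
  have le: "(z, w) \<in> ?S\<^sup>* \<Longrightarrow> (z, w) \<in> R\<^sup>* \<or>
      (z \<in> R\<^sup>* `` {x} \<union> R\<^sup>* `` {y} \<and> w \<in> R\<^sup>* `` {x} \<union> R\<^sup>* `` {y})" for w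
  proof (induction rule: rtrancl_induct)
    case (step w v)
    show ?case
    proof (cases "(w, v) \<in> R")
      case True
      then show ?thesis using step.IH by (auto intro: rtrancl.rtrancl_into_rtrancl)
    next
      case False
      then have "(w = x \<and> v = y) \<or> (w = y \<and> v = x)" using step by auto
      then show ?thesis using step.IH symD[OF sym] by auto
    qed
  qed simp
  show ?thesis
  proof (cases "z \<in> R\<^sup>* `` {x} \<union> R\<^sup>* `` {y}")
    case True
    have xy: "(x, y) \<in> ?S\<^sup>*" "(y, x) \<in> ?S\<^sup>*" by auto
    have "(z, x) \<in> ?S\<^sup>* \<and> (z, y) \<in> ?S\<^sup>*"
      using True symD[OF sym] mono xy by (auto intro: rtrancl_trans)
    then have "w \<in> ?S\<^sup>* `` {z}" if "w \<in> R\<^sup>* `` {x} \<union> R\<^sup>* `` {y}" for w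
      using that mono by (auto intro: rtrancl_trans)
    moreover have "w \<in> R\<^sup>* `` {x} \<union> R\<^sup>* `` {y}" if "w \<in> ?S\<^sup>* `` {z}" for w
      using le[of w] that True by (auto intro: rtrancl_trans)
    ultimately show ?thesis using True by auto
  next
    case False
    then show ?thesis using le mono by auto
  qed
qed

context comb_map
begin

lemma moves_insert:
  assumes "F \<subseteq> edges M" "x \<in> darts M"
  shows "moves (insert (edge_of M x) F) = moves F \<union> {(x, opp M x), (opp M x, x)}"
  by (auto simp: moves_def edge_of_def)

lemma component_insert:
  assumes "F \<subseteq> edges M" "x \<in> darts M"
  shows "component (insert (edge_of M x) F) z =
    (if z \<in> component F x \<union> component F (opp M x) then component F x \<union> component F (opp M x)
     else component F z)"
  unfolding component_def moves_insert[OF assms] by (rule rtrancl_insert_sym[OF moves_sym[OF assms(1)]])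

lemma some_opp_insert:
  assumes "F \<subseteq> edges M" "x \<in> darts M" "edge_of M x \<notin> F"
  shows "some_opp (insert (edge_of M x) F) = some_opp F \<circ> transpose x (opp M x)"
proof
  fix d
  have n: "x \<notin> \<Union>F" "opp M x \<notin> \<Union>F" using assms by (simp_all only: in_Union_iff edge_of_opp) auto
  show "some_opp (insert (edge_of M x) F) d = (some_opp F \<circ> transpose x (opp M x)) d"
  proof (cases "d = x \<or> d = opp M x")
    case True
    then show ?thesis using n by (auto simp: some_opp_def edge_of_def)
  next
    case False
    then show ?thesis by (auto simp: some_opp_def edge_of_def)
  qed
qed

lemma some_orbit_in_component:
  assumes "F \<subseteq> edges M" "d \<in> darts M"
  shows "orbit (rot M \<circ> some_opp F) d \<subseteq> component F d"
proof -
  interpret G: finite_perm "darts M" "rot M \<circ> some_opp F" by (rule some_perm) fact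
  show ?thesis
  proof (rule G.orbit_least)
    fix z assume z: "z \<in> component F d"
    then have zD: "z \<in> darts M" using component_subset[OF assms] by blast
    have "(z, some_opp F z) \<in> (moves F)\<^sup>*" by (auto simp: some_opp_def moves_def)
    moreover have "some_opp F z \<in> darts M" using zD by (simp add: some_opp_def)
    then have "(some_opp F z, rot M (some_opp F z)) \<in> (moves F)\<^sup>*" by (auto simp: moves_def)
    ultimately show "(rot M \<circ> some_opp F) z \<in> component F d"
      using z by (auto simp: component_def)
  qed simp
qed

text \<open>An edge within a component adds one edge and at most one face. An edge between two
  components removes a component, which counts twice, and merges two faces, since faces stay within
  components; then the defect is unchanged.\<close>

lemma defect_insert:
  assumes F: "F \<subseteq> edges M" "x \<in> darts M" "edge_of M x \<notin> F"
  shows "defect F \<le> defect (insert (edge_of M x) F)"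
proof -
  interpret G: finite_perm "darts M" "rot M \<circ> some_opp F" by (rule some_perm) fact
  have y: "opp M x \<in> darts M" using F by simp
  have fin: "finite F" using F(1) finite_edges finite_subset by blast
  have eq: "rot M \<circ> some_opp (insert (edge_of M x) F) = (rot M \<circ> some_opp F) \<circ> transpose x (opp M x)"
    by (simp add: some_opp_insert[OF F] comp_assoc)
  show ?thesis
  proof (cases "opp M x \<in> component F x")
    case True
    then have "component F (opp M x) = component F x" using component_eq F by blast
    then have "component (insert (edge_of M x) F) z = component F z" for z
      using component_insert[OF F(1,2), of z] component_eq[OF F(1), of z x] by simp
    then have "num_components (insert (edge_of M x) F) = num_components F"
      by (simp add: num_components_def)
    moreover have "some_faces (insert (edge_of M x) F) \<le> Suc (some_faces F)"
      unfolding some_faces_def eq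
      by (rule card_orbits_transpose_le[OF G.finite_perm_axioms F(2) y])
    ultimately show ?thesis using fin F by (simp add: defect_def)
  next
    case False
    have "Suc (num_components (insert (edge_of M x) F)) = num_components F"
      unfolding num_components_def
    proof (rule card_merge_classes[OF finite_darts F(2) y])
      show "component F x \<noteq> component F (opp M x)" using False by (metis component_self)
      show "component F z = component F w \<or> component F z \<inter> component F w = {}" for z w
        using component_eq[OF F(1)] by blast
    qed (use component_insert[OF F(1,2)] component_subset[OF F(1)] in auto)
    moreover have "opp M x \<notin> orbit (rot M \<circ> some_opp F) x"
      using False some_orbit_in_component[OF F(1,2)] by blast
    then have "Suc (some_faces (insert (edge_of M x) F)) = some_faces F"
      unfolding some_faces_def eq
      by (rule card_orbits_merge[OF G.finite_perm_axioms F(2) y])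
    ultimately show ?thesis using fin F by (simp add: defect_def)
  qed
qed

text \<open>Compared with the empty set this is the Euler inequality; compared with the set of all
  edges it makes submaps of planar maps planar.\<close>

lemma defect_mono:
  assumes "G \<subseteq> edges M" "F \<subseteq> G"
  shows "defect F \<le> defect G"
proof -
  have "defect F \<le> defect (F \<union> H)" if "finite H" "H \<subseteq> edges M - F" for H
    using that
  proof (induction H)
    case (insert e H)
    then obtain x where x: "x \<in> darts M" "e = edge_of M x" by (auto simp: edges_def)
    have "defect (F \<union> H) \<le> defect (insert e (F \<union> H))"
      unfolding x(2) by (rule defect_insert) (use insert x assms in auto)
    then show ?case using insert by simp
  qed simp
  from this[of "G - F"] show ?thesis
    using assms finite_edges finite_subset by (metis Diff_mono Un_Diff_cancel finite_Diff order_refl sup.absorb2)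
qed

lemma defect_nonneg: "F \<subseteq> edges M \<Longrightarrow> 0 \<le> defect F"
  using defect_mono[of F "{}"] defect_empty by simp

lemma map_connected_iff_component:
  "map_connected M \<longleftrightarrow> (\<forall>x\<in>darts M. \<forall>y\<in>darts M. y \<in> component (edges M) x)"
  by (simp add: map_connected_def component_def moves_def)

lemma some_opp_edges: "some_opp (edges M) = opp M"
  using O.outside_D by (auto simp: some_opp_def simp del: Union_iff)

lemma defect_edges:
  assumes "map_connected M" "darts M \<noteq> {}"
  shows "defect (edges M) = int (card (edges M)) + 2 - int (card (vertices M)) - int (card (faces M))"
proof -
  have "component (edges M) ` darts M = {darts M}"
    using assms component_subset[OF order_refl] unfolding map_connected_iff_component by blast
  then show ?thesis
    by (simp add: defect_def num_components_def some_faces_def some_opp_edges faces_def face_of_def)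
qed

lemma euler_inequality:
  assumes "map_connected M" "darts M \<noteq> {}"
  shows "card (vertices M) + card (faces M) \<le> card (edges M) + 2"
  using defect_edges[OF assms] defect_nonneg[of "edges M"] by simp

lemma connectedI:
  assumes "\<And>Z. Z \<subseteq> darts M \<Longrightarrow> Z \<noteq> {} \<Longrightarrow> (\<And>d. d \<in> Z \<Longrightarrow> rot M d \<in> Z) \<Longrightarrow>
    (\<And>d. d \<in> Z \<Longrightarrow> opp M d \<in> Z) \<Longrightarrow> Z = darts M"
  shows "map_connected M"
proof -
  have "component (edges M) x = darts M" if "x \<in> darts M" for x
  proof (rule assms)
    show sub: "component (edges M) x \<subseteq> darts M" by (rule component_subset) (use that in auto)
    show "component (edges M) x \<noteq> {}" using component_self by blast
    show "rot M d \<in> component (edges M) x" "opp M d \<in> component (edges M) x"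
      if "d \<in> component (edges M) x" for d
    proof -
      have "d \<in> darts M" using sub that by blast
      then have "(d, rot M d) \<in> moves (edges M)" "(d, opp M d) \<in> moves (edges M)"
        by (auto simp: moves_def simp del: Union_iff)
      then show "rot M d \<in> component (edges M) x" "opp M d \<in> component (edges M) x"
        using that by (auto simp: component_def intro: rtrancl.rtrancl_into_rtrancl)
    qed
  qed
  then show ?thesis by (simp add: map_connected_iff_component)
qed

lemma connected_closed:
  assumes "map_connected M" "Z \<subseteq> darts M" "Z \<noteq> {}"
    "\<And>d. d \<in> Z \<Longrightarrow> rot M d \<in> Z" "\<And>d. d \<in> Z \<Longrightarrow> opp M d \<in> Z"
  shows "Z = darts M"
proof -
  obtain x where x: "x \<in> Z" using assms by blast
  have "y \<in> Z" if "(x, y) \<in> (moves (edges M))\<^sup>*" for y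
    using that by induction (use x assms in \<open>auto simp: moves_def\<close>)
  then have "component (edges M) x \<subseteq> Z" by (auto simp: component_def)
  then show ?thesis using assms x unfolding map_connected_iff_component by blast
qed

end

lemma planar_map_iff:
  "planar_map M \<longleftrightarrow> comb_map M \<and> root_dart M \<in> darts M \<and> map_connected M \<and>
    card (vertices M) + card (faces M) = card (edges M) + 2"
  unfolding planar_map_def comb_map_def by blast

text \<open>A closed curve through one vertex and one face of a planar map separates it: cutting the
  vertex along the curve gains a vertex and a face.\<close>

lemma planar_split_disconnected:
  assumes planar: "planar_map M" and x: "x \<in> darts M" and y: "y \<in> vertex_of M x" "x \<noteq> y"
    and face: "opp M y \<in> face_of M (opp M x)"
  obtains Z where "Z \<subseteq> darts M" "x \<notin> Z" "y \<in> Z"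
    "\<And>d. (rot M \<circ> transpose x y) d \<in> Z \<longleftrightarrow> d \<in> Z" "\<And>d. opp M d \<in> Z \<longleftrightarrow> d \<in> Z"
proof -
  define N where "N = M\<lparr>rot := rot M \<circ> transpose x y\<rparr>"
  interpret M: comb_map M using planar planar_map_iff by blast
  have yD: "y \<in> darts M" using M.vertex_of_subset x y by blast
  interpret N: comb_map N
    by unfold_locales (simp_all add: N_def M.finite_darts M.opp_permutes M.opp_neq
        permutes_compose M.rot_permutes permutes_swap_id x yD)
  have DN: "darts N = darts M" by (simp add: N_def)
  have "card (vertices N) = Suc (card (vertices M))"
    unfolding vertices_def vertex_of_def[abs_def] N_def
    using card_orbits_split[OF M.R.finite_perm_axioms x yD] y by (simp add: vertex_of_def)
  moreover have "card (faces N) = Suc (card (faces M))"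
  proof -
    \<comment> \<open>Conjugation by \<open>opp M\<close> carries the transposition to the other
      side, so one cut of the rotation at \<open>x\<close> and \<open>y\<close> is also one cut of
      the face permutation at \<open>opp M x\<close> and \<open>opp M y\<close>. Both split a
      cycle.\<close>
    have "rot M \<circ> transpose x y \<circ> opp M = rot M \<circ> opp M \<circ> transpose (opp M x) (opp M y)"
      by (auto simp: fun_eq_iff transpose_def M.opp_eq_iff)
    then show ?thesis
      unfolding faces_def face_of_def[abs_def] N_def
      using card_orbits_split[OF M.F.finite_perm_axioms, of "opp M x" "opp M y"] x y yD face
      by (simp add: face_of_def M.opp_eq_iff)
  qed
  moreover have "edges N = edges M" by (simp add: edges_def N_def edge_of_def[abs_def])
  ultimately have "\<not> map_connected N"
    using N.euler_inequality planar x unfolding planar_map_iff by (auto simp: DN)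
  then obtain Z0 where Z0: "Z0 \<subseteq> darts M" "Z0 \<noteq> {}" "Z0 \<noteq> darts M"
    and rot0: "\<And>d. d \<in> Z0 \<Longrightarrow> rot N d \<in> Z0" and opp0: "\<And>d. d \<in> Z0 \<Longrightarrow> opp M d \<in> Z0"
    using N.connectedI DN by (auto simp: N_def)
  have rot_iff: "rot N d \<in> Z0 \<longleftrightarrow> d \<in> Z0" for d
    using N.R.orbit_invariant[of d Z0 d "rot N d"] rot0 orbit.base by fastforce
  have opp_iff: "opp M d \<in> Z0 \<longleftrightarrow> d \<in> Z0" for d using opp0 M.opp_opp by metis
  \<comment> \<open>A closed set that contains both or neither of \<open>x\<close> and
    \<open>y\<close> does not notice the cut, so it would be closed in the connected map
    \<open>M\<close> too.\<close>
  have "x \<in> Z0 \<longleftrightarrow> y \<notin> Z0"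
  proof (rule ccontr)
    assume "(x \<in> Z0) \<noteq> (y \<notin> Z0)"
    then have e: "x \<in> Z0 \<longleftrightarrow> y \<in> Z0" by blast
    have "rot M d \<in> Z0" if "d \<in> Z0" for d
      using rot_iff[of "transpose x y d"] that e by (auto simp: N_def transpose_def split: if_splits)
    then show False using M.connected_closed[of Z0] Z0 opp0 planar planar_map_iff by blast
  qed
  then consider "y \<in> Z0" "x \<notin> Z0" | "x \<in> Z0" "y \<notin> Z0" by blast
  then show ?thesis
  proof cases
    case 1
    show ?thesis
      by (rule that[of Z0]) (use 1 Z0 rot_iff opp_iff in \<open>simp_all add: N_def\<close>)
  next
    case 2
    show ?thesis
    proof (rule that[of "darts M - Z0"])
      show "(rot M \<circ> transpose x y) d \<in> darts M - Z0 \<longleftrightarrow> d \<in> darts M - Z0" for d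
        using rot_iff[of d] N.R.step_in_D[of d] unfolding DN by (simp add: N_def)
      show "opp M d \<in> darts M - Z0 \<longleftrightarrow> d \<in> darts M - Z0" for d
        using opp_iff[of d] by simp
    qed (use 2 Z0 yD in auto)
  qed
qed

section \<open>Non-separability in terms of closed sets of darts\<close>

text \<open>\<open>Z\<close> consists of the darts of a set of edges that share no vertex with the
  other edges, except possibly that of \<open>x\<close>. The condition includes connectedness, which
  non-separability alone does not, and passes to complements, so that a chosen dart may be assumed
  to lie outside \<open>Z\<close>.\<close>

definition tight :: "'d rmap \<Rightarrow> bool" where
  "tight M \<longleftrightarrow> (\<forall>x\<in>darts M. \<forall>Z\<subseteq>darts M. (\<forall>d\<in>Z. opp M d \<in> Z) \<longrightarrow>
    (\<forall>d\<in>Z. d \<notin> vertex_of M x \<longrightarrow> rot M d \<in> Z) \<longrightarrow> Z = {} \<or> Z = darts M)"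

lemma tightD:
  assumes "tight M" "x \<in> darts M" "Z \<subseteq> darts M" "\<And>d. d \<in> Z \<Longrightarrow> opp M d \<in> Z"
    "\<And>d. d \<in> Z \<Longrightarrow> d \<notin> vertex_of M x \<Longrightarrow> rot M d \<in> Z"
  shows "Z = {} \<or> Z = darts M"
  using assms unfolding tight_def by blast

context comb_map
begin

lemma closed_off_iff:
  assumes "\<And>d. d \<in> Z \<Longrightarrow> d \<notin> W \<Longrightarrow> rot M d \<in> Z" "vertex_of M d \<inter> W = {}"
  shows "rot M d \<in> Z \<longleftrightarrow> d \<in> Z"
  by (rule R.orbit_invariant[of d]) (use assms in \<open>auto simp: vertex_of_def orbit.base\<close>)

lemma tight_complement:
  assumes "\<And>d. d \<in> Z \<Longrightarrow> opp M d \<in> Z" "\<And>d. d \<in> Z \<Longrightarrow> d \<notin> vertex_of M x \<Longrightarrow> rot M d \<in> Z"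
  shows "d \<in> darts M - Z \<Longrightarrow> opp M d \<in> darts M - Z"
    "d \<in> darts M - Z \<Longrightarrow> d \<notin> vertex_of M x \<Longrightarrow> rot M d \<in> darts M - Z"
proof -
  assume d: "d \<in> darts M - Z"
  then show "opp M d \<in> darts M - Z" using assms(1)[of "opp M d"] by auto
  assume "d \<notin> vertex_of M x"
  then have "vertex_of M d \<inter> vertex_of M x = {}"
    using vertex_of_eq by (metis disjoint_iff self_in_vertex)
  then show "rot M d \<in> darts M - Z" using closed_off_iff[OF assms(2)] d by simp
qed

lemma tight_imp_connected: "tight M \<Longrightarrow> map_connected M"
proof (rule connectedI)
  fix Z assume t: "tight M" and Z: "Z \<subseteq> darts M" "Z \<noteq> {}"
    "\<And>d. d \<in> Z \<Longrightarrow> rot M d \<in> Z" "\<And>d. d \<in> Z \<Longrightarrow> opp M d \<in> Z"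
  then obtain x where "x \<in> Z" by blast
  then show "Z = darts M" using tightD[OF t, of x Z] Z by blast
qed

text \<open>Walking around a vertex, one can change between the two sides of a separation only at
  the unique common vertex.\<close>

lemma tight_imp_nonseparable:
  assumes t: "tight M"
  shows "\<not> separable M"
proof
  assume "separable M"
  then obtain A B v where AB: "A \<union> B = edges M" "A \<inter> B = {}" "A \<noteq> {}" "B \<noteq> {}"
    and v: "v \<in> vertices M"
    and uniq: "\<And>w. w \<in> vertices M \<Longrightarrow> \<exists>a\<in>A. w \<inter> a \<noteq> {} \<Longrightarrow> \<exists>b\<in>B. w \<inter> b \<noteq> {} \<Longrightarrow> w = v"
    unfolding separable_def by metis
  have A: "A \<subseteq> edges M" using AB by blast
  obtain x where x: "x \<in> darts M" "v = vertex_of M x" using v by (auto simp: vertices_def)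
  have "\<Union>A = {} \<or> \<Union>A = darts M"
  proof (rule tightD[OF t x(1)])
    show "\<Union>A \<subseteq> darts M" by (rule Union_subset_darts) fact
    show "opp M d \<in> \<Union>A" if "d \<in> \<Union>A" for d using opp_in_Union[OF A] that by blast
    fix d assume d: "d \<in> \<Union>A" "d \<notin> vertex_of M x"
    then have dD: "d \<in> darts M" using Union_subset_darts[OF A] by blast
    show "rot M d \<in> \<Union>A"
    proof (rule ccontr)
      assume "rot M d \<notin> \<Union>A"
      then have "edge_of M (rot M d) \<in> B" using AB in_Union_iff[OF A] dD
        by (metis R.step_in_D UnE edge_of_in_edges)
      moreover have "edge_of M d \<in> A" using d in_Union_iff[OF A] by blast
      moreover have "d \<in> vertex_of M d \<inter> edge_of M d"
        "rot M d \<in> vertex_of M d \<inter> edge_of M (rot M d)"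
        by (simp_all add: edge_of_def)
      ultimately have "vertex_of M d = v"
        using dD by (intro uniq) (simp add: vertices_def, blast+)
      then show False using d(2) x(2) self_in_vertex by metis
    qed
  qed
  then show False
  proof
    assume "\<Union>A = {}"
    then show False using AB in_Union_iff[OF A] edges_image_Union[OF A] by auto
  next
    assume "\<Union>A = darts M"
    then have "A = edges M" using edges_image_Union[OF A] by (simp add: edges_def)
    then show False using AB by blast
  qed
qed

text \<open>A proper closed set and its complement form a separation at the vertex of
  \<open>x\<close>: connectedness forces this vertex to meet both sides, while every other vertex
  lies on one side.\<close>

lemma nonseparable_imp_tight:
  assumes conn: "map_connected M" and ns: "\<not> separable M"
  shows "tight M"
  unfolding tight_def
proof (intro ballI allI impI)
  fix x Z
  assume x: "x \<in> darts M" and Z: "Z \<subseteq> darts M" and o: "\<forall>d\<in>Z. opp M d \<in> Z"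
    and r: "\<forall>d\<in>Z. d \<notin> vertex_of M x \<longrightarrow> rot M d \<in> Z"
  show "Z = {} \<or> Z = darts M"
  proof (rule ccontr)
    assume n: "\<not> (Z = {} \<or> Z = darts M)"
    define A where "A = edge_of M ` Z"
    define B where "B = edges M - A"
    have eA: "edge_of M d \<in> A \<longleftrightarrow> d \<in> Z" for d
    proof -
      have "opp M d \<in> Z \<longleftrightarrow> d \<in> Z" using o opp_opp by metis
      then show ?thesis by (auto simp: A_def edge_of_eq_iff)
    qed
    have rot_iff: "rot M d \<in> Z \<longleftrightarrow> d \<in> Z" if "d \<notin> vertex_of M x" for d
    proof (rule closed_off_iff[where W = "vertex_of M x"])
      show "vertex_of M d \<inter> vertex_of M x = {}"
        using that vertex_of_eq by (metis disjoint_iff self_in_vertex)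
    qed (use r in blast)
    have inA: "(\<exists>a\<in>A. w \<inter> a \<noteq> {}) \<longleftrightarrow> w \<inter> Z \<noteq> {}" if "w \<subseteq> darts M" for w
    proof
      assume "\<exists>a\<in>A. w \<inter> a \<noteq> {}"
      then show "w \<inter> Z \<noteq> {}" using o by (auto simp: A_def edge_of_def)
    next
      assume "w \<inter> Z \<noteq> {}"
      then show "\<exists>a\<in>A. w \<inter> a \<noteq> {}" by (auto simp: A_def edge_of_def)
    qed
    have inB: "(\<exists>b\<in>B. w \<inter> b \<noteq> {}) \<longleftrightarrow> \<not> w \<subseteq> Z" if w: "w \<subseteq> darts M" for w
    proof
      assume "\<exists>b\<in>B. w \<inter> b \<noteq> {}"
      then obtain b d where "b \<in> B" "d \<in> w" "d \<in> b" by blast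
      then have "edge_of M d \<in> B" using in_edge_of unfolding B_def by blast
      then have "d \<notin> Z" using eA by (simp add: B_def)
      then show "\<not> w \<subseteq> Z" using \<open>d \<in> w\<close> by blast
    next
      assume "\<not> w \<subseteq> Z"
      then obtain d where "d \<in> w" "d \<notin> Z" by blast
      then have "edge_of M d \<in> B" "d \<in> edge_of M d"
        using eA[of d] w edge_of_in_edges[of d] by (auto simp: B_def) (simp add: edge_of_def)
      then show "\<exists>b\<in>B. w \<inter> b \<noteq> {}" using \<open>d \<in> w\<close> by blast
    qed
    have both: "vertex_of M x \<inter> Z \<noteq> {} \<and> \<not> vertex_of M x \<subseteq> Z"
    proof (rule ccontr)
      assume "\<not> ?thesis"
      then have "rot M d \<in> Z" if "d \<in> Z" for d
        using that rot_iff[of d] rot_in_vertex[of d x] by blast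
      then show False using connected_closed[OF conn Z] n o by blast
    qed
    have "\<exists>!v. v \<in> vertices M \<and> (\<exists>a\<in>A. v \<inter> a \<noteq> {}) \<and> (\<exists>b\<in>B. v \<inter> b \<noteq> {})"
    proof (rule ex1I)
      show "vertex_of M x \<in> vertices M \<and> (\<exists>a\<in>A. vertex_of M x \<inter> a \<noteq> {}) \<and>
          (\<exists>b\<in>B. vertex_of M x \<inter> b \<noteq> {})"
        using both inA inB vertex_of_subset[OF x] x by (simp add: vertices_def)
      fix v assume v: "v \<in> vertices M \<and> (\<exists>a\<in>A. v \<inter> a \<noteq> {}) \<and> (\<exists>b\<in>B. v \<inter> b \<noteq> {})"
      then obtain y where y: "y \<in> darts M" "v = vertex_of M y" by (auto simp: vertices_def)
      have vs: "v \<subseteq> darts M" using vertex_of_subset[OF y(1)] y(2) by simp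
      have "v \<inter> Z \<noteq> {}" using conjunct1[OF conjunct2[OF v]] by (rule inA[OF vs, THEN iffD1])
      moreover have "\<not> v \<subseteq> Z" using conjunct2[OF conjunct2[OF v]] by (rule inB[OF vs, THEN iffD1])
      ultimately obtain p q where pq: "p \<in> v" "p \<in> Z" "q \<in> v" "q \<notin> Z" by blast
      show "v = vertex_of M x"
      proof (rule ccontr)
        assume "v \<noteq> vertex_of M x"
        then have off: "d \<notin> vertex_of M x" if "d \<in> orbit (rot M) y" for d
          using vertex_of_eq[of d x] vertex_of_eq[of d y] that y by (auto simp: vertex_of_def)
        have "p \<in> Z \<longleftrightarrow> q \<in> Z"
        proof (rule R.orbit_invariant[of y])
          show "p \<in> orbit (rot M) y" "q \<in> orbit (rot M) y" using pq y by (simp_all add: vertex_of_def)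
        qed (use rot_iff off in blast)
        then show False using pq by blast
      qed
    qed
    moreover have "A \<noteq> {}" using n by (auto simp: A_def)
    moreover obtain d where "d \<in> darts M" "d \<notin> Z" using n Z by blast
    then have "edge_of M d \<in> B" using eA by (simp add: B_def)
    then have "B \<noteq> {}" by blast
    moreover have "A \<subseteq> edges M" using Z by (auto simp: A_def edges_def)
    then have "A \<union> B = edges M" "A \<inter> B = {}" by (auto simp: B_def)
    ultimately have "separable M"
      unfolding separable_def by (intro exI[of _ A] exI[of _ B] conjI)
    with ns show False ..
  qed
qed

lemma tight_iff: "tight M \<longleftrightarrow> map_connected M \<and> \<not> separable M"
  using tight_imp_connected tight_imp_nonseparable nonseparable_imp_tight by blast

end

lemma nsp_map_iff: "nsp_map M \<longleftrightarrow> planar_map M \<and> tight M \<and> 2 \<le> card (edges M)"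
  using comb_map.tight_iff planar_map_iff unfolding nsp_map_def by blast

section \<open>Submaps of planar maps\<close>

text \<open>The walk stops as soon as it is back in \<open>S\<close>, so values on \<open>S\<close>
  matter only for its first step. This lets a face walk of a submap, which starts with a reversal,
  be compared with a pure rotation around a vertex.\<close>

lemma first_return_cong:
  assumes start: "f d = g d'" and off: "\<And>x. x \<notin> S \<Longrightarrow> f x = g x"
    and ex: "\<exists>n. 0 < n \<and> (f ^^ n) d \<in> S"
  shows "first_return f S d = first_return g S d'"
proof -
  define m where "m = (LEAST n. 0 < n \<and> (f ^^ n) d \<in> S)"
  have m: "0 < m" "(f ^^ m) d \<in> S" using LeastI_ex[OF ex] by (simp_all add: m_def)
  have least: "(f ^^ n) d \<notin> S" if "0 < n" "n < m" for n
    using that not_less_Least unfolding m_def by blast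
  have eq: "0 < n \<Longrightarrow> n \<le> m \<Longrightarrow> (f ^^ n) d = (g ^^ n) d'" for n
  proof (induction n)
    case (Suc n)
    then show ?case using start off least[of n] by (cases "n = 0") simp_all
  qed simp
  have "(LEAST n. 0 < n \<and> (g ^^ n) d' \<in> S) = m"
  proof (rule Least_equality)
    show "0 < m \<and> (g ^^ m) d' \<in> S" using m eq[of m] by simp
    fix n assume n: "0 < n \<and> (g ^^ n) d' \<in> S"
    show "m \<le> n"
    proof (rule ccontr)
      assume "\<not> m \<le> n"
      then show False using n eq[of n] least[of n] by simp
    qed
  qed
  then show ?thesis using eq[of m] m by (simp add: first_return_def m_def)
qed

context comb_map
begin

lemma darts_submap [simp]: "darts (submap M F) = \<Union>F"
  by (simp add: submap_def)

lemma root_submap [simp]: "root_dart (submap M F) = root_dart M"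
  by (simp add: submap_def)

lemma rot_submap: "rot (submap M F) = R.restricted (\<Union>F)"
  by (rule ext) (simp add: submap_def R.restricted_def del: Union_iff)

lemma opp_submap: "opp (submap M F) = some_opp F"
  by (rule ext) (simp add: submap_def some_opp_def del: Union_iff)

lemma opp_submap_in: "d \<in> \<Union>F \<Longrightarrow> opp (submap M F) d = opp M d"
  by (simp add: opp_submap some_opp_def del: Union_iff)

lemma rot_submap_step: "d \<in> \<Union>F \<Longrightarrow> rot M d \<in> \<Union>F \<Longrightarrow> rot (submap M F) d = rot M d"
  by (simp add: rot_submap R.restricted_def R.first_return_step del: Union_iff)

lemma edge_of_submap: "d \<in> \<Union>F \<Longrightarrow> edge_of (submap M F) d = edge_of M d"
  by (simp add: edge_of_def opp_submap_in del: Union_iff)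

lemma edges_submap: "F \<subseteq> edges M \<Longrightarrow> edges (submap M F) = F"
  using edges_image_Union[of F] edge_of_submap[of _ F]
  by (simp add: edges_def del: Union_iff cong: image_cong)

lemma vertex_of_submap:
  "F \<subseteq> edges M \<Longrightarrow> d \<in> \<Union>F \<Longrightarrow> vertex_of (submap M F) d = vertex_of M d \<inter> \<Union>F"
  using R.orbit_restricted[OF Union_subset_darts, of F d] by (simp add: vertex_of_def rot_submap)

lemma some_opp_permutes:
  assumes "F \<subseteq> edges M"
  shows "some_opp F permutes \<Union>F"
proof (rule bij_imp_permutes)
  show "bij_betw (some_opp F) (\<Union>F) (\<Union>F)"
    by (rule bij_betw_byWitness[where f' = "some_opp F"])
      (use opp_in_Union[OF assms] in \<open>auto simp: some_opp_def simp del: Union_iff\<close>)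
qed (simp add: some_opp_def del: Union_iff)

lemma comb_map_submap:
  assumes F: "F \<subseteq> edges M"
  shows "comb_map (submap M F)"
proof
  show "finite (darts (submap M F))"
    using Union_subset_darts[OF F] finite_darts finite_subset by auto
  show "rot (submap M F) permutes darts (submap M F)"
    using R.restricted_permutes[OF Union_subset_darts[OF F]] by (simp add: rot_submap)
  show "opp (submap M F) permutes darts (submap M F)"
    using some_opp_permutes[OF F] by (simp add: opp_submap)
  fix d assume "d \<in> darts (submap M F)"
  then have d: "d \<in> \<Union>F" by simp
  then have d': "opp M d \<in> \<Union>F" using opp_in_Union[OF F] by blast
  show "opp (submap M F) d \<noteq> d"
    using opp_submap_in[OF d] opp_neq Union_subset_darts[OF F] d by auto
  show "opp (submap M F) (opp (submap M F) d) = d"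
    using opp_submap_in[OF d] opp_submap_in[OF d'] by simp
qed

lemma component_isolated:
  assumes "vertex_of M d \<inter> \<Union>F = {}" "d \<in> darts M"
  shows "component F d = vertex_of M d"
proof
  show "vertex_of M d \<subseteq> component F d"
    using vertex_reachable[OF _ assms(2)] by (auto simp: component_def)
  show "component F d \<subseteq> vertex_of M d"
  proof
    fix y assume "y \<in> component F d"
    then have "(d, y) \<in> (moves F)\<^sup>*" by (simp add: component_def)
    then show "y \<in> vertex_of M d"
      by induction (use assms in \<open>auto simp: moves_def\<close>)
  qed
qed

lemma component_connected_submap:
  assumes F: "F \<subseteq> edges M" and conn: "map_connected (submap M F)" and s: "s \<in> \<Union>F"
  shows "\<Union>F \<subseteq> component F s"
proof -
  interpret S: comb_map "submap M F" by (rule comb_map_submap) fact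
  have sub: "\<Union>F \<subseteq> darts M" by (rule Union_subset_darts) fact
  have "component F s \<inter> \<Union>F = darts (submap M F)"
  proof (rule S.connected_closed[OF conn])
    show "component F s \<inter> \<Union>F \<noteq> {}" using s component_self by blast
    fix d assume d: "d \<in> component F s \<inter> \<Union>F"
    then have eq: "component F d = component F s" using component_eq[OF F] by blast
    have "d \<in> darts M" using d sub by blast
    moreover have "rot (submap M F) d \<in> vertex_of M d"
      using S.R.orbit_eq vertex_of_submap[OF F, of d] d S.rot_in_vertex[of d d] by fastforce
    ultimately have "rot (submap M F) d \<in> component F d"
      using vertex_reachable by (auto simp: component_def)
    moreover have "rot (submap M F) d \<in> \<Union>F"
      using S.R.step_in_D[of d] d by (simp del: Union_iff)
    ultimately show "rot (submap M F) d \<in> component F s \<inter> \<Union>F" using eq by blast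
    have "(d, opp M d) \<in> moves F" using d by (auto simp: moves_def)
    then have "opp M d \<in> component F d" by (auto simp: component_def)
    then show "opp (submap M F) d \<in> component F s \<inter> \<Union>F"
      using eq d opp_in_Union[OF F, of d] by (simp add: opp_submap_in del: Union_iff)
  qed (use s in auto)
  then show ?thesis by auto
qed

text \<open>The extra components are the vertices without edges of \<open>F\<close>. They are
  counted twice here, and once each among the vertices and the faces, so they cancel in the
  defect.\<close>

lemma num_components_submap:
  assumes F: "F \<subseteq> edges M" and conn: "map_connected (submap M F)" and ne: "\<Union>F \<noteq> {}"
  shows "num_components F = Suc (card {X \<in> vertices M. X \<inter> \<Union>F = {}})"
proof -
  obtain s where s: "s \<in> \<Union>F" using ne by blast
  have sD: "s \<in> darts M" using Union_subset_darts[OF F] s by blast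
  have "component F ` darts M = insert (component F s) {X \<in> vertices M. X \<inter> \<Union>F = {}}"
  proof (intro equalityI subsetI)
    fix X assume "X \<in> component F ` darts M"
    then obtain d where d: "d \<in> darts M" "X = component F d" by blast
    show "X \<in> insert (component F s) {X \<in> vertices M. X \<inter> \<Union>F = {}}"
    proof (cases "vertex_of M d \<inter> \<Union>F = {}")
      case True
      then show ?thesis using d component_isolated by (simp add: vertices_def)
    next
      case False
      then obtain y where y: "y \<in> vertex_of M d" "y \<in> \<Union>F" by blast
      then have "y \<in> component F d" using vertex_reachable d by (auto simp: component_def)
      moreover have "y \<in> component F s" using component_connected_submap[OF F conn s] y by blast
      ultimately show ?thesis using component_eq[OF F] d by blast
    qed
  next
    fix X assume "X \<in> insert (component F s) {X \<in> vertices M. X \<inter> \<Union>F = {}}"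
    then consider "X = component F s" | d where "d \<in> darts M" "X = vertex_of M d" "X \<inter> \<Union>F = {}"
      by (auto simp: vertices_def)
    then show "X \<in> component F ` darts M"
      using component_isolated sD by cases (blast, metis imageI)
  qed
  moreover have "component F s \<notin> {X \<in> vertices M. X \<inter> \<Union>F = {}}"
    using s component_self by blast
  moreover have "finite {X \<in> vertices M. X \<inter> \<Union>F = {}}" by (simp add: vertices_def finite_darts)
  ultimately show ?thesis by (simp add: num_components_def)
qed

text \<open>The partial face permutation passes over half-edges, so its first return to the darts of
  \<open>F\<close> is the face permutation of the submap. A vertex without edges of \<open>F\<close>
  is a face of its own.\<close>

lemma some_faces_submap:
  assumes F: "F \<subseteq> edges M"
  shows "some_faces F = card (faces (submap M F)) + card {X \<in> vertices M. X \<inter> \<Union>F = {}}"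
proof -
  let ?S = "\<Union>F" and ?g = "rot M \<circ> some_opp F"
  interpret G: finite_perm "darts M" ?g by (rule some_perm) fact
  have sub: "?S \<subseteq> darts M" by (rule Union_subset_darts) fact
  have off: "?g x = rot M x" if "x \<notin> ?S" for x using that by (simp add: some_opp_def del: Union_iff)
  have "rot (submap M F) (opp (submap M F) d) = G.restricted ?S d" for d
  proof (cases "d \<in> ?S")
    case True
    then have o: "opp M d \<in> ?S" using opp_in_Union[OF F] by blast
    have "first_return ?g ?S d = first_return (rot M) ?S (opp M d)"
    proof (rule first_return_cong)
      show "?g d = rot M (opp M d)" using True by (simp add: some_opp_def del: Union_iff)
    qed (use off G.first_return_exists[OF True] in auto)
    then show ?thesis using True o
      by (simp add: rot_submap R.restricted_def G.restricted_def opp_submap_in del: Union_iff)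
  next
    case False
    then show ?thesis
      by (simp add: rot_submap R.restricted_def G.restricted_def opp_submap some_opp_def del: Union_iff)
  qed
  then have "rot (submap M F) \<circ> opp (submap M F) = G.restricted ?S" by auto
  then have "card (faces (submap M F)) = card (orbit (G.restricted ?S) ` ?S)"
    by (simp add: faces_def face_of_def)
  moreover have "{X \<in> orbit ?g ` darts M. X \<inter> ?S = {}} = {X \<in> vertices M. X \<inter> ?S = {}}"
  proof -
    have "orbit (rot M) d = orbit ?g d" if "orbit ?g d \<inter> ?S = {}" for d
    proof (rule orbit_cong)
      show "rot M s = ?g s" if "s \<in> orbit ?g d" for s
        using off[of s] that \<open>orbit ?g d \<inter> ?S = {}\<close> by (metis disjoint_iff)
    qed simp
    moreover have "orbit ?g d = orbit (rot M) d" if "orbit (rot M) d \<inter> ?S = {}" for d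
    proof (rule orbit_cong)
      show "?g s = rot M s" if "s \<in> orbit (rot M) d" for s
        using off[of s] that \<open>orbit (rot M) d \<inter> ?S = {}\<close> by blast
    qed simp
    ultimately show ?thesis unfolding vertices_def vertex_of_def by (auto simp del: Union_iff) 
  qed
  ultimately show ?thesis
    using G.card_orbits_restricted[OF sub] by (simp add: some_faces_def)
qed

text \<open>The defect of \<open>F\<close> is squeezed between 0 and the defect of all edges, which
  vanishes by planarity.\<close>

lemma planar_submap:
  assumes planar: "planar_map M" and F: "F \<subseteq> edges M" and conn: "map_connected (submap M F)"
    and root: "root_dart M \<in> \<Union>F"
  shows "planar_map (submap M F)"
proof -
  have sub: "\<Union>F \<subseteq> darts M" by (rule Union_subset_darts) fact
  have "defect (edges M) = 0"
    using planar defect_edges unfolding planar_map_iff by fastforce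
  then have "defect F = 0"
    using defect_mono[OF order_refl F] defect_nonneg[OF F] by simp
  moreover have "card (vertices M) =
      card (vertices (submap M F)) + card {X \<in> vertices M. X \<inter> \<Union>F = {}}"
    using R.card_orbits_restricted[OF sub]
    by (simp add: vertices_def vertex_of_def[abs_def] rot_submap)
  moreover have "\<Union>F \<noteq> {}" using root by blast
  note num_components_submap[OF F conn this]
  ultimately have "card (vertices (submap M F)) + card (faces (submap M F)) = card F + 2"
    using some_faces_submap[OF F] by (simp add: defect_def)
  then show ?thesis
    using comb_map_submap[OF F] conn root by (simp add: planar_map_iff edges_submap[OF F] del: Union_iff)
qed

end

section \<open>Contracting the root\<close>

text \<open>The root is no loop and both of its ends have a further dart, so \<open>rot M r\<close>
  and \<open>rot M r'\<close> survive the contraction. The ends are parameters because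
  \<open>M\<close> and the submap \<open>N1\<close> are both contracted along the same pair of
  darts.\<close>

locale contractible = comb_map M for M :: "'d rmap" +
  fixes r r' :: 'd
  assumes r_def: "r = root_dart M" and r'_def: "r' = opp M r"
    and root_in: "r \<in> darts M"
    and nonloop: "r' \<notin> vertex_of M r"
    and rot_r: "rot M r \<noteq> r" and rot_r': "rot M r' \<noteq> r'"
begin

abbreviation K :: "'d rmap" where "K \<equiv> contract_root M"

abbreviation ends :: "'d set" where "ends \<equiv> vertex_of M r \<union> vertex_of M r'"

lemma root'_in: "r' \<in> darts M"
  using root_in by (simp add: r'_def)

lemma opp_r [simp]: "opp M r = r'" "opp M r' = r"
  by (simp_all add: r'_def)

lemma root_neq: "r \<noteq> r'"
  using nonloop by auto

lemma root_edge: "root_edge M = {r, r'}"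
  by (simp add: root_edge_def edge_of_def r_def[symmetric])

lemma darts_K: "darts K = darts M - {r, r'}"
  by (simp add: contract_root_def Let_def root_edge)

lemma opp_K: "opp K d = (if d \<in> darts K then opp M d else d)"
  by (simp add: contract_root_def Let_def)

lemma root_K: "root_dart K = rot M r'"
  by (simp add: contract_root_def Let_def r_def[symmetric])

lemma rot_root_in_K: "rot M r \<in> darts K" "rot M r' \<in> darts K"
proof -
  have "rot M r \<noteq> r'" using nonloop by (metis rot_in_vertex self_in_vertex)
  moreover have "rot M r' \<noteq> r"
    using nonloop by (metis rot_in_vertex self_in_vertex in_vertex_sym)
  ultimately show "rot M r \<in> darts K" "rot M r' \<in> darts K"
    using rot_r rot_r' root_in root'_in by (simp_all add: darts_K)
qed

lemma opp_in_K: "d \<in> darts K \<Longrightarrow> opp M d \<in> darts K"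
  by (auto simp: darts_K opp_eq_iff)

lemma rot_K_eq_first_return: "d \<in> darts K \<Longrightarrow> rot K d = first_return (rot M \<circ> opp M) (darts K) (opp M d)"
  by (simp add: contract_root_def Let_def)

text \<open>A face walk that runs into the root edge gets past it in one step, since
  \<open>rot M r\<close> and \<open>rot M r'\<close> survive. Seen from the vertex, the rotation of
  one end continues behind the root dart of the other end.\<close>

lemma rot_K:
  assumes d: "d \<in> darts K"
  shows "rot K d = (if rot M d = r then rot M r' else if rot M d = r' then rot M r else rot M d)"
proof -
  let ?D = "darts K" and ?f = "rot M \<circ> opp M"
  have ex: "\<exists>n. 0 < n \<and> (?f ^^ n) (opp M d) \<in> ?D"
    by (rule F.first_return_exists) (rule opp_in_K[OF d])
  have eq: "rot K d = first_return ?f ?D (opp M d)" by (rule rot_K_eq_first_return) fact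
  have dD: "rot M d \<in> darts M" using d by (simp add: darts_K)
  show ?thesis
  proof (cases "rot M d \<in> {r, r'}")
    case True
    then have fr: "?f (rot M d) \<in> {rot M r, rot M r'}" using opp_r by (metis comp_apply insert_iff singletonD)
    from True have "?f (opp M d) \<notin> ?D" by (auto simp: darts_K)
    then have "rot K d = first_return ?f ?D (rot M d)" using F.first_return_skip[OF _ ex] eq by simp
    also have "\<dots> = ?f (rot M d)" using rot_root_in_K fr by (intro F.first_return_step) auto
    finally show ?thesis using True root_neq by auto
  next
    case False
    then have "?f (opp M d) \<in> ?D" using dD by (simp add: darts_K)
    then show ?thesis using False eq F.first_return_step by simp
  qed
qed

lemma merged_perm: "finite_perm (darts M) (rot M \<circ> transpose r r')"
  by (rule finite_perm_comp_transpose[OF R.finite_perm_axioms root_in root'_in])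

sublocale P: finite_perm "darts M" "rot M \<circ> transpose r r'"
  by (rule merged_perm)

text \<open>Contraction as an operation on vertices: a transposition merges the cycles of the two
  ends, and then the root darts are skipped. The definition by face cycles gives the face count,
  this form gives the vertex count.\<close>

lemma rot_K_restricted: "rot K = P.restricted (darts K)"
proof
  fix d
  let ?D = "darts K" and ?f = "rot M \<circ> transpose r r'"
  show "rot K d = P.restricted (darts K) d"
  proof (cases "d \<in> ?D")
    case d: True
    then have fd: "?f d = rot M d" by (simp add: darts_K)
    have ex: "\<exists>n. 0 < n \<and> (?f ^^ n) d \<in> ?D" by (rule P.first_return_exists) fact
    have "first_return ?f ?D d = (if rot M d = r then rot M r' else if rot M d = r' then rot M r else rot M d)"
    proof (cases "rot M d \<in> {r, r'}")
      case True
      then have "?f d \<notin> ?D" using fd by (auto simp: darts_K)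
      then have "first_return ?f ?D d = first_return ?f ?D (rot M d)"
        using P.first_return_skip[OF _ ex] fd by simp
      also have "\<dots> = ?f (rot M d)" using True rot_root_in_K by (intro P.first_return_step) auto
      finally show ?thesis using True root_neq by auto
    next
      case False
      then have "?f d \<in> ?D" using d fd by (simp add: darts_K)
      then show ?thesis using False fd P.first_return_step by simp
    qed
    then show ?thesis using d rot_K by (simp add: P.restricted_def)
  next
    case False
    then show ?thesis by (auto simp: P.restricted_def contract_root_def Let_def)
  qed
qed

lemma comb_map_K: "comb_map K"
proof
  have sub: "darts K \<subseteq> darts M" by (auto simp: darts_K)
  show "finite (darts K)" using finite_darts sub finite_subset by blast
  show "rot K permutes darts K" using P.restricted_permutes[OF sub] by (simp add: rot_K_restricted)
  show "opp K permutes darts K"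
  proof (rule bij_imp_permutes)
    show "bij_betw (opp K) (darts K) (darts K)"
      by (rule bij_betw_byWitness[where f' = "opp K"]) (auto simp: opp_K opp_in_K)
  qed (simp add: opp_K)
  fix d assume d: "d \<in> darts K"
  then show "opp K d \<noteq> d" using opp_neq sub by (auto simp: opp_K)
  show "opp K (opp K d) = d" using d by (simp add: opp_K opp_in_K)
qed

lemma orbit_merged:
  "orbit (rot M \<circ> transpose r r') d = (if d \<in> ends then ends else vertex_of M d)"
  using orbit_transpose_merge[OF R.finite_perm_axioms root_in root'_in] nonloop
  by (simp add: vertex_of_def)

lemma vertex_of_K:
  assumes "d \<in> darts K"
  shows "vertex_of K d = (if d \<in> ends then ends - {r, r'} else vertex_of M d)"
proof -
  have "vertex_of K d = orbit (rot M \<circ> transpose r r') d \<inter> darts K"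
    unfolding vertex_of_def rot_K_restricted
    by (rule P.orbit_restricted) (use assms in \<open>auto simp: darts_K\<close>)
  moreover have "vertex_of M d \<inter> {r, r'} = {}" if "d \<notin> ends"
    using that in_vertex_sym by blast
  moreover have "vertex_of M d \<subseteq> darts M" "ends \<subseteq> darts M"
    using assms vertex_of_subset root_in root'_in by (auto simp: darts_K)
  ultimately show ?thesis by (auto simp: orbit_merged darts_K)
qed

lemma edge_of_K: "d \<in> darts K \<Longrightarrow> edge_of K d = edge_of M d"
  by (simp add: edge_of_def opp_K)

lemma edges_K: "edges K = edges M - {root_edge M}"
proof -
  have "edges K = edge_of M ` darts K"
    unfolding edges_def by (rule image_cong) (simp_all add: edge_of_K)
  moreover have "edge_of M d = {r, r'} \<longleftrightarrow> d \<in> {r, r'}" for d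
    using edge_of_eq_iff[of d r] by (auto simp: edge_of_def)
  then have "{d \<in> darts M. edge_of M d \<noteq> {r, r'}} = darts K" unfolding darts_K by blast
  moreover have "edges M - {{r, r'}} = edge_of M ` {d \<in> darts M. edge_of M d \<noteq> {r, r'}}"
    unfolding edges_def by blast
  ultimately show ?thesis unfolding root_edge by metis
qed

lemma rot_K_other: "d \<in> darts K \<Longrightarrow> d \<notin> ends \<Longrightarrow> rot K d = rot M d"
  using rot_K by (metis UnCI rot_in_vertex self_in_vertex)

lemma connected_K:
  assumes conn: "map_connected M"
  shows "map_connected K"
proof -
  interpret K: comb_map K by (rule comb_map_K)
  show ?thesis
  proof (rule K.connectedI)
    fix Z assume Z: "Z \<subseteq> darts K" "Z \<noteq> {}"
      and rotZ: "\<And>d. d \<in> Z \<Longrightarrow> rot K d \<in> Z" and oppZ: "\<And>d. d \<in> Z \<Longrightarrow> opp K d \<in> Z"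
    have oppZ': "opp M d \<in> Z" if "d \<in> Z" for d
    proof -
      have "d \<in> darts K" using Z that by blast
      then show ?thesis using oppZ[OF that] by (simp add: opp_K)
    qed
    show "Z = darts K"
    proof (cases "Z \<inter> ends = {}")
      case True
      have "Z = darts M"
      proof (rule connected_closed[OF conn _ Z(2)])
        show "rot M d \<in> Z" if "d \<in> Z" for d
        proof -
          have "d \<in> darts K" "d \<notin> ends" using that Z True by blast+
          then show ?thesis using rotZ[OF that] rot_K_other by metis
        qed
      qed (use Z oppZ' darts_K in auto)
      then show ?thesis using Z(1) root_in by (auto simp: darts_K)
    next
      case False
      then obtain d where d: "d \<in> Z" "d \<in> ends" by blast
      have "vertex_of K d \<subseteq> Z" by (rule K.orbit_closed[OF Z(1) rotZ d(1)])
      then have ends: "ends - {r, r'} \<subseteq> Z" using d Z vertex_of_K[of d] by auto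
      \<comment> \<open>\<open>Z\<close> contains the whole merged vertex, hence the successors of
        both root darts, and becomes closed in \<open>M\<close> once the root edge is added.\<close>
      have "Z \<union> {r, r'} = darts M"
      proof (rule connected_closed[OF conn])
        fix d assume d: "d \<in> Z \<union> {r, r'}"
        show "opp M d \<in> Z \<union> {r, r'}" using d oppZ' by auto
        show "rot M d \<in> Z \<union> {r, r'}"
        proof (cases "d \<in> Z")
          case True
          then show ?thesis using rotZ[OF True] rot_K[of d] Z by (auto split: if_splits)
        next
          case False
          then have "rot M d \<in> ends" using d by auto
          then show ?thesis using ends by blast
        qed
      qed (use Z root_in root'_in in \<open>auto simp: darts_K\<close>)
      then show ?thesis using Z by (auto simp: darts_K)
    qed
  qed
qed

lemma face_perm_K: "rot K \<circ> opp K = F.restricted (darts K)"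
proof
  fix d show "(rot K \<circ> opp K) d = F.restricted (darts K) d"
  proof (cases "d \<in> darts K")
    case True
    then show ?thesis
      using rot_K_eq_first_return[OF opp_in_K[OF True]] by (simp add: opp_K F.restricted_def)
  next
    case False
    then show ?thesis by (auto simp: opp_K F.restricted_def contract_root_def Let_def)
  qed
qed

lemma face_of_K_subset: "d \<in> darts K \<Longrightarrow> face_of K d \<subseteq> face_of M d"
  unfolding face_of_def face_perm_K using F.orbit_restricted[of "darts K" d] by (auto simp: darts_K)

text \<open>One vertex and one edge are lost and no face: thanks to \<open>rot M r\<close> and
  \<open>rot M r'\<close>, every merged vertex and every face keeps a dart.\<close>

lemma planar_K:
  assumes planar: "planar_map M"
  shows "planar_map K"
proof -
  have sub: "darts K \<subseteq> darts M" by (auto simp: darts_K)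
  have "{X \<in> orbit (rot M \<circ> transpose r r') ` darts M. X \<inter> darts K = {}} = {}"
  proof -
    have "orbit (rot M \<circ> transpose r r') d \<inter> darts K \<noteq> {}" if d: "d \<in> darts M" for d
    proof (cases "d \<in> ends")
      case True
      then have "rot M r \<in> orbit (rot M \<circ> transpose r r') d" by (simp add: orbit_merged)
      then show ?thesis using rot_root_in_K by blast
    next
      case False
      then have "d \<in> darts K" using d by (auto simp: darts_K)
      then show ?thesis using P.self_in_orbit by blast
    qed
    then show ?thesis by blast
  qed
  then have "card (orbit (rot M \<circ> transpose r r') ` darts M) = card (vertices K)"
    using P.card_orbits_restricted[OF sub]
    by (simp only: vertices_def vertex_of_def[abs_def] rot_K_restricted) simp
  then have V: "card (vertices M) = Suc (card (vertices K))"
    using card_orbits_merge[OF R.finite_perm_axioms root_in root'_in] nonloop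
    by (simp add: vertices_def vertex_of_def[abs_def])
  have "{X \<in> faces M. X \<inter> darts K = {}} = {}"
  proof -
    have "face_of M d \<inter> darts K \<noteq> {}" if d: "d \<in> darts M" for d
    proof (cases "d \<in> {r, r'}")
      case True
      then have "(rot M \<circ> opp M) d \<in> darts K" using rot_root_in_K by auto
      then show ?thesis using orbit.base unfolding face_of_def by fast
    next
      case False
      then have "d \<in> darts K" using d by (simp add: darts_K)
      then show ?thesis using F.self_in_orbit unfolding face_of_def by blast
    qed
    then show ?thesis unfolding faces_def by blast
  qed
  with face_perm_K have FF: "card (faces M) = card (faces K)"
    using F.card_orbits_restricted[OF sub] unfolding faces_def face_of_def[abs_def] by (simp only:) simp
  have E: "card (edges M) = Suc (card (edges K))"
    using card_Suc_Diff1[OF finite_edges, of "root_edge M"] root_in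
    by (simp add: edges_K root_edge_def r_def[symmetric])
  show ?thesis
    using planar V FF E comb_map_K connected_K rot_root_in_K
    by (simp add: planar_map_iff root_K)
qed

end

section \<open>The innermost block of an NSP-map\<close>

lemma (in comb_map) vertex_of_disjoint:
  "d \<notin> vertex_of M x \<Longrightarrow> vertex_of M d \<inter> vertex_of M x = {}"
  unfolding vertex_of_def using R.orbit_disjoint[of d x] R.self_in_orbit[of d] by blast

locale nsp = comb_map M for M :: "'d rmap" +
  assumes nsp: "nsp_map M"
begin

abbreviation "r \<equiv> root_dart M"

definition r' :: 'd where
  r'_opp: "r' = opp M (root_dart M)"

lemma planar: "planar_map M" and tight: "tight M" and two_edges: "2 \<le> card (edges M)"
  using nsp nsp_map_iff by blast+

lemma r_in: "r \<in> darts M"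
  using planar planar_map_iff by blast

lemma edge_not_all: "{d, opp M d} \<noteq> darts M"
proof
  assume e: "{d, opp M d} = darts M"
  then have "edges M \<subseteq> {edge_of M d}"
    unfolding edges_def e[symmetric] by auto
  then have "card (edges M) \<le> 1" using card_mono[of "{edge_of M d}"] by simp
  then show False using two_edges by simp
qed

text \<open>The two darts of a loop would form a set closed off the vertex of the loop.\<close>

lemma no_loops:
  assumes d: "d \<in> darts M"
  shows "opp M d \<notin> vertex_of M d"
proof
  assume l: "opp M d \<in> vertex_of M d"
  have "{d, opp M d} = {} \<or> {d, opp M d} = darts M"
    by (rule tightD[OF tight d]) (use d l in auto)
  then show False using edge_not_all by blast
qed

text \<open>The edge at a vertex of degree one would be closed off its other end.\<close>

lemma rot_neq:
  assumes d: "d \<in> darts M"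
  shows "rot M d \<noteq> d"
proof
  assume l: "rot M d = d"
  have "{d, opp M d} = {} \<or> {d, opp M d} = darts M"
    by (rule tightD[OF tight, of "opp M d"]) (use d l in auto)
  then show False using edge_not_all by blast
qed

sublocale contractible M r r'
  by unfold_locales (simp_all add: r'_opp r_in no_loops rot_neq)

sublocale K: comb_map K
  by (rule comb_map_K)

text \<open>On its face, \<open>opp M x\<close> is followed by \<open>rot M x\<close>, so it stands
  for the corner between \<open>x\<close> and \<open>rot M x\<close>. Two corners of one vertex in
  the same face would allow a cut at this vertex, and the part cut off contradicts
  tightness.\<close>

lemma face_meets_vertex_once:
  assumes x: "x \<in> darts M" and y: "y \<in> vertex_of M x" "x \<noteq> y"
  shows "opp M y \<notin> face_of M (opp M x)"
proof
  assume f: "opp M y \<in> face_of M (opp M x)"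
  obtain Z where Z: "Z \<subseteq> darts M" "x \<notin> Z" "y \<in> Z"
    and rotZ: "\<And>d. (rot M \<circ> transpose x y) d \<in> Z \<longleftrightarrow> d \<in> Z" and oppZ: "\<And>d. opp M d \<in> Z \<longleftrightarrow> d \<in> Z"
    by (rule planar_split_disconnected[OF planar x y f]) blast
  have "Z = {} \<or> Z = darts M"
  proof (rule tightD[OF tight x Z(1)])
    fix d assume d: "d \<in> Z"
    then show "opp M d \<in> Z" using oppZ by simp
    assume "d \<notin> vertex_of M x"
    then have "d \<noteq> x" "d \<noteq> y" using y by auto
    then have "transpose x y d = d" by simp
    then show "rot M d \<in> Z" using rotZ[of d] d by simp
  qed
  then show False using Z x by blast
qed

text \<open>These are the dart sets of unions of bridges of the two ends of the root, that is, of
  pieces that meet the other pieces only at these ends. The root edge is such a piece as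
  well.\<close>

definition bridge_closed :: "'d set \<Rightarrow> bool" where
  "bridge_closed Z \<longleftrightarrow> Z \<subseteq> darts M \<and> (\<forall>d\<in>Z. opp M d \<in> Z) \<and> (\<forall>d\<in>Z. d \<notin> ends \<longrightarrow> rot M d \<in> Z)"

lemma ends_disjoint: "vertex_of M r \<inter> vertex_of M r' = {}"
  using vertex_of_disjoint[OF nonloop] by blast

lemma vertex_off_ends: "d \<notin> ends \<Longrightarrow> vertex_of M d \<inter> ends = {}"
  using vertex_of_disjoint[of d r] vertex_of_disjoint[of d r'] by blast

lemma bridge_closed_rot:
  assumes "bridge_closed Z" "d \<notin> ends"
  shows "rot M d \<in> Z \<longleftrightarrow> d \<in> Z"
proof (rule closed_off_iff[where W = ends])
  show "vertex_of M d \<inter> ends = {}" by (rule vertex_off_ends[OF assms(2)])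
  show "rot M e \<in> Z" if "e \<in> Z" "e \<notin> ends" for e
    using assms(1) that unfolding bridge_closed_def by blast
qed

lemma bridge_closed_opp: "bridge_closed Z \<Longrightarrow> opp M d \<in> Z \<longleftrightarrow> d \<in> Z"
proof
  assume Z: "bridge_closed Z"
  then have o: "\<And>e. e \<in> Z \<Longrightarrow> opp M e \<in> Z" unfolding bridge_closed_def by blast
  show "d \<in> Z" if "opp M d \<in> Z" using o[OF that] by (simp only: opp_opp)
  show "opp M d \<in> Z" if "d \<in> Z" using that by (rule o)
qed

lemma bridge_closed_vertex:
  assumes "bridge_closed Z" "d \<in> Z" "d \<notin> ends"
  shows "vertex_of M d \<subseteq> Z"
  unfolding vertex_of_def
proof (rule R.orbit_least[OF assms(2)])
  fix z assume "z \<in> Z" "z \<in> orbit (rot M) d"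
  then have "z \<notin> ends" using vertex_off_ends[OF assms(3)] by (auto simp: vertex_of_def)
  then show "rot M z \<in> Z" using bridge_closed_rot[OF assms(1)] \<open>z \<in> Z\<close> by blast
qed

lemma bridge_closed_complement:
  assumes "bridge_closed Z"
  shows "bridge_closed (darts M - Z)"
  using bridge_closed_rot[OF assms] bridge_closed_opp[OF assms] by (simp add: bridge_closed_def)

lemma bridge_closed_root: "bridge_closed {r, r'}"
  using root_in root'_in by (auto simp: bridge_closed_def)

lemma bridge_closed_Un: "bridge_closed Z \<Longrightarrow> bridge_closed Y \<Longrightarrow> bridge_closed (Z \<union> Y)"
  by (auto simp: bridge_closed_def)

text \<open>A union of bridges that missed one end would be cut off by the other end alone.\<close>

lemma bridge_meets_end:
  assumes Z: "bridge_closed Z" "Z \<noteq> {}" "r \<notin> Z" and x: "x \<in> {r, r'}"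
  shows "Z \<inter> vertex_of M x \<noteq> {}"
proof
  assume e: "Z \<inter> vertex_of M x = {}"
  obtain y where y: "{x, y} = {r, r'}" using x by blast
  then have yD: "y \<in> darts M" using root_in root'_in by (auto simp: doubleton_eq_iff)
  have "Z = {} \<or> Z = darts M"
  proof (rule tightD[OF tight yD])
    fix d assume d: "d \<in> Z" "d \<notin> vertex_of M y"
    then have "d \<notin> ends" using e y by (auto simp: doubleton_eq_iff)
    then show "rot M d \<in> Z" using bridge_closed_rot[OF Z(1)] d by blast
  qed (use Z in \<open>auto simp: bridge_closed_def\<close>)
  then show False using Z root_in by blast
qed

section \<open>The run of the innermost block at the head of the root\<close>

definition b :: "nat \<Rightarrow> 'd" where
  "b j = (rot M ^^ j) r'"

text \<open>The degree of the head: \<open>b m\<close> is the root dart \<open>r'\<close> again, and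
  the search examines \<open>b 1\<close> to \<open>b (m - 1)\<close> in this order.\<close>

definition m :: nat where
  "m = card (vertex_of M r')"

lemma b_0 [simp]: "b 0 = r'"
  by (simp add: b_def)

lemma b_Suc: "b (Suc j) = rot M (b j)"
  by (simp add: b_def)

lemma b_m [simp]: "b m = r'"
  using R.funpow_card_orbit[of r'] by (simp add: b_def m_def vertex_of_def)

lemma b_inj: "j < m \<Longrightarrow> k < m \<Longrightarrow> b j = b k \<longleftrightarrow> j = k"
  using R.inj_on_orbit_enum[of r'] by (auto simp: b_def m_def vertex_of_def inj_on_def)

lemma head_vertex: "vertex_of M r' = b ` {0..<m}"
  using R.orbit_enum_image[of r'] by (simp add: b_def m_def vertex_of_def)

lemma b_in_head: "b j \<in> vertex_of M r'"
  by (induction j) (simp_all add: b_Suc)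

lemma b_in: "b j \<in> darts M"
  using b_in_head vertex_of_subset root'_in by blast

lemma b_not_tail: "b j \<notin> vertex_of M r"
  using b_in_head ends_disjoint by blast

lemma b_neq_root: "0 < j \<Longrightarrow> j < m \<Longrightarrow> b j \<notin> {r, r'}"
  using b_inj[of j 0] b_not_tail[of j] self_in_vertex[of r] by auto

lemma m_ge_2: "2 \<le> m"
proof -
  have "m \<noteq> 0" using R.card_orbit_pos[of r'] by (simp add: m_def vertex_of_def)
  moreover have "m \<noteq> 1"
  proof
    assume "m = 1"
    then have "b 1 = r'" using b_m by metis
    then show False using b_Suc[of 0] rot_r' by simp
  qed
  ultimately show ?thesis by simp
qed

text \<open>The bridge of the last dart before the root: the darts of the innermost block.\<close>

definition A :: "'d set" where
  "A = \<Inter>{Z. bridge_closed Z \<and> b (m - 1) \<in> Z}"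

lemma A_least: "bridge_closed Z \<Longrightarrow> b (m - 1) \<in> Z \<Longrightarrow> A \<subseteq> Z"
  by (auto simp: A_def)

lemma last_in_A: "b (m - 1) \<in> A"
  by (auto simp: A_def)

lemma bridge_closed_rest: "bridge_closed (darts M - {r, r'})"
  by (rule bridge_closed_complement[OF bridge_closed_root])

lemma bridge_closed_A: "bridge_closed A"
proof -
  have "A \<subseteq> darts M - {r, r'}"
    by (rule A_least[OF bridge_closed_rest]) (use b_in b_neq_root[of "m - 1"] m_ge_2 in auto)
  then show ?thesis by (auto simp: bridge_closed_def A_def)
qed

lemma A_sub: "A \<subseteq> darts K"
  unfolding darts_K
  by (rule A_least[OF bridge_closed_rest]) (use b_in b_neq_root[of "m - 1"] m_ge_2 in auto)

lemma A_sub_darts: "A \<subseteq> darts M"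
  using A_sub darts_K by blast

lemma root_notin_A: "r \<notin> A" "r' \<notin> A"
  using A_sub by (auto simp: darts_K)

text \<open>Either \<open>Z\<close> or its complement contains the dart that generates
  \<open>A\<close>, and both are bridge-closed.\<close>

lemma A_minimal:
  assumes Z: "bridge_closed Z" "Z \<inter> A \<noteq> {}"
  shows "A \<subseteq> Z"
proof (cases "b (m - 1) \<in> Z")
  case True
  then show ?thesis using A_least Z by blast
next
  case False
  then have "A \<subseteq> darts M - Z"
    using A_least[OF bridge_closed_complement[OF Z(1)]] b_in by blast
  then show ?thesis using Z by blast
qed

lemma A_opp [simp]: "opp M d \<in> A \<longleftrightarrow> d \<in> A"
  by (rule bridge_closed_opp[OF bridge_closed_A])

definition EA :: "'d set set" where
  "EA = edge_of M ` A"

lemma edge_in_EA [simp]: "edge_of M d \<in> EA \<longleftrightarrow> d \<in> A"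
  using A_opp by (auto simp: EA_def edge_of_eq_iff)

lemma EA_sub: "EA \<subseteq> edges M"
  using A_sub_darts by (auto simp: EA_def edges_def)

lemma Union_EA [simp]: "\<Union>EA = A"
  using in_Union_iff[OF EA_sub] edge_in_EA by blast

lemma EA_ne: "EA \<noteq> {}"
  using last_in_A by (auto simp: EA_def)

lemma root_edge_notin: "root_edge M \<notin> EA"
  unfolding root_edge_def by (simp add: root_notin_A)

lemma EA_sub_K: "EA \<subseteq> edges K"
  using EA_sub root_edge_notin by (auto simp: edges_K)

text \<open>The last dart of the head before the run of darts of \<open>A\<close> that ends at the root borders a
  face of the contracted map that also leaves \<open>A\<close> at the tail of the root; cutting along this face
  shows that no earlier dart of the head belongs to \<open>A\<close>.\<close>

lemma no_earlier:
  assumes i: "0 < i" "i < m" "b i \<in> A" and p: "b (i - 1) \<notin> A" and k: "k < i"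
  shows "b k \<notin> A"
proof (cases "i = 1")
  case True
  then show ?thesis using k root_notin_A by simp
next
  case False
  define p where "p = b (i - 1)"
  have pM: "p \<in> darts M" by (simp add: p_def b_in)
  have pK: "p \<in> darts K" using b_neq_root[of "i - 1"] i False pM by (simp add: p_def darts_K)
  have pe: "p \<in> ends" using b_in_head by (simp add: p_def)
  have rp: "rot M p = b i" using b_Suc[of "i - 1"] i by (simp add: p_def)
  have bi: "b i \<in> darts K" using i A_sub by blast
  then have rKp: "rot K p = b i" using rot_K[OF pK] rp darts_K by auto
  have oo: "opp K (opp M p) = p" using pK opp_in_K by (simp add: opp_K)
  then have fp: "(rot K \<circ> opp K) (opp M p) = b i" using rKp by simp
  then have fbi: "face_of K (b i) = face_of K (opp M p)"
    unfolding face_of_def using K.F.orbit_eq orbit.base by metis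
  \<comment> \<open>The face that enters \<open>A\<close> at \<open>b i\<close> must leave it again;
    otherwise it would already have been in \<open>A\<close> one step earlier, at
    \<open>opp M p\<close>.\<close>
  have "\<exists>z\<in>face_of K (b i). z \<in> A \<and> (rot K \<circ> opp K) z \<notin> A"
  proof (rule ccontr)
    assume "\<not> ?thesis"
    then have "opp M p \<in> A \<longleftrightarrow> b i \<in> A"
      using fbi unfolding face_of_def by (intro K.F.orbit_invariant[of "b i"]) auto
    then show False using i p by (simp add: p_def)
  qed
  then obtain z where z: "z \<in> face_of K (b i)" "z \<in> A" "(rot K \<circ> opp K) z \<notin> A" by blast
  define c where "c = opp M z"
  have zK: "z \<in> darts K" using z A_sub by blast
  have cA: "c \<in> A" and cK: "c \<in> darts K" using z A_sub zK by (auto simp: c_def opp_in_K)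
  have rc: "rot K c \<notin> A" using z zK by (simp add: c_def opp_K)
  have ce: "c \<in> ends"
  proof (rule ccontr)
    assume "c \<notin> ends"
    then show False using rc cA rot_K_other[OF cK] bridge_closed_rot[OF bridge_closed_A] by simp
  qed
  have cp: "p \<noteq> c" using cA p by (auto simp: p_def)
  have cface: "opp M c \<in> face_of K (opp M p)" using z fbi by (simp add: c_def)
  \<comment> \<open>If \<open>c\<close> were at the head, a face of \<open>M\<close> would have two
    corners there, behind \<open>p\<close> and behind \<open>c\<close>.\<close>
  have c_tail: "c \<notin> vertex_of M r'"
  proof
    assume "c \<in> vertex_of M r'"
    moreover have "p \<in> vertex_of M r'" by (simp add: p_def b_in_head)
    ultimately have "c \<in> vertex_of M p" using vertex_of_eq by metis
    then have "opp M c \<notin> face_of M (opp M p)" by (rule face_meets_vertex_once[OF pM _ cp])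
    then show False using cface face_of_K_subset[OF opp_in_K[OF pK]] by blast
  qed
  have "c \<in> vertex_of K p" using pe ce cK vertex_of_K[OF pK] by (simp add: darts_K)
  moreover have "opp K c \<in> face_of K (opp K p)" using cface cK pK by (simp add: opp_K)
  ultimately obtain Y where Y: "Y \<subseteq> darts K" "p \<notin> Y" "c \<in> Y"
    and rotY: "\<And>d. (rot K \<circ> transpose p c) d \<in> Y \<longleftrightarrow> d \<in> Y" and oppY: "\<And>d. opp K d \<in> Y \<longleftrightarrow> d \<in> Y"
    using planar_split_disconnected[OF planar_K[OF planar] pK _ cp] by blast
  have rotY': "rot K d \<in> Y \<longleftrightarrow> d \<in> Y" if "d \<noteq> p" "d \<noteq> c" for d
    using rotY[of d] that by simp
  \<comment> \<open>The cut alters the rotation only at \<open>p\<close> and \<open>c\<close>, which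
    both lie at the ends. So by minimality it leaves \<open>A\<close> in one piece, on the side of
    \<open>c\<close>.\<close>
  have "bridge_closed (A \<inter> Y)"
    unfolding bridge_closed_def
  proof (intro conjI ballI impI)
    show "A \<inter> Y \<subseteq> darts M" using A_sub_darts by blast
    fix d assume d: "d \<in> A \<inter> Y"
    then have dK: "d \<in> darts K" using A_sub by blast
    show "opp M d \<in> A \<inter> Y" using d oppY[of d] dK by (simp add: opp_K)
    assume de: "d \<notin> ends"
    then have "d \<noteq> p" "d \<noteq> c" using pe ce by auto
    then have "rot M d \<in> Y" using rotY'[of d] d rot_K_other[OF dK de] by simp
    then show "rot M d \<in> A \<inter> Y" using bridge_closed_rot[OF bridge_closed_A de] d by blast
  qed
  then have AY: "A \<subseteq> Y" using A_minimal[of "A \<inter> Y"] cA Y by blast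
  \<comment> \<open>Going backwards from \<open>p\<close>, the darts of the head stay on the side of
    \<open>p\<close>. The index runs down to 1, just before the contracted root dart would be
    met.\<close>
  have notY: "b (i - 1 - n) \<notin> Y" if "n < i - 1" for n
    using that
  proof (induction n)
    case 0
    then show ?case using Y by (simp add: p_def)
  next
    case (Suc n)
    define j where "j = i - 1 - Suc n"
    have j: "0 < j" "Suc j = i - 1 - n" "Suc j < m" using Suc.prems i by (auto simp: j_def)
    have bj: "b j \<in> darts K" using b_neq_root[of j] j b_in by (simp add: darts_K)
    have "rot K (b j) = b (Suc j)"
      using rot_K[OF bj] b_Suc[of j] b_neq_root[of "Suc j"] j by auto
    moreover have "b j \<noteq> p" using b_inj[of j "i - 1"] j i by (simp add: p_def j_def)
    moreover have "b j \<noteq> c" using c_tail b_in_head by metis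
    ultimately have "b (Suc j) \<in> Y \<longleftrightarrow> b j \<in> Y" using rotY'[of "b j"] by simp
    then show ?case using Suc j by (simp add: j_def)
  qed
  show ?thesis
  proof (cases "k = 0")
    case True
    then show ?thesis using root_notin_A by simp
  next
    case False
    then have "b (i - 1 - (i - 1 - k)) \<notin> Y" using k by (intro notY) auto
    then show ?thesis using AY k by auto
  qed
qed

text \<open>\<open>i\<close> starts the last run of darts of \<open>A\<close>. The dart before it is
  outside \<open>A\<close>, so \<open>no_earlier\<close> excludes every earlier run.\<close>

lemma head_interval:
  obtains i where "0 < i" "i < m" "\<And>j. j < m \<Longrightarrow> b j \<in> A \<longleftrightarrow> i \<le> j"
proof -
  define i where "i = (LEAST i. \<forall>j. i \<le> j \<and> j < m \<longrightarrow> b j \<in> A)"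
  have ex: "\<forall>j. m - 1 \<le> j \<and> j < m \<longrightarrow> b j \<in> A"
  proof (intro allI impI)
    fix j assume "m - 1 \<le> j \<and> j < m"
    then have "j = m - 1" using m_ge_2 by (elim conjE) linarith
    then show "b j \<in> A" using last_in_A by simp
  qed
  then have i: "\<And>j. i \<le> j \<Longrightarrow> j < m \<Longrightarrow> b j \<in> A"
    using LeastI[of "\<lambda>i. \<forall>j. i \<le> j \<and> j < m \<longrightarrow> b j \<in> A", OF ex] unfolding i_def by blast
  have im: "i < m" using Least_le[of "\<lambda>i. \<forall>j. i \<le> j \<and> j < m \<longrightarrow> b j \<in> A", OF ex] m_ge_2
    by (simp add: i_def)
  have i0: "0 < i" using i[of 0] im root_notin_A by (cases i) auto
  have "b (i - 1) \<notin> A"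
  proof
    assume a: "b (i - 1) \<in> A"
    have "\<forall>j. i - 1 \<le> j \<and> j < m \<longrightarrow> b j \<in> A"
    proof (intro allI impI)
      fix j assume "i - 1 \<le> j \<and> j < m"
      then show "b j \<in> A" using a i[of j] by (cases "j = i - 1") auto
    qed
    then have "i \<le> i - 1" unfolding i_def by (rule Least_le)
    then show False using i0 by simp
  qed
  then show ?thesis using that[of i] i0 im i no_earlier[of i] by (meson le_refl not_le)
qed

text \<open>The face is followed backwards from \<open>r'\<close>, starting with the reversal of the
  last dart of the head, which lies in \<open>A\<close>. Away from the ends, closure under rotation
  keeps the walk in \<open>A\<close>; each end is met only at the corner next to the root, because a
  face has at most one corner at a vertex.\<close>

lemma core_face: "face_of M r' \<subseteq> insert r' A"
proof -
  define w where "w n = ((rot M \<circ> opp M) ^^ n) r'" for n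
  define N where "N = card (face_of M r')"
  have w_Suc: "w (Suc n) = rot M (opp M (w n))" for n by (simp add: w_def)
  have wN: "w N = r'" using F.funpow_card_orbit[of r'] by (simp add: w_def N_def face_of_def)
  have winj: "j < N \<Longrightarrow> k < N \<Longrightarrow> w j = w k \<Longrightarrow> j = k" for j k
    using F.inj_on_orbit_enum[of r'] by (auto simp: w_def N_def face_of_def inj_on_def)
  have face: "face_of M r' = w ` {0..<N}"
    using F.orbit_enum_image[of r'] by (simp add: w_def N_def face_of_def)
  have N0: "0 < N" using F.card_orbit_pos[of r'] by (simp add: N_def face_of_def)
  define l where "l = b (m - 1)"
  have rl: "rot M l = r'" using b_Suc[of "m - 1"] m_ge_2 by (simp add: l_def)
  have wl: "w (N - 1) = opp M l"
  proof -
    have "rot M (opp M (w (N - 1))) = rot M l" using w_Suc[of "N - 1"] N0 wN rl by simp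
    then have "opp M (w (N - 1)) = l" by simp
    then show ?thesis by (simp add: opp_eq_iff)
  qed
  have w_in: "w n \<in> face_of M r'" if "n < N" for n using that face by auto
  have "face_of M r' = face_of M (opp M l)"
    unfolding face_of_def by (rule F.orbit_eq[symmetric]) (use w_in[of "N - 1"] wl N0 in \<open>simp add: face_of_def\<close>)
  then have face_l: "opp M y \<notin> face_of M r'" if "y \<in> vertex_of M l" "y \<noteq> l" for y
    using face_meets_vertex_once[of l y] that b_in by (auto simp: l_def)
  have lr: "vertex_of M l = vertex_of M r'" unfolding l_def by (rule vertex_of_eq) (rule b_in_head)
  have "w (N - 1 - n) \<in> A" if "n < N - 1" for n
    using that
  proof (induction n)
    case 0
    then show ?case using wl last_in_A by (simp add: l_def)
  next
    case (Suc n)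
    define j where "j = N - 1 - Suc n"
    have j: "0 < j" "Suc j = N - 1 - n" "Suc j < N" using Suc.prems by (auto simp: j_def)
    have IH: "rot M (opp M (w j)) \<in> A" using Suc j by (simp flip: w_Suc)
    have "opp M (w j) \<notin> vertex_of M r'"
    proof
      assume a: "opp M (w j) \<in> vertex_of M r'"
      have "opp M (w j) = l"
      proof (rule ccontr)
        assume "opp M (w j) \<noteq> l"
        then have "opp M (opp M (w j)) \<notin> face_of M r'" using a lr by (intro face_l) simp_all
        then show False using w_in[of j] j by simp
      qed
      then have "w j = w (N - 1)" using wl by (simp add: opp_eq_iff)
      then show False using winj[of j "N - 1"] j by simp
    qed
    moreover have "opp M (w j) \<notin> vertex_of M r"
    proof
      assume a: "opp M (w j) \<in> vertex_of M r"
      have "opp M (w j) = r"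
      proof (rule ccontr)
        assume "opp M (w j) \<noteq> r"
        then have "opp M (opp M (w j)) \<notin> face_of M (opp M r)"
          using a root_in by (intro face_meets_vertex_once) auto
        then show False using w_in[of j] j by simp
      qed
      then have "w j = w 0" by (simp add: opp_eq_iff w_def)
      then show False using winj[of j 0] j by simp
    qed
    ultimately have "opp M (w j) \<in> A" using IH bridge_closed_rot[OF bridge_closed_A] by blast
    then show ?case by (simp add: j_def)
  qed
  then have wA: "w j \<in> A" if "0 < j" "j < N" for j
    using that \<open>\<And>n. n < N - 1 \<Longrightarrow> w (N - 1 - n) \<in> A\<close>[of "N - 1 - j"] by simp
  show ?thesis
  proof
    fix z assume "z \<in> face_of M r'"
    then obtain j where j: "j < N" "z = w j" using face by auto
    then show "z \<in> insert r' A" using wA[of j] by (cases j) (simp_all add: w_def)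
  qed
qed

lemma core_edges_sub: "core_edges M \<subseteq> EA"
proof
  fix e assume "e \<in> core_edges M"
  then obtain d where "d \<in> face_of M r'" "e = edge_of M d" "e \<noteq> root_edge M"
    by (auto simp: core_edges_def)
  moreover have "edge_of M r' = root_edge M" using edge_of_opp[of r] by (simp add: root_edge_def)
  ultimately have "d \<noteq> r'" by blast
  then show "e \<in> EA" using \<open>d \<in> face_of M r'\<close> \<open>e = edge_of M d\<close> core_face by auto
qed

text \<open>This prevents other blocks from containing the core edges vacuously, and so gives
  uniqueness of the innermost block.\<close>

lemma core_edges_ne: "core_edges M \<noteq> {}"
proof -
  have f: "rot M r \<in> face_of M r'" using orbit.base[of "rot M \<circ> opp M" r'] by (simp add: face_of_def)
  moreover have "rot M r \<noteq> r'" using rot_root_in_K by (auto simp: darts_K)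
  ultimately have "rot M r \<in> A" using core_face by blast
  then have "edge_of M (rot M r) \<noteq> root_edge M" using edge_in_EA root_edge_notin by metis
  then show ?thesis using f by (auto simp: core_edges_def)
qed

text \<open>The root edge marks both ends: a closed set without the root cannot contain all darts of
  the submap at an end. So away from \<open>x\<close> it consists of complete vertices of
  \<open>M\<close> and is closed in \<open>M\<close>. Sets with the root are handled by
  complement.\<close>

lemma tight_submap:
  assumes F: "F \<subseteq> edges M" and S: "bridge_closed (\<Union>F)" and root: "r \<in> \<Union>F"
  shows "tight (submap M F)"
  unfolding tight_def
proof (intro ballI allI impI)
  interpret S: comb_map "submap M F" by (rule comb_map_submap[OF F])
  define S where "S = \<Union>F"
  have DS: "darts (submap M F) = S" by (simp add: S_def)
  have root': "r' \<in> S" using opp_in_Union[OF F, of r, THEN iffD2, OF root] by (simp only: S_def opp_r)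
  have main: "Z = {}" if x: "x \<in> S" and Z: "Z \<subseteq> S" "r \<notin> Z"
    and oZ: "\<And>d. d \<in> Z \<Longrightarrow> opp (submap M F) d \<in> Z"
    and rZ: "\<And>d. d \<in> Z \<Longrightarrow> d \<notin> vertex_of (submap M F) x \<Longrightarrow> rot (submap M F) d \<in> Z" for x Z
  proof -
    have SD: "S \<subseteq> darts M" using Union_subset_darts[OF F] by (simp add: S_def)
    have oZ': "opp M d \<in> Z" if "d \<in> Z" for d
    proof -
      have "d \<in> \<Union>F" using that Z unfolding S_def by blast
      then show ?thesis using oZ[OF that] opp_submap_in[of d F] by simp
    qed
    have r'Z: "r' \<notin> Z" using oZ'[of r'] Z by auto
    have "Z = {} \<or> Z = darts M"
    proof (rule tightD[OF tight])
      show "x \<in> darts M" "Z \<subseteq> darts M" using x Z SD by auto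
      show "opp M d \<in> Z" if "d \<in> Z" for d using oZ' that .
      fix d assume d: "d \<in> Z" "d \<notin> vertex_of M x"
      have dS: "d \<in> \<Union>F" and xS: "x \<in> \<Union>F" using d Z x unfolding S_def by blast+
      have vd: "vertex_of (submap M F) d = vertex_of M d \<inter> S"
        using vertex_of_submap[OF F dS] S_def by simp
      have vx: "vertex_of (submap M F) x = vertex_of M x \<inter> S"
        using vertex_of_submap[OF F xS] S_def by simp
      have dx: "vertex_of M d \<inter> vertex_of M x = {}" by (rule vertex_of_disjoint[OF d(2)])
      have sub: "vertex_of (submap M F) d \<subseteq> Z"
        unfolding vertex_of_def
      proof (rule S.R.orbit_least[OF d(1)])
        fix z assume "z \<in> Z" "z \<in> orbit (rot (submap M F)) d"
        then have "z \<notin> vertex_of (submap M F) x" using vd vx dx by (auto simp: vertex_of_def)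
        then show "rot (submap M F) z \<in> Z" using rZ \<open>z \<in> Z\<close> by blast
      qed
      have "d \<notin> ends"
      proof
        assume "d \<in> ends"
        then have "r \<in> vertex_of M d \<or> r' \<in> vertex_of M d" using in_vertex_sym by blast
        then show False using sub vd root root' Z(2) r'Z S_def by blast
      qed
      then have "vertex_of M d \<subseteq> S" using bridge_closed_vertex[OF S dS] S_def by simp
      then have "vertex_of M d \<subseteq> Z" using sub vd by blast
      then show "rot M d \<in> Z" using rot_in_vertex[of d d] by auto
    qed
    then show ?thesis using Z root_in by blast
  qed
  fix x Z assume x: "x \<in> darts (submap M F)" and Z: "Z \<subseteq> darts (submap M F)"
    and o: "\<forall>d\<in>Z. opp (submap M F) d \<in> Z"
    and rr: "\<forall>d\<in>Z. d \<notin> vertex_of (submap M F) x \<longrightarrow> rot (submap M F) d \<in> Z"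
  show "Z = {} \<or> Z = darts (submap M F)"
  proof (cases "r \<in> Z")
    case False
    then show ?thesis using main[of x Z] x Z o rr unfolding DS by blast
  next
    case True
    have "darts (submap M F) - Z = {}"
    proof (rule main)
      show "x \<in> S" using x unfolding DS .
      show "darts (submap M F) - Z \<subseteq> S" using DS by blast
      show "r \<notin> darts (submap M F) - Z" using True by blast
      fix d assume "d \<in> darts (submap M F) - Z"
      then show "opp (submap M F) d \<in> darts (submap M F) - Z"
        "d \<notin> vertex_of (submap M F) x \<Longrightarrow> rot (submap M F) d \<in> darts (submap M F) - Z"
        using S.tight_complement[of Z x d] o rr by blast+
    qed
    then show ?thesis using Z by blast
  qed
qed

lemma nsp_submap:
  assumes F: "F \<subseteq> edges M" and S: "bridge_closed (\<Union>F)" and root: "r \<in> \<Union>F" and "2 \<le> card F"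
  shows "nsp_map (submap M F)"
proof -
  interpret S: comb_map "submap M F" by (rule comb_map_submap[OF F])
  have t: "tight (submap M F)" by (rule tight_submap) fact+
  then have "planar_map (submap M F)"
    using S.tight_imp_connected by (intro planar_submap[OF planar F _ root]) blast
  then show ?thesis using t assms(4) by (simp add: nsp_map_iff edges_submap[OF F])
qed

text \<open>\<open>L\<close> is any map on \<open>A\<close> in which the two ends are merged. If
  \<open>x\<close> lies at the merged vertex, \<open>Z\<close> is bridge-closed and \<open>A\<close>
  is minimal. Otherwise \<open>Z\<close> or its complement avoids the merged vertex, is closed in
  \<open>M\<close> off \<open>x\<close> and therefore empty. Two constructions are covered at once:
  the block \<open>submap K EA\<close>, and the contraction of \<open>N1\<close> used in the
  recursion.\<close>

lemma tight_bridge: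
  assumes L: "comb_map L" and DL: "darts L = A" and oL: "\<And>d. d \<in> A \<Longrightarrow> opp L d = opp M d"
    and rL: "\<And>d. d \<in> A \<Longrightarrow> d \<notin> ends \<Longrightarrow> rot L d = rot M d"
    and vL: "\<And>d. d \<in> A \<Longrightarrow> vertex_of L d = (if d \<in> ends then ends \<inter> A else vertex_of M d)"
  shows "tight L"
  unfolding tight_def DL
proof (intro ballI allI impI)
  interpret L: comb_map L by fact
  fix x Z assume x: "x \<in> A" and Z: "Z \<subseteq> A" and o: "\<forall>d\<in>Z. opp L d \<in> Z"
    and rr: "\<forall>d\<in>Z. d \<notin> vertex_of L x \<longrightarrow> rot L d \<in> Z"
  show "Z = {} \<or> Z = A"
  proof (cases "x \<in> ends")
    case True
    have "bridge_closed Z"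
      unfolding bridge_closed_def
    proof (intro conjI ballI impI)
      show "Z \<subseteq> darts M" using Z A_sub_darts by blast
      fix d assume d: "d \<in> Z"
      then show "opp M d \<in> Z" using o oL Z by fastforce
      assume "d \<notin> ends"
      moreover have "d \<in> A" using d Z by blast
      ultimately have "d \<notin> vertex_of L x" "rot L d = rot M d" using rL vL[OF x] True by auto
      then show "rot M d \<in> Z" using rr d by metis
    qed
    then show ?thesis using A_minimal[of Z] Z by blast
  next
    case False
    have main: "Y = {}" if Y: "Y \<subseteq> A" "Y \<inter> ends = {}" and oY: "\<And>d. d \<in> Y \<Longrightarrow> opp L d \<in> Y"
      and rY: "\<And>d. d \<in> Y \<Longrightarrow> d \<notin> vertex_of L x \<Longrightarrow> rot L d \<in> Y" for Y
    proof -
      have "Y = {} \<or> Y = darts M"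
      proof (rule tightD[OF tight, of x])
        show "x \<in> darts M" "Y \<subseteq> darts M" using x Y A_sub_darts by auto
        fix d assume d: "d \<in> Y"
        then show "opp M d \<in> Y" using oY oL Y by fastforce
        assume "d \<notin> vertex_of M x"
        then have "rot L d \<in> Y" using rY[OF d] vL[OF x] False by simp
        moreover have "rot L d = rot M d" using rL d Y by blast
        ultimately show "rot M d \<in> Y" by simp
      qed
      then show ?thesis using Y root_in root_notin_A by blast
    qed
    show ?thesis
    proof (cases "Z \<inter> ends = {}")
      case True
      then show ?thesis using main[of Z] Z o rr by blast
    next
      case ne: False
      then obtain d where d: "d \<in> Z" "d \<in> ends" by blast
      have "vertex_of L d \<subseteq> Z"
        unfolding vertex_of_def
      proof (rule L.R.orbit_least[OF d(1)])
        fix z assume z: "z \<in> Z" "z \<in> orbit (rot L) d"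
        then have "z \<in> ends" using vL[of d] d Z by (auto simp: vertex_of_def)
        then have "z \<notin> vertex_of L x" using vL[OF x] False vertex_off_ends[OF False] by auto
        then show "rot L z \<in> Z" using rr z by blast
      qed
      then have sub: "ends \<inter> A \<subseteq> Z" using vL[of d] d Z by auto
      have "A - Z = {}"
      proof (rule main)
        fix e assume "e \<in> A - Z"
        then show "opp L e \<in> A - Z" "e \<notin> vertex_of L x \<Longrightarrow> rot L e \<in> A - Z"
          using L.tight_complement[of Z x e] o rr DL by auto
      qed (use sub in auto)
      then show ?thesis using Z by blast
    qed
  qed
qed

lemma EA_nonsep: "nonsep_submap K EA"
proof -
  have F: "EA \<subseteq> edges K" by (rule EA_sub_K)
  interpret L: comb_map "submap K EA" by (rule K.comb_map_submap[OF F])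
  have "tight (submap K EA)"
  proof (rule tight_bridge[OF L.comb_map_axioms])
    show "darts (submap K EA) = A" by simp
    fix d assume d: "d \<in> A"
    then have dK: "d \<in> darts K" using A_sub by blast
    have dU: "d \<in> \<Union>EA" using d by (simp only: Union_EA)
    show "opp (submap K EA) d = opp M d"
      using K.opp_submap_in[OF dU] dK by (simp add: opp_K)
    show "vertex_of (submap K EA) d = (if d \<in> ends then ends \<inter> A else vertex_of M d)"
    proof (cases "d \<in> ends")
      case True
      then show ?thesis using K.vertex_of_submap[OF F dU] vertex_of_K[OF dK] A_sub unfolding Union_EA darts_K
        by auto
    next
      case False
      then show ?thesis using K.vertex_of_submap[OF F dU] vertex_of_K[OF dK]
          bridge_closed_vertex[OF bridge_closed_A d False] unfolding Union_EA by auto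
    qed
    assume e: "d \<notin> ends"
    then have "rot M d \<in> \<Union>EA" 
      unfolding Union_EA using bridge_closed_rot[OF bridge_closed_A e] d by blast
    then show "rot (submap K EA) d = rot M d"
      using K.rot_submap_step[OF dU] rot_K_other[OF dK e] by simp
  qed
  then show ?thesis
    using L.tight_iff F EA_ne by (auto simp: nonsep_submap_def)
qed

text \<open>\<open>A\<close> can fail to be closed under rotation only at the ends, which form a
  single vertex of the contracted map. So within the darts \<open>S\<close> of a non-separable
  submap, \<open>A \<inter> S\<close> is closed off one vertex and must be all of
  \<open>S\<close>.\<close>

lemma nonsep_meets_EA:
  assumes G: "nonsep_submap K G" and ne: "G \<inter> EA \<noteq> {}"
  shows "G \<subseteq> EA"
proof -
  have sub: "G \<subseteq> edges K" using G by (simp add: nonsep_submap_def)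
  then have subM: "G \<subseteq> edges M" by (auto simp: edges_K)
  interpret L: comb_map "submap K G" by (rule K.comb_map_submap[OF sub])
  define S where "S = \<Union>G"
  have DS: "darts (submap K G) = S" by (simp add: S_def)
  have SK: "S \<subseteq> darts K" using K.Union_subset_darts[OF sub] by (simp add: S_def)
  have t: "tight (submap K G)" using G L.tight_iff by (auto simp: nonsep_submap_def)
  have neS: "A \<inter> S \<noteq> {}"
  proof -
    obtain e where "e \<in> G" "e \<in> EA" using ne by blast
    then obtain d where "d \<in> A" "edge_of M d \<in> G" by (auto simp: EA_def)
    then show ?thesis using in_Union_iff[OF subM] by (auto simp: S_def)
  qed
  have vS: "vertex_of (submap K G) d = vertex_of K d \<inter> S" if "d \<in> S" for d
    using K.vertex_of_submap[OF sub] that by (simp add: S_def)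
  obtain x where x: "x \<in> S" "ends \<inter> S \<subseteq> vertex_of (submap K G) x"
  proof (cases "ends \<inter> S = {}")
    case True
    then show ?thesis using that neS by blast
  next
    case False
    then obtain x where xx: "x \<in> ends" "x \<in> S" by blast
    then have "vertex_of (submap K G) x = (ends - {r, r'}) \<inter> S"
      using vS vertex_of_K SK by (metis subsetD)
    then show ?thesis using that[of x] xx SK darts_K by blast
  qed
  have "A \<inter> S = {} \<or> A \<inter> S = darts (submap K G)"
  proof (rule tightD[OF t])
    show "x \<in> darts (submap K G)" "A \<inter> S \<subseteq> darts (submap K G)" using x DS by auto
    fix d assume d: "d \<in> A \<inter> S"
    then have dK: "d \<in> darts K" using SK by blast
    have dU: "d \<in> \<Union>G" using d S_def by blast
    have "opp (submap K G) d = opp M d" using K.opp_submap_in[OF dU] dK by (simp add: opp_K)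
    moreover have "opp M d \<in> S" using opp_in_Union[OF subM, of d] dU S_def by blast
    ultimately show "opp (submap K G) d \<in> A \<inter> S" using d by simp
    assume "d \<notin> vertex_of (submap K G) x"
    then have de: "d \<notin> ends" using x d by blast
    have "rot (submap K G) d \<in> vertex_of (submap K G) d" by simp
    then have "rot (submap K G) d \<in> vertex_of M d \<inter> S" using vS[of d] d vertex_of_K[OF dK] de by auto
    then show "rot (submap K G) d \<in> A \<inter> S" using bridge_closed_vertex[OF bridge_closed_A _ de] d by blast
  qed
  then have "S \<subseteq> A" using neS DS by blast
  show ?thesis
  proof
    fix e assume e: "e \<in> G"
    then obtain d where d: "e = edge_of M d" using subM by (auto simp: edges_def)
    then have "d \<in> S" using e in_Union_iff[OF subM] by (simp add: S_def)
    then show "e \<in> EA" using d \<open>S \<subseteq> A\<close> by auto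
  qed
qed

section \<open>The blocks of the contracted map\<close>

lemma EA_block: "EA \<in> blocks K"
  unfolding blocks_def using EA_nonsep nonsep_meets_EA EA_ne by blast

lemma block_meets_EA: "F \<in> blocks K \<Longrightarrow> F \<inter> EA \<noteq> {} \<Longrightarrow> F = EA"
  using nonsep_meets_EA[of F] EA_nonsep unfolding blocks_def by blast

lemma innermost_block: "innermost_block M = EA"
  unfolding innermost_block_def
proof (rule the_equality)
  show "EA \<in> blocks K \<and> core_edges M \<subseteq> EA" using EA_block core_edges_sub by blast
  fix F assume "F \<in> blocks K \<and> core_edges M \<subseteq> F"
  then show "F = EA" using core_edges_ne core_edges_sub by (intro block_meets_EA) auto
qed

text \<open>Extended to a maximal set, this puts every edge of the contracted map into a block, so
  there is a second block as soon as \<open>EA\<close> is not everything.\<close>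

lemma nonsep_edge:
  assumes x: "x \<in> darts K"
  shows "nonsep_submap K {edge_of M x}"
proof -
  have e: "edge_of K x = edge_of M x" by (rule edge_of_K[OF x])
  have F: "{edge_of M x} \<subseteq> edges K" using x by (simp flip: e)
  interpret L: comb_map "submap K {edge_of M x}" by (rule K.comb_map_submap[OF F])
  have D: "darts (submap K {edge_of M x}) = {x, opp M x}" by (simp add: edge_of_def)
  have "tight (submap K {edge_of M x})"
    unfolding tight_def D
  proof (intro ballI allI impI)
    fix y Z assume Z: "Z \<subseteq> {x, opp M x}" and o: "\<forall>d\<in>Z. opp (submap K {edge_of M x}) d \<in> Z"
    have "opp (submap K {edge_of M x}) d = opp M d" if "d \<in> {x, opp M x}" for d
    proof -
      have "opp (submap K {edge_of M x}) d = opp K d"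
        using that by (intro K.opp_submap_in) (simp add: edge_of_def)
      also have "\<dots> = opp M d" using that x opp_in_K by (auto simp: opp_K)
      finally show ?thesis .
    qed
    then have o': "opp M d \<in> Z" if "d \<in> Z" for d using o that Z by fastforce
    have "x \<in> Z \<longleftrightarrow> opp M x \<in> Z" using o'[of x] o'[of "opp M x"] by (auto simp only: opp_opp)
    then show "Z = {} \<or> Z = {x, opp M x}" using Z by blast
  qed
  then show ?thesis using L.tight_iff F by (auto simp: nonsep_submap_def)
qed

lemma block_extends:
  assumes "nonsep_submap K F"
  obtains G where "F \<subseteq> G" "G \<in> blocks K"
proof -
  have fin: "finite {G. nonsep_submap K G \<and> F \<subseteq> G}"
    by (rule finite_subset[OF _ iffD2[OF finite_Pow_iff K.finite_edges]]) (auto simp: nonsep_submap_def)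
  obtain G where "G \<in> {G. nonsep_submap K G \<and> F \<subseteq> G}" "F \<subseteq> G"
    "\<And>H. H \<in> {G. nonsep_submap K G \<and> F \<subseteq> G} \<Longrightarrow> G \<subseteq> H \<Longrightarrow> G = H"
    using finite_has_maximal2[OF fin, of F] assms by auto
  then have "G \<in> blocks K" unfolding blocks_def by blast
  then show ?thesis using that \<open>F \<subseteq> G\<close> by blast
qed

lemma single_block_iff: "card (blocks K) = 1 \<longleftrightarrow> EA = edges K"
proof
  assume "card (blocks K) = 1"
  then obtain F0 where "blocks K = {F0}" by (auto simp: card_1_singleton_iff)
  then have bl: "blocks K = {EA}" using EA_block by simp
  show "EA = edges K"
  proof (rule ccontr)
    assume "EA \<noteq> edges K"
    then obtain x where x: "x \<in> darts K" "edge_of K x \<notin> EA" using EA_sub_K by (auto simp: edges_def)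
    then obtain G where "{edge_of M x} \<subseteq> G" "G \<in> blocks K" using block_extends[OF nonsep_edge] by blast
    then show False using bl x edge_of_K by auto
  qed
next
  assume e: "EA = edges K"
  have "F = EA" if "F \<in> blocks K" for F
    using that e by (intro block_meets_EA) (auto simp: blocks_def nonsep_submap_def)
  then have "blocks K = {EA}" using EA_block by blast
  then show "card (blocks K) = 1" by simp
qed

lemma single_edge_bridge:
  assumes "EA = {a}" "d \<in> A"
  shows "A = {d, opp M d}" "a = {d, opp M d}" "A \<subseteq> ends"
proof -
  have "edge_of M d = a" using assms edge_in_EA[of d] by blast
  then show a: "a = {d, opp M d}" by (simp add: edge_of_def)
  then show A: "A = {d, opp M d}" using assms Union_EA by simp
  obtain x y where xy: "x \<in> A" "x \<in> vertex_of M r" "y \<in> A" "y \<in> vertex_of M r'"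
    using bridge_meets_end[OF bridge_closed_A _ root_notin_A(1)] assms(2) by blast
  then have "x \<noteq> y" using ends_disjoint by blast
  then have "A = {x, y}" using xy A by auto
  then show "A \<subseteq> ends" using xy by auto
qed

text \<open>A bridge meets both ends, so a bridge with a single edge joins them and becomes a loop
  on contraction. This turns the loop case of \<open>phi_M\<close> into a condition on
  \<open>card EA\<close>.\<close>

lemma single_edge_iff: "(\<exists>a. EA = {a} \<and> is_loop K a) \<longleftrightarrow> card EA = 1"
proof
  assume "card EA = 1"
  then obtain a where a: "EA = {a}" by (auto simp: card_1_singleton_iff)
  define d where "d = b (m - 1)"
  have d: "d \<in> A" using last_in_A by (simp add: d_def)
  note A = single_edge_bridge[OF a d]
  have dK: "d \<in> darts K" using d A_sub by blast
  have "a \<subseteq> vertex_of K d" using A d A_sub vertex_of_K[OF dK] by (auto simp: darts_K)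
  moreover have "vertex_of K d \<in> vertices K" using dK by (simp add: vertices_def)
  moreover have "a \<in> edges K" using a EA_sub_K by blast
  ultimately show "\<exists>a. EA = {a} \<and> is_loop K a" using a by (auto simp: is_loop_def)
qed auto

lemma finite_EA: "finite EA"
  using EA_sub finite_edges finite_subset by blast

lemma card_edges_K: "card (edges M) = Suc (card (edges K))"
  using card_Suc_Diff1[OF finite_edges, of "root_edge M"] root_in by (simp add: edges_K root_edge_def)

lemma is_M0_iff: "is_M0 M \<longleftrightarrow> EA = edges K \<and> card EA = 1"
proof
  assume "is_M0 M"
  then have "card (edges M) = 2" by (simp add: is_M0_def)
  then have "card (edges K) = 1" using card_edges_K by simp
  then obtain x where x: "edges K = {x}" by (auto simp: card_1_singleton_iff)
  then have "EA = {x}" using EA_sub_K EA_ne unfolding x subset_singleton_iff by (simp only: simp_thms)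
  then show "EA = edges K \<and> card EA = 1" using x by simp
next
  assume e: "EA = edges K \<and> card EA = 1"
  then obtain a where a: "EA = {a}" by (auto simp: card_1_singleton_iff)
  have ce: "card (edges M) = 2" using card_edges_K e by auto
  have sub: "A \<subseteq> ends" using single_edge_bridge(3)[OF a last_in_A] .
  have D: "darts M = {r, r'} \<union> A"
  proof -
    have "root_edge M \<in> edges M" using root_in by (simp add: root_edge_def)
    then have "edges M = insert (root_edge M) EA" using e edges_K by auto
    then have "darts M = root_edge M \<union> \<Union>EA" using Union_edges by (metis Union_insert)
    then show ?thesis by (simp add: root_edge_def edge_of_def)
  qed
  have V: "vertices M = {vertex_of M r, vertex_of M r'}"
  proof (intro equalityI subsetI)
    fix v assume "v \<in> vertices M"
    then obtain d where d: "d \<in> darts M" "v = vertex_of M d" by (auto simp: vertices_def)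
    then have "d \<in> ends" using D sub by auto
    then show "v \<in> {vertex_of M r, vertex_of M r'}" using d vertex_of_eq by blast
  qed (use root_in root'_in in \<open>auto simp: vertices_def\<close>)
  moreover have "vertex_of M r \<noteq> vertex_of M r'" using nonloop by (metis self_in_vertex)
  moreover have "v \<inter> x \<noteq> {}" if v: "v \<in> vertices M" and x: "x \<in> edges M" for v x
  proof -
    have "x = root_edge M \<or> x \<in> EA" using x unfolding conjunct1[OF e] edges_K by blast
    then consider "x = root_edge M" | "x = a" unfolding a by blast
    then show ?thesis
    proof cases
      case 1
      then show ?thesis using v V self_in_vertex by (auto simp: root_edge_def edge_of_def)
    next
      case 2
      have "A = a" using a Union_EA by simp
      moreover have "A \<inter> vertex_of M r \<noteq> {}" "A \<inter> vertex_of M r' \<noteq> {}"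
        using bridge_meets_end[OF bridge_closed_A _ root_notin_A(1)] last_in_A by auto
      ultimately show ?thesis using 2 v V by auto
    qed
  qed
  ultimately show "is_M0 M" using ce by (simp add: is_M0_def)
qed

section \<open>The two submaps of the recursion\<close>

abbreviation M2 :: "'d rmap" where "M2 \<equiv> submap M (edges M - EA)"
abbreviation N1 :: "'d rmap" where "N1 \<equiv> submap M (insert (root_edge M) EA)"

lemma M2_edges: "edges M - EA \<subseteq> edges M" "\<Union>(edges M - EA) = darts M - A"
proof -
  show "edges M - EA \<subseteq> edges M" by blast
  have "d \<in> \<Union>(edges M - EA) \<longleftrightarrow> d \<in> darts M - A" for d
    using in_Union_iff[of "edges M - EA" d] by (simp del: Union_iff)
  then show "\<Union>(edges M - EA) = darts M - A" by blast
qed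

lemma N1_edges: "insert (root_edge M) EA \<subseteq> edges M" "\<Union>(insert (root_edge M) EA) = {r, r'} \<union> A"
  using EA_sub root_in by (simp_all add: root_edge_def) (simp add: edge_of_def)

lemma M2_nsp:
  assumes "EA \<noteq> edges K"
  shows "nsp_map M2"
proof (rule nsp_submap[OF M2_edges(1)])
  show "bridge_closed (\<Union>(edges M - EA))"
    unfolding M2_edges by (rule bridge_closed_complement[OF bridge_closed_A])
  show "r \<in> \<Union>(edges M - EA)" unfolding M2_edges using root_in root_notin_A by blast
  obtain e where e: "e \<in> edges M - EA" "e \<noteq> root_edge M"
    using assms EA_sub_K by (auto simp: edges_K)
  have "root_edge M \<in> edges M - EA" using root_in root_edge_notin by (simp add: root_edge_def)
  then have "{e, root_edge M} \<subseteq> edges M - EA" using e by blast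
  from card_mono[OF _ this] show "2 \<le> card (edges M - EA)" using e finite_edges by simp
qed

lemma N1_nsp: "nsp_map N1"
proof (rule nsp_submap[OF N1_edges(1)])
  show "bridge_closed (\<Union>(insert (root_edge M) EA))"
    unfolding N1_edges by (rule bridge_closed_Un[OF bridge_closed_root bridge_closed_A])
  show "r \<in> \<Union>(insert (root_edge M) EA)" unfolding N1_edges by blast
  have "0 < card EA" using EA_ne finite_EA by (simp add: card_gt_0_iff)
  then show "2 \<le> card (insert (root_edge M) EA)" using root_edge_notin finite_EA by simp
qed

lemma contractible_N1: "contractible N1 r r'"
proof -
  interpret N: comb_map N1 by (rule comb_map_submap[OF N1_edges(1)])
  interpret N: nsp N1 by unfold_locales (rule N1_nsp)
  have "opp N1 r = opp M r" by (rule opp_submap_in) (use N1_edges(2) in blast)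
  then show ?thesis using N.contractible_axioms by (simp add: N.r'_opp)
qed

end

section \<open>Depth-first search\<close>

lemma explore_examined: "\<forall>d\<in>set ds. edge_of M d \<in> E \<Longrightarrow> explore M p ds E \<delta> = ([], E, \<delta>)"
  by (induction ds) simp_all

lemma explore_Nil_iff:
  assumes "explore M p ds E \<delta> = ([], E', \<delta>')" "finite (darts M)" "set ds \<subseteq> darts M"
  shows "\<forall>d\<in>set ds. edge_of M d \<in> E"
  using assms by (induction ds) (auto split: if_splits option.splits prod.splits)

context comb_map
begin

lemma set_darts_after: "set (darts_after M f) = vertex_of M f - {f}"
proof -
  define N where "N = card (orbit (rot M) f)"
  have N: "0 < N" using R.card_orbit_pos[of f] by (simp add: N_def)
  have "set (darts_after M f) = (\<lambda>i. (rot M ^^ i) f) ` {1..<N}"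
    by (simp add: darts_after_def vertex_of_def N_def)
  moreover have "vertex_of M f = (\<lambda>i. (rot M ^^ i) f) ` {0..<N}"
    using R.orbit_enum_image[of f] by (simp add: N_def vertex_of_def)
  moreover have "{0..<N} = insert 0 {1..<N}" using N by auto
  moreover have "f \<notin> (\<lambda>i. (rot M ^^ i) f) ` {1..<N}"
  proof
    assume "f \<in> (\<lambda>i. (rot M ^^ i) f) ` {1..<N}"
    then obtain i where i: "i \<in> {1..<N}" "(rot M ^^ i) f = f" by force
    then have "(rot M ^^ i) f = (rot M ^^ 0) f" by simp
    then show False using inj_onD[OF R.inj_on_orbit_enum[of f], of i 0] i N by (simp add: N_def)
  qed
  ultimately show ?thesis by simp
qed

lemma darts_after_sub: "d \<in> darts M \<Longrightarrow> set (darts_after M d) \<subseteq> darts M"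
  using vertex_of_subset by (auto simp: set_darts_after)

text \<open>Induction over a run of the search with its result as a parameter. The map is fixed and
  the termination guard is discharged once and for all, which leaves the cases of an exhausted list,
  an examined edge, a visited vertex and a new vertex.\<close>

lemma explore_induct [consumes 2, case_names Nil skip seen new]:
  assumes eq: "explore M p ds E \<delta> = (ts, E', \<delta>')" and sub: "set ds \<subseteq> darts M"
    and Nil: "\<And>p E \<delta>. P p [] E \<delta> [] E \<delta>"
    and skip: "\<And>p d ds E \<delta> ts E' \<delta>'. d \<in> darts M \<Longrightarrow> set ds \<subseteq> darts M \<Longrightarrow> edge_of M d \<in> E \<Longrightarrow>
      P p ds E \<delta> ts E' \<delta>' \<Longrightarrow> P p (d # ds) E \<delta> ts E' \<delta>'"
    and seen: "\<And>p d ds E \<delta> k ts E' \<delta>'. d \<in> darts M \<Longrightarrow> set ds \<subseteq> darts M \<Longrightarrow> edge_of M d \<notin> E \<Longrightarrow>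
      \<delta> (vertex_of M (opp M d)) = Some k \<Longrightarrow>
      P p ds (insert (edge_of M d) E) \<delta> ts E' \<delta>' \<Longrightarrow> P p (d # ds) E \<delta> (Leaf k # ts) E' \<delta>'"
    and new: "\<And>p d ds E \<delta> us E1 \<delta>1 ts E' \<delta>'. d \<in> darts M \<Longrightarrow> set ds \<subseteq> darts M \<Longrightarrow> edge_of M d \<notin> E \<Longrightarrow>
      \<delta> (vertex_of M (opp M d)) = None \<Longrightarrow>
      P (p + 1) (darts_after M (opp M d)) (insert (edge_of M d) E) (\<delta>(vertex_of M (opp M d) \<mapsto> p + 1))
        us E1 \<delta>1 \<Longrightarrow>
      P p ds E1 \<delta>1 ts E' \<delta>' \<Longrightarrow> P p (d # ds) E \<delta> (Node (rev us) # ts) E' \<delta>'"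
  shows "P p ds E \<delta> ts E' \<delta>'"
proof -
  have "N = M \<Longrightarrow> explore N p ds E \<delta> = (ts, E', \<delta>') \<Longrightarrow> set ds \<subseteq> darts N \<Longrightarrow> P p ds E \<delta> ts E' \<delta>'" for N
  proof (induction N p ds E \<delta> arbitrary: ts E' \<delta>' rule: explore.induct)
    case (1 N p E \<delta>)
    then show ?case using Nil by simp
  next
    case (2 N p d ds E \<delta>)
    have N: "N = M" by (rule 2)
    have d: "d \<in> darts M" "set ds \<subseteq> darts M" and fin: "finite (darts N) \<and> d \<in> darts N"
      using 2 finite_darts by auto
    show ?case
    proof (cases "edge_of M d \<in> E")
      case True
      have "explore N p ds E \<delta> = (ts, E', \<delta>')" using "2.prems" True by simp
      then have "P p ds E \<delta> ts E' \<delta>'" using True d N by (intro "2.IH"(1)) auto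
      then show ?thesis using skip d True by blast
    next
      case False
      then have c: "\<not> (edge_of N d \<in> E \<or> \<not> (finite (darts N) \<and> d \<in> darts N))" using fin N by simp
      show ?thesis
      proof (cases "\<delta> (vertex_of M (opp M d))")
        case (Some k)
        obtain ts1 E1 \<delta>1 where e: "explore N p ds (insert (edge_of N d) E) \<delta> = (ts1, E1, \<delta>1)"
          by (metis prod_cases3)
        have eqs: "ts = Leaf k # ts1" "E1 = E'" "\<delta>1 = \<delta>'" using "2.prems" c Some e N by simp_all
        have IH: "P p ds (insert (edge_of M d) E) \<delta> ts1 E' \<delta>'"
          unfolding N[symmetric] eqs[symmetric]
          by (rule "2.IH"(4)[OF c _ N e]) (use Some d N in auto)
        show ?thesis unfolding eqs(1) by (rule seen[where \<delta> = \<delta>, OF d False Some IH])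
      next
        case None
        let ?\<delta> = "\<delta>(vertex_of N (opp N d) \<mapsto> p + 1)"
        obtain us E1 \<delta>1 where e1: "explore N (p + 1) (darts_after N (opp N d)) (insert (edge_of N d) E) ?\<delta> =
          (us, E1, \<delta>1)" by (metis prod_cases3)
        obtain ts1 E2 \<delta>2 where e2: "explore N p ds E1 \<delta>1 = (ts1, E2, \<delta>2)" by (metis prod_cases3)
        have eqs: "ts = Node (rev us) # ts1" "E2 = E'" "\<delta>2 = \<delta>'"
          using "2.prems" c None e1 e2 N by simp_all
        have None': "\<delta> (vertex_of N (opp N d)) = None" using None N by simp
        have IH1: "P (p + 1) (darts_after M (opp M d)) (insert (edge_of M d) E)
            (\<delta>(vertex_of M (opp M d) \<mapsto> p + 1)) us E1 \<delta>1"
          unfolding N[symmetric] by (rule "2.IH"(2)[OF c None' N e1]) (use darts_after_sub[of "opp M d"] d N in simp)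
        have IH2: "P p ds E1 \<delta>1 ts1 E' \<delta>'"
          unfolding eqs[symmetric] by (rule "2.IH"(3)[OF c None' e1[symmetric] refl N e2]) (use d N in simp)
        show ?thesis unfolding eqs(1) by (rule new[where \<delta> = \<delta>, OF d False None IH1 IH2])
      qed
    qed
  qed
  then show ?thesis using eq sub by blast
qed

text \<open>This allows the list of darts at the head to be split where the run of \<open>A\<close>
  begins.\<close>

lemma explore_append:
  assumes "explore M p ds E \<delta> = (ts, E', \<delta>')" "set ds \<subseteq> darts M"
    "explore M p ds2 E' \<delta>' = (ts2, E2, \<delta>2)"
  shows "explore M p (ds @ ds2) E \<delta> = (ts @ ts2, E2, \<delta>2)"
proof -
  have fin: "finite (darts M)" by (rule finite_darts)
  have "\<forall>d\<in>set ds. d \<in> darts M" using assms(2) by blast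
  then show ?thesis
    using assms(1,3)
  proof (induction ds arbitrary: ts E \<delta> E' \<delta>')
    case (Cons d ds)
    then show ?case using fin
      by (auto split: if_splits option.splits prod.splits)
  qed simp
qed

lemma explore_mono:
  assumes "explore M p ds E \<delta> = (ts, E', \<delta>')" "set ds \<subseteq> darts M"
  shows "E \<subseteq> E' \<and> (\<forall>x. \<delta> x \<noteq> None \<longrightarrow> \<delta>' x = \<delta> x) \<and> (\<forall>d\<in>set ds. edge_of M d \<in> E')"
  using assms
proof (induction rule: explore_induct)
  case (new p d ds E \<delta> us E1 \<delta>1 ts E' \<delta>')
  have "\<delta>' x = \<delta> x" if "\<delta> x \<noteq> None" for x
  proof -
    have "x \<noteq> vertex_of M (opp M d)" using that new by auto
    then have "\<delta>1 x = \<delta> x" using new.IH(1) that by (metis fun_upd_other)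
    then show ?thesis using new.IH(2) that by metis
  qed
  then show ?case using new by auto
qed auto

text \<open>The first two conjuncts work together: newly examined edges have both ends visited, and
  newly visited vertices have all their edges examined. So the examined edges are closed under
  rotation at every new vertex, which is how the search is shown to exhaust a bridge.\<close>

lemma explore_complete:
  assumes "explore M p ds E \<delta> = (ts, E', \<delta>')" "set ds \<subseteq> darts M" "\<forall>d\<in>set ds. \<delta> (vertex_of M d) \<noteq> None"
  shows "(\<forall>d\<in>darts M. \<delta> (vertex_of M d) = None \<longrightarrow> \<delta>' (vertex_of M d) \<noteq> None \<longrightarrow> edge_of M d \<in> E') \<and>
    (\<forall>d\<in>darts M. edge_of M d \<in> E' \<longrightarrow> edge_of M d \<in> E \<or> \<delta>' (vertex_of M d) \<noteq> None) \<and>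
    E \<subseteq> E' \<and> (\<forall>x. \<delta> x \<noteq> None \<longrightarrow> \<delta>' x \<noteq> None) \<and> (\<forall>d\<in>set ds. edge_of M d \<in> E')"
  using assms
proof (induction rule: explore_induct)
  case (seen p d ds E \<delta> k ts E' \<delta>')
  then have IH: "(\<forall>d\<in>darts M. \<delta> (vertex_of M d) = None \<longrightarrow> \<delta>' (vertex_of M d) \<noteq> None \<longrightarrow> edge_of M d \<in> E')"
    "(\<forall>e\<in>darts M. edge_of M e \<in> E' \<longrightarrow> edge_of M e \<in> insert (edge_of M d) E \<or> \<delta>' (vertex_of M e) \<noteq> None)"
    "insert (edge_of M d) E \<subseteq> E'" "(\<forall>x. \<delta> x \<noteq> None \<longrightarrow> \<delta>' x \<noteq> None)" "(\<forall>d\<in>set ds. edge_of M d \<in> E')"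
    by simp_all
  have "\<delta> (vertex_of M d) \<noteq> None" "\<delta> (vertex_of M (opp M d)) \<noteq> None" using seen by auto
  then have "\<delta>' (vertex_of M e) \<noteq> None" if "edge_of M e = edge_of M d" for e
    using that[symmetric] IH(4) unfolding edge_of_eq_iff by auto
  then show ?case using IH by auto
next
  case (new p d ds E \<delta> us E1 \<delta>1 ts E' \<delta>')
  let ?y = "vertex_of M (opp M d)"
  have nn: "(\<delta>(?y \<mapsto> p + 1)) (vertex_of M e) \<noteq> None" if "e \<in> set (darts_after M (opp M d))" for e
    using that vertex_of_eq[of e "opp M d"] by (simp add: set_darts_after)
  have IH1: "\<And>e. e \<in> darts M \<Longrightarrow> (\<delta>(?y \<mapsto> p + 1)) (vertex_of M e) = None \<Longrightarrow> \<delta>1 (vertex_of M e) \<noteq> None \<Longrightarrow> edge_of M e \<in> E1"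
    "\<And>e. e \<in> darts M \<Longrightarrow> edge_of M e \<in> E1 \<Longrightarrow> edge_of M e \<in> insert (edge_of M d) E \<or> \<delta>1 (vertex_of M e) \<noteq> None"
    "insert (edge_of M d) E \<subseteq> E1" "\<And>x. (\<delta>(?y \<mapsto> p + 1)) x \<noteq> None \<Longrightarrow> \<delta>1 x \<noteq> None"
    "\<And>e. e \<in> set (darts_after M (opp M d)) \<Longrightarrow> edge_of M e \<in> E1"
    using new.IH(1) nn by blast+
  have n1: "\<delta>1 x \<noteq> None" if "\<delta> x \<noteq> None \<or> x = ?y" for x using IH1(4)[of x] that by auto
  then have "\<forall>e\<in>set ds. \<delta>1 (vertex_of M e) \<noteq> None" using new.prems by simp
  then have IH2: "\<And>e. e \<in> darts M \<Longrightarrow> \<delta>1 (vertex_of M e) = None \<Longrightarrow> \<delta>' (vertex_of M e) \<noteq> None \<Longrightarrow> edge_of M e \<in> E'"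
    "\<And>e. e \<in> darts M \<Longrightarrow> edge_of M e \<in> E' \<Longrightarrow> edge_of M e \<in> E1 \<or> \<delta>' (vertex_of M e) \<noteq> None"
    "E1 \<subseteq> E'" "\<And>x. \<delta>1 x \<noteq> None \<Longrightarrow> \<delta>' x \<noteq> None"
    "\<And>e. e \<in> set ds \<Longrightarrow> edge_of M e \<in> E'"
    using new.IH(2) by blast+
  show ?case
  proof (intro conjI ballI impI allI)
    fix e assume e: "e \<in> darts M" "\<delta> (vertex_of M e) = None" "\<delta>' (vertex_of M e) \<noteq> None"
    show "edge_of M e \<in> E'"
    proof (cases "vertex_of M e = ?y")
      case True
      then have "e \<in> ?y" using self_in_vertex[of e] by simp
      then have "e = opp M d \<or> e \<in> set (darts_after M (opp M d))" by (auto simp: set_darts_after)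
      then have "edge_of M e \<in> E1" using IH1(3,5) by auto
      then show ?thesis using IH2(3) by blast
    next
      case False
      then have z: "(\<delta>(?y \<mapsto> p + 1)) (vertex_of M e) = None" using e by simp
      show ?thesis
      proof (cases "\<delta>1 (vertex_of M e) = None")
        case True
        then show ?thesis using IH2(1) e by blast
      next
        case False
        then show ?thesis using IH1(1)[OF e(1) z] IH2(3) by blast
      qed
    qed
  next
    fix e assume e: "e \<in> darts M" "edge_of M e \<in> E'"
    have "\<delta>' (vertex_of M e) \<noteq> None" if "edge_of M e = edge_of M d"
    proof -
      have "e = d \<or> e = opp M d" using that[symmetric] edge_of_eq_iff by blast
      then have "\<delta>1 (vertex_of M e) \<noteq> None" using n1[of "vertex_of M e"] new.prems by auto
      then show ?thesis by (rule IH2(4))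
    qed
    then show "edge_of M e \<in> E \<or> \<delta>' (vertex_of M e) \<noteq> None"
      using IH2(2)[OF e] IH1(2)[OF e(1)] IH2(4)[of "vertex_of M e"] by blast
  next
    show "E \<subseteq> E'" using IH1(3) IH2(3) by blast
    show "\<delta>' x \<noteq> None" if "\<delta> x \<noteq> None" for x using n1 IH2(4) that by blast
    show "edge_of M e \<in> E'" if "e \<in> set (d # ds)" for e
      using that IH2(3,5) IH1(3) by auto
  qed
qed auto

text \<open>The search spreads only by entering unvisited vertices, and an unvisited vertex with a
  dart in \<open>S\<close> lies entirely in \<open>S\<close>. Visited vertices act as walls.\<close>

lemma explore_frame:
  assumes "explore M p ds E \<delta> = (ts, E', \<delta>')" "set ds \<subseteq> darts M" "set ds \<subseteq> S"
    and S: "\<And>d. d \<in> S \<Longrightarrow> opp M d \<in> S" "\<And>d. d \<in> S \<Longrightarrow> \<delta> (vertex_of M d) = None \<Longrightarrow> vertex_of M d \<subseteq> S"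
  shows "E' \<subseteq> E \<union> edge_of M ` S \<and> (\<forall>x. x \<notin> vertex_of M ` S \<longrightarrow> \<delta>' x = \<delta> x) \<and>
    (\<forall>x. \<delta> x \<noteq> None \<longrightarrow> \<delta>' x \<noteq> None)"
  using assms(1-3) S(2)
proof (induction rule: explore_induct)
  case (new p d ds E \<delta> us E1 \<delta>1 ts E' \<delta>')
  let ?y = "vertex_of M (opp M d)"
  have oS: "opp M d \<in> S" using new.prems S(1) by simp
  have IH1: "E1 \<subseteq> insert (edge_of M d) E \<union> edge_of M ` S"
    "\<And>x. x \<notin> vertex_of M ` S \<Longrightarrow> \<delta>1 x = (\<delta>(?y \<mapsto> p + 1)) x"
    "\<And>x. (\<delta>(?y \<mapsto> p + 1)) x \<noteq> None \<Longrightarrow> \<delta>1 x \<noteq> None"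
  proof -
    have "set (darts_after M (opp M d)) \<subseteq> S"
      using new.prems(2)[OF oS] new.hyps by (auto simp: set_darts_after)
    moreover have "\<And>e. e \<in> S \<Longrightarrow> (\<delta>(?y \<mapsto> p + 1)) (vertex_of M e) = None \<Longrightarrow> vertex_of M e \<subseteq> S"
      using new.prems(2) by (auto split: if_splits)
    ultimately show "E1 \<subseteq> insert (edge_of M d) E \<union> edge_of M ` S"
      "\<And>x. x \<notin> vertex_of M ` S \<Longrightarrow> \<delta>1 x = (\<delta>(?y \<mapsto> p + 1)) x"
      "\<And>x. (\<delta>(?y \<mapsto> p + 1)) x \<noteq> None \<Longrightarrow> \<delta>1 x \<noteq> None"
      using new.IH(1) by blast+
  qed
  have n1: "\<delta>1 x \<noteq> None" if "\<delta> x \<noteq> None" for x using IH1(3)[of x] that by auto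
  have IH2: "E' \<subseteq> E1 \<union> edge_of M ` S"
    "\<And>x. x \<notin> vertex_of M ` S \<Longrightarrow> \<delta>' x = \<delta>1 x" "\<And>x. \<delta>1 x \<noteq> None \<Longrightarrow> \<delta>' x \<noteq> None"
  proof -
    have "set ds \<subseteq> S" using new.prems by simp
    moreover have "\<And>e. e \<in> S \<Longrightarrow> \<delta>1 (vertex_of M e) = None \<Longrightarrow> vertex_of M e \<subseteq> S"
      using new.prems(2) n1 by blast
    ultimately show "E' \<subseteq> E1 \<union> edge_of M ` S"
      "\<And>x. x \<notin> vertex_of M ` S \<Longrightarrow> \<delta>' x = \<delta>1 x" "\<And>x. \<delta>1 x \<noteq> None \<Longrightarrow> \<delta>' x \<noteq> None"
      using new.IH(2) by blast+
  qed
  have d: "edge_of M d \<in> edge_of M ` S" using new.prems by simp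
  show ?case
  proof (intro conjI allI impI)
    show "E' \<subseteq> E \<union> edge_of M ` S" using IH1(1) IH2(1) d by blast
    show "\<delta>' x = \<delta> x" if "x \<notin> vertex_of M ` S" for x
      using IH1(2)[OF that] IH2(2)[OF that] that oS by auto
    show "\<delta>' x \<noteq> None" if "\<delta> x \<noteq> None" for x by (rule IH2(3)[OF n1[OF that]])
  qed
next
  case (seen p d ds E \<delta> k ts E' \<delta>')
  have IH: "E' \<subseteq> insert (edge_of M d) E \<union> edge_of M ` S \<and> (\<forall>x. x \<notin> vertex_of M ` S \<longrightarrow> \<delta>' x = \<delta> x) \<and>
    (\<forall>x. \<delta> x \<noteq> None \<longrightarrow> \<delta>' x \<noteq> None)"
    by (rule seen.IH) (use seen.prems in auto)
  have "edge_of M d \<in> edge_of M ` S" using seen.prems by simp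
  then show ?case using IH by blast
qed simp_all

text \<open>Each newly examined edge at the vertex of depth -1 creates one leaf labeled -1: new
  vertices get positive depth, so this vertex is never entered and such an edge is always examined
  from its other end. Without loops it has exactly one dart there.\<close>

lemma explore_count:
  assumes "explore M p ds E \<delta> = (ts, E', \<delta>')" "set ds \<subseteq> darts M"
    and w: "\<And>d. d \<in> vertex_of M w \<Longrightarrow> opp M d \<notin> vertex_of M w"
    and "set ds \<inter> vertex_of M w = {}" "0 \<le> p"
    "\<And>x. \<delta> x = Some (-1) \<longleftrightarrow> x = vertex_of M w"
  shows "sum_list (map free_leaves ts) = card {d \<in> vertex_of M w. edge_of M d \<in> E' - E} \<and> E \<subseteq> E' \<and>
    (\<forall>x. \<delta>' x = Some (-1) \<longleftrightarrow> x = vertex_of M w)"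
  using assms(1,2,4-)
proof (induction rule: explore_induct)
  case (seen p d ds E \<delta> k ts E' \<delta>')
  let ?V = "vertex_of M w"
  have IH: "sum_list (map free_leaves ts) = card {e \<in> ?V. edge_of M e \<in> E' - insert (edge_of M d) E}"
    "insert (edge_of M d) E \<subseteq> E'" "\<forall>x. \<delta>' x = Some (-1) \<longleftrightarrow> x = ?V"
    using seen by simp_all
  have dV: "d \<notin> ?V" using seen.prems by simp
  have k: "k = -1 \<longleftrightarrow> opp M d \<in> ?V"
    using seen.hyps(4) seen.prems(3)[of "vertex_of M (opp M d)"] vertex_of_eq_iff by auto
  have fl: "free_leaves (Leaf k) = (if k = -1 then 1 else 0)" by (simp add: free_leaves_def)
  have fin: "finite {e \<in> ?V. edge_of M e \<in> E' - insert (edge_of M d) E}" using finite_vertex_of by simp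
  have "{e \<in> ?V. edge_of M e \<in> E' - E} =
    {e \<in> ?V. edge_of M e \<in> E' - insert (edge_of M d) E} \<union> {e \<in> ?V. edge_of M e = edge_of M d}"
    using IH(2) seen.hyps(3) by auto
  moreover have "{e \<in> ?V. edge_of M e = edge_of M d} = (if k = -1 then {opp M d} else {})"
  proof -
    have "edge_of M e = edge_of M d \<longleftrightarrow> e = d \<or> e = opp M d" for e
      using edge_of_eq_iff[of d e] by auto
    then show ?thesis using k dV by auto
  qed
  ultimately show ?case using IH fl fin by (cases "k = -1") simp_all
next
  case (new p d ds E \<delta> us E1 \<delta>1 ts E' \<delta>')
  let ?V = "vertex_of M w" and ?y = "vertex_of M (opp M d)"
  have yV: "?y \<noteq> ?V" using new.hyps(4) new.prems(3)[of ?V] by auto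
  have dV: "d \<notin> ?V" using new.prems by simp
  have oV: "opp M d \<notin> ?V" using yV vertex_of_eq by blast
  have disj: "set (darts_after M (opp M d)) \<inter> ?V = {}"
    using vertex_of_disjoint[OF oV] by (auto simp: set_darts_after)
  have "\<And>x. (\<delta>(?y \<mapsto> p + 1)) x = Some (-1) \<longleftrightarrow> x = ?V" using new.prems yV by auto
  then have IH1: "sum_list (map free_leaves us) = card {e \<in> ?V. edge_of M e \<in> E1 - insert (edge_of M d) E}"
    "insert (edge_of M d) E \<subseteq> E1" "\<And>x. \<delta>1 x = Some (-1) \<longleftrightarrow> x = ?V"
    using new.IH(1) disj new.prems(2) by simp_all
  then have IH2: "sum_list (map free_leaves ts) = card {e \<in> ?V. edge_of M e \<in> E' - E1}"
    "E1 \<subseteq> E'" "\<forall>x. \<delta>' x = Some (-1) \<longleftrightarrow> x = ?V"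
    using new.IH(2) new.prems by simp_all
  have fl: "free_leaves (Node (rev us)) = sum_list (map free_leaves us)"
    by (simp add: free_leaves_def[abs_def] filter_concat length_concat comp_def rev_map[symmetric] sum_list_rev)
  have ne: "edge_of M e \<noteq> edge_of M d" if "e \<in> ?V" for e
    using that dV oV edge_of_eq_iff[of d e] by auto
  have "{e \<in> ?V. edge_of M e \<in> E' - E} =
    {e \<in> ?V. edge_of M e \<in> E1 - insert (edge_of M d) E} \<union> {e \<in> ?V. edge_of M e \<in> E' - E1}"
    using IH1(2) IH2(2) ne by auto
  moreover have "{e \<in> ?V. edge_of M e \<in> E1 - insert (edge_of M d) E} \<inter> {e \<in> ?V. edge_of M e \<in> E' - E1} = {}"
    by blast
  ultimately have "card {e \<in> ?V. edge_of M e \<in> E' - E} = sum_list (map free_leaves us) + sum_list (map free_leaves ts)"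
    using IH1 IH2 finite_vertex_of by (simp add: card_Un_disjoint)
  then show ?case using fl IH1(2) IH2(2,3) by auto
qed auto

end

section \<open>Dependence of the search on the map and on the depths\<close>

fun relabel :: "(int \<Rightarrow> int) \<Rightarrow> dtree \<Rightarrow> dtree" where
  "relabel g (Leaf l) = Leaf (g l)"
| "relabel g (Node ts) = Node (map (relabel g) ts)"

lemma relabel_id [simp]: "relabel (\<lambda>l. l) t = t"
  by (induction t) (auto intro: map_idI)

lemma lower_labels_eq_relabel: "lower_labels t = relabel (\<lambda>l. if l = -1 then l else l - 1) t"
  by (induction t) auto

lemma darts_after_cong:
  assumes "\<And>x. x \<in> vertex_of M f \<Longrightarrow> rot N x = rot M x" "f \<in> vertex_of M f"
  shows "vertex_of N f = vertex_of M f" "darts_after N f = darts_after M f"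
proof -
  show v: "vertex_of N f = vertex_of M f"
    using orbit_cong[of f "rot M" "rot N"] assms by (simp add: vertex_of_def)
  have "(rot N ^^ n) f = (rot M ^^ n) f \<and> (rot M ^^ n) f \<in> vertex_of M f" for n
  proof (induction n)
    case (Suc n)
    then show ?case using assms(1) by (auto simp: vertex_of_def intro: orbit.step)
  qed (use assms in simp)
  then show "darts_after N f = darts_after M f" by (simp add: darts_after_def v)
qed

text \<open>The search only depends on the part \<open>S\<close> of the map that it can reach without passing through
  visited vertices, and shifts with the depths.\<close>

lemma (in comb_map) explore_transfer:
  fixes N :: "'d rmap" and g :: "int \<Rightarrow> int"
  assumes "explore M p ds E \<delta> = (ts, E', \<delta>')" "set ds \<subseteq> darts M" "set ds \<subseteq> S"
    and N: "comb_map N" "S \<subseteq> darts N" "\<And>d. d \<in> S \<Longrightarrow> opp N d = opp M d \<and> opp M d \<in> S"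
    and g: "\<And>q. p0 \<le> q \<Longrightarrow> g (q + 1) = g q + 1"
    and "p0 \<le> p" and E: "\<And>d. d \<in> S \<Longrightarrow> edge_of M d \<in> E \<longleftrightarrow> edge_of M d \<in> EN"
    and \<delta>: "\<And>d. d \<in> S \<Longrightarrow> \<delta>N (vertex_of N d) = map_option g (\<delta> (vertex_of M d))"
    and rot: "\<And>d. d \<in> S \<Longrightarrow> \<delta> (vertex_of M d) = None \<Longrightarrow>
      vertex_of M d \<subseteq> S \<and> (\<forall>x\<in>vertex_of M d. rot N x = rot M x)"
  shows "\<exists>EN' \<delta>N'. explore N (g p) ds EN \<delta>N = (map (relabel g) ts, EN', \<delta>N') \<and>
    (\<forall>d\<in>S. edge_of M d \<in> E' \<longleftrightarrow> edge_of M d \<in> EN') \<and>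
    (\<forall>d\<in>S. \<delta>N' (vertex_of N d) = map_option g (\<delta>' (vertex_of M d))) \<and>
    (\<forall>x. \<delta> x \<noteq> None \<longrightarrow> \<delta>' x \<noteq> None)"
proof -
  interpret N: comb_map N by fact
  let ?out = "\<lambda>E' EN' \<delta>N' \<delta>' \<delta>. (\<forall>d\<in>S. edge_of M d \<in> E' \<longleftrightarrow> edge_of M d \<in> EN') \<and>
    (\<forall>d\<in>S. \<delta>N' (vertex_of N d) = map_option g (\<delta>' (vertex_of M d))) \<and>
    (\<forall>x. \<delta> x \<noteq> None \<longrightarrow> \<delta>' x \<noteq> None)"
  have edgeN: "edge_of N d = edge_of M d" if "d \<in> S" for d using N(3)[OF that] by (simp add: edge_of_def)
  \<comment> \<open>The hypotheses about the state are part of the induction formula, since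
    \<open>E\<close>, \<open>\<delta>\<close> and their counterparts in \<open>N\<close> change
    during the run.\<close>
  have "set ds \<subseteq> S \<longrightarrow> p0 \<le> p \<longrightarrow> (\<forall>d\<in>S. edge_of M d \<in> E \<longleftrightarrow> edge_of M d \<in> EN) \<longrightarrow>
    (\<forall>d\<in>S. \<delta>N (vertex_of N d) = map_option g (\<delta> (vertex_of M d))) \<longrightarrow>
    (\<forall>d\<in>S. \<delta> (vertex_of M d) = None \<longrightarrow> vertex_of M d \<subseteq> S \<and> (\<forall>x\<in>vertex_of M d. rot N x = rot M x)) \<longrightarrow>
    (\<exists>EN' \<delta>N'. explore N (g p) ds EN \<delta>N = (map (relabel g) ts, EN', \<delta>N') \<and>
    ?out E' EN' \<delta>N' \<delta>' \<delta>)" for EN \<delta>N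
    using assms(1,2)
  proof (induction arbitrary: EN \<delta>N rule: explore_induct)
    case (Nil p E \<delta>)
    then show ?case by simp
  next
    case (skip p d ds E \<delta> ts E' \<delta>')
    show ?case
    proof (intro impI)
      assume a: "set (d # ds) \<subseteq> S" "p0 \<le> p" "\<forall>d\<in>S. edge_of M d \<in> E \<longleftrightarrow> edge_of M d \<in> EN"
        "\<forall>d\<in>S. \<delta>N (vertex_of N d) = map_option g (\<delta> (vertex_of M d))"
        "\<forall>d\<in>S. \<delta> (vertex_of M d) = None \<longrightarrow> vertex_of M d \<subseteq> S \<and> (\<forall>x\<in>vertex_of M d. rot N x = rot M x)"
      have "edge_of N d \<in> EN" using a skip.hyps edgeN by simp
      then have "explore N (g p) (d # ds) EN \<delta>N = explore N (g p) ds EN \<delta>N" by simp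
      then show "\<exists>EN' \<delta>N'. explore N (g p) (d # ds) EN \<delta>N = (map (relabel g) ts, EN', \<delta>N') \<and>
        ?out E' EN' \<delta>N' \<delta>' \<delta>"
        using skip.IH[of EN \<delta>N] a by simp
    qed
  next
    case (seen p d ds E \<delta> k ts E' \<delta>')
    show ?case
    proof (intro impI)
      assume a: "set (d # ds) \<subseteq> S" "p0 \<le> p" "\<forall>d\<in>S. edge_of M d \<in> E \<longleftrightarrow> edge_of M d \<in> EN"
        "\<forall>d\<in>S. \<delta>N (vertex_of N d) = map_option g (\<delta> (vertex_of M d))"
        "\<forall>d\<in>S. \<delta> (vertex_of M d) = None \<longrightarrow> vertex_of M d \<subseteq> S \<and> (\<forall>x\<in>vertex_of M d. rot N x = rot M x)"
      have d: "d \<in> S" using a by simp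
      have c: "edge_of N d = edge_of M d" "edge_of M d \<notin> EN" "d \<in> darts N" "opp N d = opp M d"
        using a seen.hyps edgeN d N by auto
      have "\<delta>N (vertex_of N (opp M d)) = Some (g k)" using a(4) N(3)[OF d] seen.hyps(4) by simp
      then have step: "explore N (g p) (d # ds) EN \<delta>N = (case explore N (g p) ds (insert (edge_of M d) EN) \<delta>N of
        (ts, E', \<delta>') \<Rightarrow> (Leaf (g k) # ts, E', \<delta>'))"
        using c N.finite_darts by simp
      have "\<exists>EN' \<delta>N'. explore N (g p) ds (insert (edge_of M d) EN) \<delta>N = (map (relabel g) ts, EN', \<delta>N') \<and>
        ?out E' EN' \<delta>N' \<delta>' \<delta>"
        using seen.IH[of "insert (edge_of M d) EN" \<delta>N] a by simp
      then show "\<exists>EN' \<delta>N'. explore N (g p) (d # ds) EN \<delta>N = (map (relabel g) (Leaf k # ts), EN', \<delta>N') \<and>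
        ?out E' EN' \<delta>N' \<delta>' \<delta>"
        unfolding step by auto
    qed
  next
    case (new p d ds E \<delta> us E1 \<delta>1 ts E' \<delta>')
    show ?case
    proof (intro impI)
      assume a: "set (d # ds) \<subseteq> S" "p0 \<le> p" "\<forall>d\<in>S. edge_of M d \<in> E \<longleftrightarrow> edge_of M d \<in> EN"
        "\<forall>d\<in>S. \<delta>N (vertex_of N d) = map_option g (\<delta> (vertex_of M d))"
        "\<forall>d\<in>S. \<delta> (vertex_of M d) = None \<longrightarrow> vertex_of M d \<subseteq> S \<and> (\<forall>x\<in>vertex_of M d. rot N x = rot M x)"
      let ?y = "vertex_of M (opp M d)"
      have d: "d \<in> S" and o: "opp M d \<in> S" using a N(3) by auto
      have c: "edge_of N d = edge_of M d" "edge_of M d \<notin> EN" "d \<in> darts N" "opp N d = opp M d"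
        using a(3) d new.hyps(3) edgeN N by auto
      have y: "?y \<subseteq> S" "\<forall>x\<in>?y. rot N x = rot M x" using a(5) o new.hyps(4) by blast+
      have yN: "vertex_of N (opp M d) = ?y" "darts_after N (opp M d) = darts_after M (opp M d)"
        using y(2) by (intro darts_after_cong; simp)+
      have dN: "\<delta>N ?y = None" using bspec[OF a(4) o] new.hyps(4) yN by simp
      \<comment> \<open>\<open>N\<close> may merge visited vertices. For the update of the depths it
        is enough that the new vertex corresponds to itself and to nothing else.\<close>
      have vy: "vertex_of N e = ?y \<longleftrightarrow> vertex_of M e = ?y" if e: "e \<in> S" for e
      proof
        assume "vertex_of N e = ?y"
        then have "e \<in> ?y" using N.self_in_vertex[of e] by simp
        then show "vertex_of M e = ?y" by (rule vertex_of_eq)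
      next
        assume v: "vertex_of M e = ?y"
        then have "e \<in> vertex_of N (opp M d)" using self_in_vertex[of e] yN by simp
        then show "vertex_of N e = ?y" using N.vertex_of_eq[of e "opp M d"] yN by simp
      qed
      \<comment> \<open>The shift is required from \<open>p0\<close> on, where new depths arise by
        adding one; below \<open>p0\<close>, \<open>g\<close> may identify depths, as it will for
        the two ends of the root.\<close>
      have gp: "g (p + 1) = g p + 1" using g a(2) by blast
      have "\<exists>EN' \<delta>N'. explore N (g (p + 1)) (darts_after M (opp M d)) (insert (edge_of M d) EN) (\<delta>N(?y \<mapsto> g (p + 1))) =
          (map (relabel g) us, EN', \<delta>N') \<and>
        ?out E1 EN' \<delta>N' \<delta>1 (\<delta>(?y \<mapsto> p + 1))"
      proof (rule new.IH(1)[rule_format])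
        show "set (darts_after M (opp M d)) \<subseteq> S" using y(1) by (auto simp: set_darts_after)
        show "p0 \<le> p + 1" using a(2) by simp
        fix e assume e: "e \<in> S"
        show "(edge_of M e \<in> insert (edge_of M d) E) = (edge_of M e \<in> insert (edge_of M d) EN)"
          using a(3) e by blast
        show "(\<delta>N(?y \<mapsto> g (p + 1))) (vertex_of N e) = map_option g ((\<delta>(?y \<mapsto> p + 1)) (vertex_of M e))"
          using vy[OF e] bspec[OF a(4) e] by simp
        assume "(\<delta>(?y \<mapsto> p + 1)) (vertex_of M e) = None"
        then have "\<delta> (vertex_of M e) = None" by (simp split: if_splits)
        then show "vertex_of M e \<subseteq> S \<and> (\<forall>x\<in>vertex_of M e. rot N x = rot M x)" using a(5) e by blast
      qed
      then obtain EN1 \<delta>N1 where e1: "explore N (g p + 1) (darts_after M (opp M d)) (insert (edge_of M d) EN)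
          (\<delta>N(?y \<mapsto> g p + 1)) = (map (relabel g) us, EN1, \<delta>N1)"
        and h1: "\<forall>d\<in>S. edge_of M d \<in> E1 \<longleftrightarrow> edge_of M d \<in> EN1"
          "\<forall>d\<in>S. \<delta>N1 (vertex_of N d) = map_option g (\<delta>1 (vertex_of M d))"
          "\<forall>x. (\<delta>(?y \<mapsto> p + 1)) x \<noteq> None \<longrightarrow> \<delta>1 x \<noteq> None" unfolding gp by blast
      have n1: "\<delta>1 x \<noteq> None" if "\<delta> x \<noteq> None" for x using spec[OF h1(3), of x] that by auto
      have "\<exists>EN' \<delta>N'. explore N (g p) ds EN1 \<delta>N1 = (map (relabel g) ts, EN', \<delta>N') \<and>
        ?out E' EN' \<delta>N' \<delta>' \<delta>1"
      proof (rule new.IH(2)[rule_format])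
        show "set ds \<subseteq> S" using a(1) by simp
        fix e assume e: "e \<in> S"
        show "(edge_of M e \<in> E1) = (edge_of M e \<in> EN1)" using h1(1) e by blast
        show "\<delta>N1 (vertex_of N e) = map_option g (\<delta>1 (vertex_of M e))" using h1(2) e by blast
        assume "\<delta>1 (vertex_of M e) = None"
        then have "\<delta> (vertex_of M e) = None" using n1 by blast
        then show "vertex_of M e \<subseteq> S \<and> (\<forall>x\<in>vertex_of M e. rot N x = rot M x)" using a(5) e by blast
      qed (rule a(2))
      then obtain EN2 \<delta>N2 where e2: "explore N (g p) ds EN1 \<delta>N1 = (map (relabel g) ts, EN2, \<delta>N2)"
        and h2: "\<forall>d\<in>S. edge_of M d \<in> E' \<longleftrightarrow> edge_of M d \<in> EN2"
          "\<forall>d\<in>S. \<delta>N2 (vertex_of N d) = map_option g (\<delta>' (vertex_of M d))"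
          "\<forall>x. \<delta>1 x \<noteq> None \<longrightarrow> \<delta>' x \<noteq> None" by blast
      have "explore N (g p) (d # ds) EN \<delta>N = (map (relabel g) (Node (rev us) # ts), EN2, \<delta>N2)"
        using c N.finite_darts dN yN e1 e2 by (simp add: rev_map)
      moreover have "\<forall>x. \<delta> x \<noteq> None \<longrightarrow> \<delta>' x \<noteq> None"
        using h2(3) n1 by (intro allI impI) (simp only: not_False_eq_True)
      ultimately show "\<exists>EN' \<delta>N'. explore N (g p) (d # ds) EN \<delta>N = (map (relabel g) (Node (rev us) # ts), EN', \<delta>N') \<and>
        ?out E' EN' \<delta>N' \<delta>' \<delta>"
        using h2(1,2) by (intro exI[of _ EN2] exI[of _ \<delta>N2] conjI)
    qed
  qed
  note main = this
  show ?thesis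
  proof (rule main[rule_format])
    show "set ds \<subseteq> S" "p0 \<le> p" by fact+
    fix d assume d: "d \<in> S"
    show "edge_of M d \<in> E \<longleftrightarrow> edge_of M d \<in> EN" by (rule E[OF d])
    show "\<delta>N (vertex_of N d) = map_option g (\<delta> (vertex_of M d))" by (rule \<delta>[OF d])
    assume "\<delta> (vertex_of M d) = None"
    then show "vertex_of M d \<subseteq> S \<and> (\<forall>x\<in>vertex_of M d. rot N x = rot M x)" by (rule rot[OF d])
  qed
qed

section \<open>The search tree of an NSP-map\<close>

context nsp
begin

abbreviation K1 :: "'d rmap" where "K1 \<equiv> contract_root N1"

lemma vertex_of_N1: "d \<in> {r, r'} \<union> A \<Longrightarrow> vertex_of N1 d = vertex_of M d \<inter> ({r, r'} \<union> A)"
  using vertex_of_submap[OF N1_edges(1), of d] unfolding N1_edges(2) .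

lemma rot_N1: "d \<in> A \<Longrightarrow> d \<notin> ends \<Longrightarrow> rot N1 d = rot M d"
proof (rule rot_submap_step; unfold N1_edges(2))
  assume "d \<in> A" "d \<notin> ends"
  then show "rot M d \<in> {r, r'} \<union> A" using bridge_closed_rot[OF bridge_closed_A] by blast
qed simp

lemma darts_K1: "darts K1 = A"
proof -
  interpret C: contractible N1 r r' by (rule contractible_N1)
  show ?thesis unfolding C.darts_K darts_submap N1_edges(2) using root_notin_A by blast
qed

lemma opp_K1: "d \<in> A \<Longrightarrow> opp K1 d = opp M d"
proof -
  interpret C: contractible N1 r r' by (rule contractible_N1)
  assume d: "d \<in> A"
  then have "opp K1 d = opp N1 d" using C.opp_K[of d] darts_K1 by simp
  also have "\<dots> = opp M d" by (rule opp_submap_in) (use d N1_edges(2) in blast)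
  finally show ?thesis .
qed

lemma ends_N1: "vertex_of N1 r \<union> vertex_of N1 r' = ends \<inter> ({r, r'} \<union> A)"
  using vertex_of_N1[of r] vertex_of_N1[of r'] by blast

lemma rot_K1: "d \<in> A \<Longrightarrow> d \<notin> ends \<Longrightarrow> rot K1 d = rot M d"
proof -
  interpret C: contractible N1 r r' by (rule contractible_N1)
  assume d: "d \<in> A" "d \<notin> ends"
  have "rot K1 d = rot N1 d" by (rule C.rot_K_other) (use d darts_K1 ends_N1 in blast)+
  then show ?thesis using rot_N1[OF d] by simp
qed

lemma vertex_of_K1: "d \<in> A \<Longrightarrow> vertex_of K1 d = (if d \<in> ends then ends \<inter> A else vertex_of M d)"
proof -
  interpret C: contractible N1 r r' by (rule contractible_N1)
  assume d: "d \<in> A"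
  have v: "vertex_of K1 d = (if d \<in> vertex_of N1 r \<union> vertex_of N1 r'
      then (vertex_of N1 r \<union> vertex_of N1 r') - {r, r'} else vertex_of N1 d)"
    by (rule C.vertex_of_K) (use d darts_K1 in blast)
  show ?thesis
  proof (cases "d \<in> ends")
    case True
    then show ?thesis using v d root_notin_A unfolding ends_N1 by auto
  next
    case False
    then show ?thesis using v vertex_of_N1[of d] bridge_closed_vertex[OF bridge_closed_A d False] d
      unfolding ends_N1 by auto
  qed
qed

lemma comb_map_K1: "comb_map K1"
proof -
  interpret C: contractible N1 r r' by (rule contractible_N1)
  show ?thesis by (rule C.comb_map_K)
qed

lemma nsp_K1:
  assumes "card EA \<noteq> 1"
  shows "nsp_map K1"
proof -
  interpret C: contractible N1 r r' by (rule contractible_N1)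
  interpret L: comb_map K1 by (rule comb_map_K1)
  have "planar_map K1" by (rule C.planar_K) (use N1_nsp nsp_map_iff in blast)
  moreover have "tight K1"
    by (rule tight_bridge[OF comb_map_K1 darts_K1 opp_K1 rot_K1 vertex_of_K1])
  moreover have "edges K1 = EA"
  proof -
    have "edge_of K1 d = edge_of M d" if "d \<in> A" for d using opp_K1[OF that] by (simp add: edge_of_def)
    then have "edge_of K1 ` A = edge_of M ` A" by (intro image_cong) auto
    also have "\<dots> = EA" by (simp only: EA_def)
    finally show ?thesis by (simp only: edges_def darts_K1)
  qed
  moreover have "card EA \<noteq> 0" using EA_ne finite_EA by simp
  ultimately show ?thesis using assms by (simp add: nsp_map_iff)
qed

lemma b_power: "b i = (rot M ^^ i) r'"
  by (simp add: b_def)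

text \<open>In \<open>N1\<close>, the dart after \<open>r'\<close> is the first dart of
  \<open>A\<close> at the head. So the search of the contraction starts along the very edge by which
  the search of \<open>M\<close> enters the bridge.\<close>

lemma root_K1:
  assumes i: "0 < i" "i < m" "\<And>j. j < m \<Longrightarrow> b j \<in> A \<longleftrightarrow> i \<le> j"
  shows "root_dart K1 = b i"
proof -
  interpret C: contractible N1 r r' by (rule contractible_N1)
  have "root_dart K1 = rot N1 r'" by (rule C.root_K)
  also have "\<dots> = first_return (rot M) ({r, r'} \<union> A) r'"
    unfolding rot_submap N1_edges(2) by (simp add: R.restricted_def)
  also have "\<dots> = b i"
  proof -
    have "(LEAST n. 0 < n \<and> (rot M ^^ n) r' \<in> {r, r'} \<union> A) = i"
    proof (rule Least_equality)
      show "0 < i \<and> (rot M ^^ i) r' \<in> {r, r'} \<union> A" using i by (simp flip: b_power)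
      fix n assume n: "0 < n \<and> (rot M ^^ n) r' \<in> {r, r'} \<union> A"
      then have bn: "b n \<in> {r, r'} \<union> A" by (simp add: b_power)
      show "i \<le> n"
      proof (rule ccontr)
        assume "\<not> i \<le> n"
        then show False using bn b_neq_root[of n] i(3)[of n] n i(2) by auto
      qed
    qed
    then show ?thesis by (simp add: first_return_def b_power)
  qed
  finally show ?thesis .
qed

lemma darts_after_head: "darts_after M r' = map b [1..<m]"
  by (simp add: darts_after_def m_def b_def[abs_def])

lemma T_map_eq: "T_map M = Node (rev (fst (explore M 0 (map b [1..<m]) {root_edge M}
  [vertex_of M r \<mapsto> -1, vertex_of M r' \<mapsto> 0])))"
  using darts_after_head by (simp add: T_map_def Let_def)

text \<open>Before the run of \<open>A\<close>, the search stays in the other bridges. It leaves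
  \<open>A\<close> untouched, and it is also the search of \<open>M2\<close>, whose head carries
  exactly these darts. The first five conclusions describe the state in which the run of
  \<open>A\<close> is entered.\<close>

lemma explore_outer:
  assumes i: "0 < i" "i < m" "\<And>j. j < m \<Longrightarrow> b j \<in> A \<longleftrightarrow> i \<le> j"
    and e: "explore M 0 (map b [1..<i]) {root_edge M} [vertex_of M r \<mapsto> -1, vertex_of M r' \<mapsto> 0] = (ts, E1, \<delta>1)"
  shows "\<And>d. d \<in> A \<Longrightarrow> edge_of M d \<notin> E1"
    and "\<And>d. d \<in> A \<Longrightarrow> d \<notin> ends \<Longrightarrow> \<delta>1 (vertex_of M d) = None"
    and "\<delta>1 (vertex_of M r) = Some (-1)" "\<delta>1 (vertex_of M r') = Some 0"
    and "\<And>x. \<delta>1 x = Some (-1) \<longleftrightarrow> x = vertex_of M r"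
    and "1 < i \<Longrightarrow> T_map M2 = Node (rev ts)"
proof -
  define S where "S = darts M - ({r, r'} \<union> A)"
  define \<delta>0 where "\<delta>0 = [vertex_of M r \<mapsto> (-1::int), vertex_of M r' \<mapsto> 0]"
  have e0: "explore M 0 (map b [1..<i]) {root_edge M} \<delta>0 = (ts, E1, \<delta>1)" using e by (simp add: \<delta>0_def)
  have rr: "vertex_of M r \<noteq> vertex_of M r'" using nonloop vertex_of_eq_iff by blast
  have S_closed: "bridge_closed S"
    unfolding S_def by (rule bridge_closed_complement[OF bridge_closed_Un[OF bridge_closed_root bridge_closed_A]])
  have \<delta>0: "\<delta>0 (vertex_of M d) = None \<longleftrightarrow> d \<notin> ends" for d
    using vertex_of_eq_iff[of d] by (auto simp: \<delta>0_def)
  have sub: "set (map b [1..<i]) \<subseteq> S"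
  proof
    fix x assume "x \<in> set (map b [1..<i])"
    then obtain j where "j \<in> {1..<i}" "x = b j" by auto
    then have j: "0 < j" "j < i" "x = b j" by auto
    then show "x \<in> S" using i b_neq_root[of j] b_in by (auto simp: S_def)
  qed
  have subD: "set (map b [1..<i]) \<subseteq> darts M" using sub by (auto simp: S_def)
  have frame: "E1 \<subseteq> {root_edge M} \<union> edge_of M ` S \<and> (\<forall>x. x \<notin> vertex_of M ` S \<longrightarrow> \<delta>1 x = \<delta>0 x) \<and>
    (\<forall>x. \<delta>0 x \<noteq> None \<longrightarrow> \<delta>1 x \<noteq> None)"
  proof (rule explore_frame[OF e0 subD sub])
    show "opp M d \<in> S" if "d \<in> S" for d using bridge_closed_opp[OF S_closed] that by blast
    show "vertex_of M d \<subseteq> S" if "d \<in> S" "\<delta>0 (vertex_of M d) = None" for d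
      using bridge_closed_vertex[OF S_closed] that \<delta>0 by blast
  qed
  have mono: "\<delta>1 x = \<delta>0 x" if "\<delta>0 x \<noteq> None" for x using explore_mono[OF e0 subD] that by blast
  show "edge_of M d \<notin> E1" if d: "d \<in> A" for d
  proof
    assume "edge_of M d \<in> E1"
    then have "edge_of M d = root_edge M \<or> edge_of M d \<in> edge_of M ` S" using frame by blast
    then obtain x where x: "edge_of M d = edge_of M x" "x = r \<or> x \<in> S" by (auto simp: root_edge_def)
    then have "edge_of M x \<in> EA" using edge_in_EA[of d] d by simp
    then have "x \<in> A" by simp
    then show False using x(2) root_notin_A by (auto simp: S_def)
  qed
  show "\<delta>1 (vertex_of M d) = None" if d: "d \<in> A" "d \<notin> ends" for d
  proof -
    have "vertex_of M d \<notin> vertex_of M ` S"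
    proof
      assume "vertex_of M d \<in> vertex_of M ` S"
      then obtain x where "x \<in> S" "vertex_of M d = vertex_of M x" by blast
      then have "x \<in> vertex_of M d" by simp
      then have "x \<in> A" using bridge_closed_vertex[OF bridge_closed_A d] by blast
      then show False using \<open>x \<in> S\<close> by (simp add: S_def)
    qed
    then have "\<delta>1 (vertex_of M d) = \<delta>0 (vertex_of M d)" using frame by blast
    then show ?thesis using d(2) \<delta>0[of d] by simp
  qed
  show "\<delta>1 (vertex_of M r) = Some (-1)" using mono[of "vertex_of M r"] rr by (simp add: \<delta>0_def)
  show "\<delta>1 (vertex_of M r') = Some 0" using mono[of "vertex_of M r'"] by (simp add: \<delta>0_def)
  have dis: "set (map b [1..<i]) \<inter> vertex_of M r = {}" using b_not_tail by auto
  have nl: "opp M d \<notin> vertex_of M r" if "d \<in> vertex_of M r" for d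
  proof -
    have "d \<in> darts M" using that vertex_of_subset[OF root_in] by blast
    then show ?thesis using no_loops[of d] vertex_of_eq[OF that] by simp
  qed
  have "\<And>x. \<delta>0 x = Some (-1) \<longleftrightarrow> x = vertex_of M r" using rr by (auto simp: \<delta>0_def)
  then show "\<delta>1 x = Some (-1) \<longleftrightarrow> x = vertex_of M r" for x
    using explore_count[OF e0 subD nl dis] by blast
  assume "1 < i"
  interpret N: comb_map M2 by (rule comb_map_submap[OF M2_edges(1)])
  have S2: "S \<subseteq> \<Union>(edges M - EA)" "r \<in> \<Union>(edges M - EA)" "r' \<in> \<Union>(edges M - EA)"
    unfolding M2_edges(2) S_def using root_in root'_in root_notin_A by auto
  have v2: "vertex_of M2 d = vertex_of M d - A" if "d \<in> darts M - A" for d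
  proof -
    have "d \<in> \<Union>(edges M - EA)" using that M2_edges(2) by blast
    from vertex_of_submap[OF M2_edges(1) this] show ?thesis
      unfolding M2_edges(2) using vertex_of_subset[of d] that by blast
  qed
  have o2: "opp M2 d = opp M d" if "d \<in> darts M - A" for d
    by (rule opp_submap_in) (use that M2_edges(2) in blast)
  have head2: "vertex_of M2 r' = b ` {0..<i}"
  proof -
    have "vertex_of M2 r' = b ` {0..<m} - A"
      using v2[of r'] root'_in root_notin_A unfolding head_vertex by blast
    also have "\<dots> = b ` {0..<i}" using i by (auto simp: not_le)
    finally show ?thesis .
  qed
  have "card (vertex_of M2 r') = i"
  proof -
    have "inj_on b {0..<i}" using b_inj i(2) by (intro inj_onI) auto
    then show ?thesis by (simp add: head2 card_image)
  qed
  moreover have "(rot M2 ^^ j) r' = b j" if "j < i" for j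
    using that
  proof (induction j)
    case (Suc j)
    have "b j \<in> \<Union>(edges M - EA)" "rot M (b j) \<in> \<Union>(edges M - EA)"
      unfolding M2_edges(2) b_Suc[symmetric] using Suc.prems i b_in by auto
    then show ?case using Suc by (simp add: rot_submap_step b_Suc del: Union_iff)
  qed simp
  ultimately have da: "darts_after M2 r' = map b [1..<i]" by (simp add: darts_after_def)
  define \<delta>N where "\<delta>N = [vertex_of M2 r \<mapsto> (-1::int), vertex_of M2 r' \<mapsto> 0]"
  have vv: "vertex_of M2 d = vertex_of M2 x \<longleftrightarrow> vertex_of M d = vertex_of M x"
    if "d \<in> darts M - A" "x \<in> darts M - A" for d x
    using N.vertex_of_eq_iff[of d x] vertex_of_eq_iff[of d x] v2[OF that(2)] that(1) by blast
  have "\<exists>EN' \<delta>N'. explore M2 0 (map b [1..<i]) {root_edge M} \<delta>N = (map (relabel (\<lambda>l. l)) ts, EN', \<delta>N') \<and>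
    (\<forall>d\<in>S. edge_of M d \<in> E1 \<longleftrightarrow> edge_of M d \<in> EN') \<and>
    (\<forall>d\<in>S. \<delta>N' (vertex_of M2 d) = map_option (\<lambda>l. l) (\<delta>1 (vertex_of M d))) \<and>
    (\<forall>x. \<delta>0 x \<noteq> None \<longrightarrow> \<delta>1 x \<noteq> None)"
  proof (rule explore_transfer[OF e0 subD sub N.comb_map_axioms, where g = "\<lambda>l. l" and ?p0.0 = 0])
    show "S \<subseteq> darts M2" using S2 by simp
    fix d assume d: "d \<in> S"
    then have dA: "d \<in> darts M - A" by (simp add: S_def)
    show "opp M2 d = opp M d \<and> opp M d \<in> S"
      using o2[OF dA] bridge_closed_opp[OF S_closed] d by blast
    show "\<delta>N (vertex_of M2 d) = map_option (\<lambda>l. l) (\<delta>0 (vertex_of M d))"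
      using vv[OF dA, of r] vv[OF dA, of r'] root_in root'_in root_notin_A
      by (simp add: \<delta>N_def \<delta>0_def)
    assume "\<delta>0 (vertex_of M d) = None"
    then have v: "vertex_of M d \<subseteq> S" using bridge_closed_vertex[OF S_closed d] \<delta>0 by blast
    moreover have "rot M2 x = rot M x" if x: "x \<in> vertex_of M d" for x
    proof (rule rot_submap_step)
      show "x \<in> \<Union>(edges M - EA)" using x v S2(1) by blast
      have "rot M x \<in> vertex_of M d" using x by simp
      then show "rot M x \<in> \<Union>(edges M - EA)" using v S2(1) by blast
    qed
    ultimately show "vertex_of M d \<subseteq> S \<and> (\<forall>x\<in>vertex_of M d. rot M2 x = rot M x)" by blast
  qed simp_all
  moreover have "map (relabel (\<lambda>l. l)) ts = ts" by (simp add: map_idI)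
  ultimately have "fst (explore M2 0 (map b [1..<i]) {root_edge M} \<delta>N) = ts" by auto
  moreover have "root_edge M2 = root_edge M"
    using edge_of_submap[OF S2(2)] by (simp add: root_edge_def)
  moreover have "opp M2 r = r'" using o2[of r] root_in root_notin_A by simp
  ultimately show "T_map M2 = Node (rev ts)" using da by (simp add: T_map_def \<delta>N_def)
qed

text \<open>The first dart of the run already leads to the search of the entire bridge, so the later
  darts of the run create nothing and there is a single child.\<close>

lemma explore_inner:
  assumes i: "0 < i" "i < m" "\<And>j. j < m \<Longrightarrow> b j \<in> A \<longleftrightarrow> i \<le> j"
    and E1: "\<And>d. d \<in> A \<Longrightarrow> edge_of M d \<notin> E1"
    and \<delta>1: "\<And>d. d \<in> A \<Longrightarrow> d \<notin> ends \<Longrightarrow> \<delta>1 (vertex_of M d) = None"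
    and tail: "\<delta>1 (vertex_of M r) = Some (-1)" and head: "\<delta>1 (vertex_of M r') = Some 0"
    and uniq: "\<And>x. \<delta>1 x = Some (-1) \<longleftrightarrow> x = vertex_of M r"
  obtains t where "fst (explore M 0 (map b [i..<m]) E1 \<delta>1) = [t]"
    "card EA = 1 \<Longrightarrow> t = Leaf (-1)"
    "card EA \<noteq> 1 \<Longrightarrow> (\<exists>us. t = Node us) \<and> T_map K1 = lower_labels t \<and> free_leaves (Node [t]) = map_deg N1"
proof -
  define d where "d = b i"
  have dA: "d \<in> A" using i by (simp add: d_def)
  have dD: "d \<in> darts M" by (simp add: d_def b_in)
  have oA: "opp M d \<in> A" using dA by simp
  have d_head: "d \<in> vertex_of M r'" by (simp add: d_def b_in_head)
  have o_head: "opp M d \<notin> vertex_of M r'"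
    using no_loops[OF dD] vertex_of_eq[OF d_head] by simp
  have ds: "map b [i..<m] = d # map b [Suc i..<m]" using i by (simp add: d_def upt_conv_Cons)
  have restA: "set (map b [Suc i..<m]) \<subseteq> A" using i by auto
  have fin: "finite (darts M) \<and> d \<in> darts M" using finite_darts dD by simp
  have eE: "edge_of M d \<notin> E1" by (rule E1[OF dA])
  show ?thesis
  proof (cases "card EA = 1")
    case True
    then obtain a where a: "EA = {a}" by (auto simp: card_1_singleton_iff)
    have "opp M d \<in> ends" using single_edge_bridge(3)[OF a dA] oA by blast
    then have "vertex_of M (opp M d) = vertex_of M r" using o_head vertex_of_eq by blast
    then have k: "\<delta>1 (vertex_of M (opp M d)) = Some (-1)" using tail by simp
    have "edge_of M x = edge_of M d" if "x \<in> A" for x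
      using that dA edge_in_EA[of x] edge_in_EA[of d] unfolding a by simp
    then have "explore M 0 (map b [Suc i..<m]) (insert (edge_of M d) E1) \<delta>1 =
      ([], insert (edge_of M d) E1, \<delta>1)"
      by (intro explore_examined) (use restA in blast)
    then have "fst (explore M 0 (map b [i..<m]) E1 \<delta>1) = [Leaf (-1)]"
      unfolding ds using eE fin k by simp
    then show ?thesis using that True by blast
  next
    case False
    \<comment> \<open>An edge between the two ends is bridge-closed by itself and would be all of
      \<open>A\<close>.\<close>
    have o_ends: "opp M d \<notin> ends"
    proof
      assume "opp M d \<in> ends"
      then have "bridge_closed {d, opp M d}" using d_head dD by (auto simp: bridge_closed_def)
      then have "A \<subseteq> {d, opp M d}" using A_minimal[of "{d, opp M d}"] dA by blast
      then have "edge_of M x = edge_of M d" if "x \<in> A" for x using that by auto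
      then have "EA \<subseteq> {edge_of M d}" unfolding EA_def by (intro image_subsetI) (simp only: singleton_iff)
      then have "EA = {edge_of M d}" using EA_ne by (simp only: subset_singleton_iff simp_thms)
      then show False using False by simp
    qed
    define y where "y = vertex_of M (opp M d)"
    have y_None: "\<delta>1 y = None" unfolding y_def by (rule \<delta>1[OF oA o_ends])
    have yA: "y \<subseteq> A" unfolding y_def by (rule bridge_closed_vertex[OF bridge_closed_A oA o_ends])
    define E2 where "E2 = insert (edge_of M d) E1"
    define \<delta>2 where "\<delta>2 = \<delta>1(y \<mapsto> 1)"
    obtain us E3 \<delta>3 where e: "explore M 1 (darts_after M (opp M d)) E2 \<delta>2 = (us, E3, \<delta>3)"
      by (metis prod_cases3)
    have after: "set (darts_after M (opp M d)) = y - {opp M d}" by (simp add: set_darts_after y_def)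
    have sub: "set (darts_after M (opp M d)) \<subseteq> A" using after yA by blast
    have subD: "set (darts_after M (opp M d)) \<subseteq> darts M" using sub A_sub_darts by blast
    have y_ends: "y \<noteq> vertex_of M r" "y \<noteq> vertex_of M r'"
      using o_ends unfolding y_def by (metis UnI1 self_in_vertex, metis UnI2 self_in_vertex)
    have \<delta>2_ends: "\<delta>2 (vertex_of M r) = Some (-1)" "\<delta>2 (vertex_of M r') = Some 0"
      using tail head y_ends[symmetric] by (simp_all add: \<delta>2_def)
    have in_y: "vertex_of M x = y \<longleftrightarrow> x \<in> y" for x unfolding y_def by (rule vertex_of_eq_iff)
    have \<delta>2_A: "\<delta>2 (vertex_of M x) = None \<longleftrightarrow> x \<notin> ends \<and> x \<notin> y" if "x \<in> A" for x
    proof (cases "x \<in> ends")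
      case True
      then have "vertex_of M x = vertex_of M r \<or> vertex_of M x = vertex_of M r'" using vertex_of_eq by blast
      then show ?thesis using True \<delta>2_ends by (elim disjE) simp_all
    next
      case False
      then show ?thesis using \<delta>1[OF that False] in_y[of x] by (simp add: \<delta>2_def)
    qed
    \<comment> \<open>The examined darts of \<open>A\<close> form a bridge-closed set that contains
      \<open>d\<close>: away from the ends, an examined edge leads to a visited vertex, all of whose
      edges are examined. Minimality of \<open>A\<close> gives the rest.\<close>
    have all: "edge_of M x \<in> E3" if "x \<in> A" for x
    proof -
      have "\<forall>x\<in>set (darts_after M (opp M d)). \<delta>2 (vertex_of M x) \<noteq> None"
        using after in_y by (auto simp: \<delta>2_def)
      note c = explore_complete[OF e subD this]
      have new: "edge_of M x \<in> E3" if "x \<in> darts M" "\<delta>2 (vertex_of M x) = None" "\<delta>3 (vertex_of M x) \<noteq> None" for x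
        using c that by blast
      have vis: "\<delta>3 (vertex_of M x) \<noteq> None" if "x \<in> darts M" "edge_of M x \<in> E3" "edge_of M x \<notin> E2" for x
        using c that by blast
      have E23: "E2 \<subseteq> E3" and dE3: "\<And>x. x \<in> set (darts_after M (opp M d)) \<Longrightarrow> edge_of M x \<in> E3"
        using c by blast+
      have dE: "edge_of M d \<in> E3" using E23 by (auto simp: E2_def)
      have yE: "edge_of M x \<in> E3" if "x \<in> y" for x
      proof (cases "x = opp M d")
        case True
        then show ?thesis using dE by simp
      next
        case False
        then show ?thesis using dE3 after that by blast
      qed
      have "bridge_closed {x \<in> A. edge_of M x \<in> E3}"
        unfolding bridge_closed_def
      proof (intro conjI ballI impI)
        show "{x \<in> A. edge_of M x \<in> E3} \<subseteq> darts M" using A_sub_darts by blast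
        fix x assume "x \<in> {x \<in> A. edge_of M x \<in> E3}"
        then have x: "x \<in> A" "edge_of M x \<in> E3" by auto
        then show "opp M x \<in> {x \<in> A. edge_of M x \<in> E3}" by simp
        assume x_ends: "x \<notin> ends"
        have rA: "rot M x \<in> A" using bridge_closed_rot[OF bridge_closed_A x_ends] x by blast
        have "edge_of M (rot M x) \<in> E3"
        proof (cases "x \<in> y")
          case True
          then have "rot M x \<in> y" by (simp add: y_def)
          then show ?thesis by (rule yE)
        next
          case False
          have "edge_of M x \<notin> E2"
          proof
            assume "edge_of M x \<in> E2"
            then have "edge_of M d = edge_of M x" using E1[OF x(1)] by (auto simp: E2_def)
            then have "x = d \<or> x = opp M d" by (simp add: edge_of_eq_iff)
            then show False using False x_ends d_head self_in_vertex[of "opp M d"] by (auto simp: y_def)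
          qed
          then have "\<delta>3 (vertex_of M (rot M x)) \<noteq> None" using vis[of x] x A_sub_darts by auto
          moreover have "\<delta>2 (vertex_of M (rot M x)) = None" using \<delta>2_A[OF x(1)] x_ends False by simp
          ultimately show ?thesis using new[of "rot M x"] rA A_sub_darts by blast
        qed
        then show "rot M x \<in> {x \<in> A. edge_of M x \<in> E3}" using rA by simp
      qed
      moreover have "d \<in> {x \<in> A. edge_of M x \<in> E3} \<inter> A" using dA dE by simp
      ultimately show ?thesis using A_minimal[of "{x \<in> A. edge_of M x \<in> E3}"] that by blast
    qed
    have "explore M 0 (map b [Suc i..<m]) E3 \<delta>3 = ([], E3, \<delta>3)"
      by (rule explore_examined) (use restA all in blast)
    then have ts: "fst (explore M 0 (map b [i..<m]) E1 \<delta>1) = [Node (rev us)]"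
      unfolding ds using eE fin y_None e by (simp add: y_def[symmetric] E2_def \<delta>2_def)
    have fl: "sum_list (map free_leaves us) = card (vertex_of M r \<inter> A)"
    proof -
      have nl: "opp M x \<notin> vertex_of M r" if "x \<in> vertex_of M r" for x
      proof -
        have "x \<in> darts M" using that vertex_of_subset[OF root_in] by blast
        then show ?thesis using no_loops[of x] vertex_of_eq[OF that] by simp
      qed
      have "y \<inter> vertex_of M r = {}"
        unfolding y_def by (rule vertex_of_disjoint) (use o_ends in blast)
      then have dis: "set (darts_after M (opp M d)) \<inter> vertex_of M r = {}" using after by blast
      have u2: "\<And>x. \<delta>2 x = Some (-1) \<longleftrightarrow> x = vertex_of M r" using uniq y_ends by (auto simp: \<delta>2_def)
      have count: "sum_list (map free_leaves us) = card {x \<in> vertex_of M r. edge_of M x \<in> E3 - E2}"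
        using explore_count[OF e subD nl dis _ u2] by simp
      have frame: "E3 \<subseteq> E2 \<union> edge_of M ` A"
      proof -
        have "E3 \<subseteq> E2 \<union> edge_of M ` A \<and> (\<forall>x. x \<notin> vertex_of M ` A \<longrightarrow> \<delta>3 x = \<delta>2 x) \<and>
            (\<forall>x. \<delta>2 x \<noteq> None \<longrightarrow> \<delta>3 x \<noteq> None)"
        proof (rule explore_frame[OF e subD sub])
          show "vertex_of M x \<subseteq> A" if "x \<in> A" "\<delta>2 (vertex_of M x) = None" for x
            using bridge_closed_vertex[OF bridge_closed_A] that \<delta>2_A by blast
        qed simp
        then show ?thesis by blast
      qed
      have "{x \<in> vertex_of M r. edge_of M x \<in> E3 - E2} = vertex_of M r \<inter> A"
      proof (intro equalityI subsetI)
        fix x assume "x \<in> {x \<in> vertex_of M r. edge_of M x \<in> E3 - E2}"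
        then have "x \<in> vertex_of M r" "edge_of M x \<in> EA" using frame by (auto simp: EA_def)
        then show "x \<in> vertex_of M r \<inter> A" by simp
      next
        fix x assume x: "x \<in> vertex_of M r \<inter> A"
        have "edge_of M x \<notin> E2"
        proof
          assume "edge_of M x \<in> E2"
          then have "edge_of M d = edge_of M x" using E1[of x] x by (auto simp: E2_def)
          then have "x = d \<or> x = opp M d" by (simp add: edge_of_eq_iff)
          then show False using x d_head o_ends ends_disjoint by blast
        qed
        then show "x \<in> {x \<in> vertex_of M r. edge_of M x \<in> E3 - E2}" using all x by blast
      qed
      then show ?thesis using count by simp
    qed
    \<comment> \<open>The one subtracted in \<open>map_deg\<close> accounts for the root dart
      \<open>r\<close>, the only dart of \<open>N1\<close> at the tail outside
      \<open>A\<close>.\<close>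
    have deg: "map_deg N1 = card (vertex_of M r \<inter> A)"
    proof -
      have "vertex_of N1 r = insert r (vertex_of M r \<inter> A)"
        using vertex_of_N1[of r] nonloop self_in_vertex[of r] by auto
      moreover have "finite (vertex_of M r \<inter> A)" using finite_vertex_of by simp
      ultimately show ?thesis using root_notin_A by (simp add: map_deg_def root_vertex_def)
    qed
    \<comment> \<open>Both ends, of depths -1 and 0, get the depth -1 of the merged vertex. All
      other depths drop by one, so \<open>y\<close> passes from depth 1 to depth 0 and becomes the
      root of the tree of the contraction.\<close>
    define g where "g = (\<lambda>l::int. if l = -1 then l else l - 1)"
    interpret L: comb_map K1 by (rule comb_map_K1)
    define \<delta>N where "\<delta>N = [vertex_of K1 d \<mapsto> (-1::int), vertex_of K1 (opp M d) \<mapsto> 0]"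
    have vd: "vertex_of K1 d = ends \<inter> A" using vertex_of_K1[OF dA] d_head by simp
    have vo: "vertex_of K1 (opp M d) = y" using vertex_of_K1[OF oA] o_ends by (simp add: y_def)
    have rotL: "rot K1 x = rot M x" if "x \<in> A" "x \<notin> ends" for x by (rule rot_K1[OF that])
    have "\<exists>EN' \<delta>N'. explore K1 (g 1) (darts_after M (opp M d)) {edge_of M d} \<delta>N = (map (relabel g) us, EN', \<delta>N') \<and>
      (\<forall>d\<in>A. edge_of M d \<in> E3 \<longleftrightarrow> edge_of M d \<in> EN') \<and>
      (\<forall>d\<in>A. \<delta>N' (vertex_of K1 d) = map_option g (\<delta>3 (vertex_of M d))) \<and>
      (\<forall>x. \<delta>2 x \<noteq> None \<longrightarrow> \<delta>3 x \<noteq> None)"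
    proof (rule explore_transfer[OF e subD sub comb_map_K1, where ?p0.0 = 1])
      show "A \<subseteq> darts K1" using darts_K1 by simp
      show "g (q + 1) = g q + 1" if "1 \<le> q" for q using that by (simp add: g_def)
      fix x assume x: "x \<in> A"
      show "opp K1 x = opp M x \<and> opp M x \<in> A" using opp_K1[OF x] x by simp
      show "edge_of M x \<in> E2 \<longleftrightarrow> edge_of M x \<in> {edge_of M d}" using E1[OF x] by (auto simp: E2_def)
      show "\<delta>N (vertex_of K1 x) = map_option g (\<delta>2 (vertex_of M x))"
      proof (cases "x \<in> ends")
        case True
        then have "vertex_of K1 x = ends \<inter> A" using vertex_of_K1[OF x] by simp
        moreover have "ends \<inter> A \<noteq> y"
          using o_ends self_in_vertex[of "opp M d"] unfolding y_def by blast
        ultimately have "\<delta>N (vertex_of K1 x) = Some (-1)" unfolding \<delta>N_def vd vo by simp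
        moreover have "vertex_of M x = vertex_of M r \<or> vertex_of M x = vertex_of M r'" using True vertex_of_eq by blast
        then have "map_option g (\<delta>2 (vertex_of M x)) = Some (-1)"
          using \<delta>2_ends by (elim disjE) (simp_all add: g_def)
        ultimately show ?thesis by (simp only:)
      next
        case False
        then have vx: "vertex_of K1 x = vertex_of M x" using vertex_of_K1[OF x] by simp
        have "vertex_of M x \<noteq> ends \<inter> A" using False self_in_vertex[of x] by blast
        then show ?thesis using \<delta>1[OF x False] unfolding vx \<delta>N_def vd vo \<delta>2_def by (simp add: g_def)
      qed
      assume "\<delta>2 (vertex_of M x) = None"
      then have x_ends: "x \<notin> ends" using \<delta>2_A[OF x] by blast
      then have vA: "vertex_of M x \<subseteq> A" by (rule bridge_closed_vertex[OF bridge_closed_A x])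
      moreover have "rot K1 z = rot M z" if "z \<in> vertex_of M x" for z
        using that vA vertex_off_ends[OF x_ends] by (intro rotL) blast+
      ultimately show "vertex_of M x \<subseteq> A \<and> (\<forall>z\<in>vertex_of M x. rot K1 z = rot M z)" by blast
    qed simp
    then obtain EN' \<delta>N' where tr: "explore K1 0 (darts_after M (opp M d)) {edge_of M d} \<delta>N =
      (map (relabel g) us, EN', \<delta>N')" by (auto simp: g_def)
    have da: "darts_after K1 (opp M d) = darts_after M (opp M d)"
    proof (rule darts_after_cong(2))
      fix z assume "z \<in> vertex_of M (opp M d)"
      then show "rot K1 z = rot M z"
        using yA vertex_off_ends[OF o_ends] by (intro rotL) (auto simp: y_def)
    qed simp
    have rK: "root_dart K1 = d" unfolding d_def by (rule root_K1[OF i])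
    have oK: "opp K1 d = opp M d" by (rule opp_K1[OF dA])
    have "root_edge K1 = edge_of M d" 
      unfolding root_edge_def[of K1] rK edge_of_def[of K1 d] edge_of_def[of M d] oK ..
    then have "T_map K1 = Node (rev (map (relabel g) us))"
      using tr by (simp add: T_map_def Let_def rK oK da \<delta>N_def)
    also have "\<dots> = lower_labels (Node (rev us))"
      by (simp add: lower_labels_eq_relabel[abs_def] g_def rev_map)
    finally have "T_map K1 = lower_labels (Node (rev us))" .
    moreover have "free_leaves (Node [Node (rev us)]) = sum_list (map free_leaves us)"
      by (simp add: free_leaves_def[abs_def] filter_concat length_concat comp_def rev_map[symmetric] sum_list_rev)
    ultimately show ?thesis using that[of "Node (rev us)"] ts False fl deg by simp
  qed
qed

text \<open>The darts outside the root edge and \<open>A\<close> form a union of bridges. If there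
  are any, some of them lie at the head, and they come before the run of \<open>A\<close>.\<close>

lemma single_block_interval:
  assumes i: "0 < i" "i < m" "\<And>j. j < m \<Longrightarrow> b j \<in> A \<longleftrightarrow> i \<le> j"
  shows "EA = edges K \<longleftrightarrow> i = 1"
proof
  assume e: "EA = edges K"
  have "b 1 \<in> darts K" using b_neq_root[of 1] m_ge_2 b_in by (simp add: darts_K)
  then have "edge_of K (b 1) \<in> EA" using e by simp
  then have "b 1 \<in> A" using \<open>b 1 \<in> darts K\<close> by (simp add: edge_of_K)
  then show "i = 1" using i(3)[of 1] i(1) m_ge_2 by simp
next
  assume i1: "i = 1"
  define Z where "Z = darts M - ({r, r'} \<union> A)"
  have Z: "bridge_closed Z"
    unfolding Z_def by (rule bridge_closed_complement[OF bridge_closed_Un[OF bridge_closed_root bridge_closed_A]])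
  have "Z = {}"
  proof (rule ccontr)
    assume "Z \<noteq> {}"
    then have "Z \<inter> vertex_of M r' \<noteq> {}" by (intro bridge_meets_end[OF Z]) (auto simp: Z_def)
    then obtain j where j: "j < m" "b j \<in> Z" unfolding head_vertex by auto
    then have "j \<noteq> 0" by (cases j) (simp_all add: Z_def)
    then show False using i(3)[OF j(1)] i1 j(2) by (simp add: Z_def)
  qed
  then have "darts K = A" using A_sub by (auto simp: Z_def darts_K)
  then have "edges K = edge_of M ` A"
    unfolding edges_def using edge_of_K by (intro image_cong) auto
  then show "EA = edges K" by (simp add: EA_def)
qed

text \<open>Children are listed in reverse order of creation, so the child created by the run of
  \<open>A\<close>, which comes last at the head, is the leftmost one, and the rest is the tree of
  \<open>M2\<close>.\<close>

lemma T_map_decomposition: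
  obtains t ts where "T_map M = Node (t # ts)" "EA = edges K \<longleftrightarrow> ts = []"
    "EA \<noteq> edges K \<Longrightarrow> T_map M2 = Node ts" "card EA = 1 \<Longrightarrow> t = Leaf (-1)"
    "card EA \<noteq> 1 \<Longrightarrow> (\<exists>us. t = Node us) \<and> T_map K1 = lower_labels t \<and> free_leaves (Node [t]) = map_deg N1"
proof -
  obtain i where i: "0 < i" "i < m" "\<And>j. j < m \<Longrightarrow> b j \<in> A \<longleftrightarrow> i \<le> j" by (rule head_interval) blast
  define \<delta>0 where "\<delta>0 = [vertex_of M r \<mapsto> (-1::int), vertex_of M r' \<mapsto> 0]"
  obtain ts1 E1 \<delta>1 where e1: "explore M 0 (map b [1..<i]) {root_edge M} \<delta>0 = (ts1, E1, \<delta>1)"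
    by (metis prod_cases3)
  note outer = explore_outer[OF i e1[unfolded \<delta>0_def]]
  obtain t where t: "fst (explore M 0 (map b [i..<m]) E1 \<delta>1) = [t]" "card EA = 1 \<Longrightarrow> t = Leaf (-1)"
    "card EA \<noteq> 1 \<Longrightarrow> (\<exists>us. t = Node us) \<and> T_map K1 = lower_labels t \<and> free_leaves (Node [t]) = map_deg N1"
    by (rule explore_inner[OF i outer(1-5)]) blast+
  obtain ts2 E2 \<delta>2 where e2: "explore M 0 (map b [i..<m]) E1 \<delta>1 = (ts2, E2, \<delta>2)"
    by (metis prod_cases3)
  have subD: "set (map b [1..<i]) \<subseteq> darts M" using b_in by auto
  have "map b [1..<m] = map b [1..<i] @ map b [i..<m]"
    using upt_add_eq_append[of 1 i "m - i"] i by (simp flip: map_append)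
  then have "explore M 0 (map b [1..<m]) {root_edge M} \<delta>0 = (ts1 @ ts2, E2, \<delta>2)"
    using explore_append[OF e1 subD e2] by simp
  then have T: "T_map M = Node (t # rev ts1)" using t(1) e2 T_map_eq by (simp add: \<delta>0_def)
  have "rev ts1 = [] \<longleftrightarrow> i = 1"
  proof
    assume "rev ts1 = []"
    then have "\<forall>d\<in>set (map b [1..<i]). edge_of M d \<in> {root_edge M}"
      using explore_Nil_iff e1 finite_darts subD by (metis rev_is_Nil_conv)
    \<comment> \<open>At the start only the root edge counts as examined, so \<open>b 1\<close>
      creates a child whenever it comes before the run of \<open>A\<close>.\<close>
    moreover have "edge_of M (b 1) \<noteq> root_edge M"
      using edge_of_eq_iff[of "b 1" r] b_neq_root[of 1] m_ge_2 opp_eq_iff[of "b 1" r] by (auto simp: root_edge_def)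
    ultimately show "i = 1" using i(1) by (cases "i = 1") auto
  qed (use e1 in simp)
  then have iff: "EA = edges K \<longleftrightarrow> rev ts1 = []" using single_block_interval[OF i] by blast
  show ?thesis
  proof (rule that[OF T iff])
    show "T_map M2 = Node (rev ts1)" if "EA \<noteq> edges K"
      using outer(6) that single_block_interval[OF i] i(1) by simp
  qed (use t in auto)
qed

end

text \<open>With a single block, \<open>N1\<close> has all edges of \<open>M\<close>; this equality
  makes the facts about \<open>N1\<close> and its contraction available there.\<close>

lemma (in comb_map) submap_edges: "submap M (edges M) = M"
proof (rule rmap.equality)
  show "rot (submap M (edges M)) = rot M"
    by (rule ext) (simp add: submap_def R.first_return_step R.outside_D del: Union_iff)
  show "opp (submap M (edges M)) = opp M"
    unfolding opp_submap by (rule some_opp_edges)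
qed simp_all

section \<open>Induction on the number of darts\<close>

lemma nsp_locale: "nsp_map M \<Longrightarrow> nsp M"
  using nsp_map_iff planar_map_iff by (auto simp: nsp_def nsp_axioms_def)

lemma finite_darts_psubset_card:
  "planar_map M \<Longrightarrow> X \<subset> darts M \<Longrightarrow> card X < card (darts M)"
  by (rule psubset_card_mono) (auto simp: planar_map_def)

theorem theorem3p2:
  fixes M :: "'d rmap"
  assumes "nsp_map M"
  shows "phi_M M = phi_T (T_map M)"
  using assms
proof (induction "card (darts M)" arbitrary: M rule: less_induct)
  case less
  interpret nsp M by (rule nsp_locale) fact
  \<comment> \<open>The guard in \<open>phi_M\<close> holds because the innermost block is
    \<open>EA\<close>, which is a block.\<close>
  have phi: "phi_M M =
    (if is_M0 M then B0
     else if card (blocks K) = 1 then Delta_B (phi_M K) (map_deg M)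
     else if \<exists>a. EA = {a} \<and> is_loop K a then L_B (phi_M M2)
     else oplus_B (phi_M K1) (map_deg N1) (phi_M M2))"
    by (subst phi_M.simps) (simp only: less.prems innermost_block EA_block simp_thms if_False)
  obtain t ts where T: "T_map M = Node (t # ts)" "EA = edges K \<longleftrightarrow> ts = []"
    "EA \<noteq> edges K \<Longrightarrow> T_map M2 = Node ts" "card EA = 1 \<Longrightarrow> t = Leaf (-1)"
    "card EA \<noteq> 1 \<Longrightarrow> (\<exists>us. t = Node us) \<and> T_map K1 = lower_labels t \<and> free_leaves (Node [t]) = map_deg N1"
    by (rule T_map_decomposition) blast
  have IH2: "phi_M M2 = phi_T (Node ts)" if "EA \<noteq> edges K"
    using less.hyps[OF finite_darts_psubset_card[OF planar] M2_nsp[OF that]]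
      darts_delete_block_psubset[OF planar EA_block] T(3)[OF that] by simp
  have IH1: "phi_M K1 = phi_T (lower_labels t)" if "card EA \<noteq> 1"
    using less.hyps[OF finite_darts_psubset_card[OF planar] nsp_K1[OF that]]
      darts_contract_submap_psubset[OF planar EA_block] T(5)[OF that] by simp
  show ?case
  \<comment> \<open>\<open>EA = edges K\<close> decides between one and several children of the
    root, \<open>card EA = 1\<close> between a leaf and an internal leftmost child. The four
    combinations are the four clauses of both recursions.\<close>
  proof (cases "EA = edges K")
    case True
    then have ts: "ts = []" and bl: "card (blocks K) = 1" using T(2) single_block_iff by blast+
    show ?thesis
    proof (cases "card EA = 1")
      case one: True
      then show ?thesis using phi is_M0_iff True T ts by simp
    next
      case more: False
      \<comment> \<open>Hence \<open>K1\<close> is \<open>K\<close>, and the number of free leaves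
        is \<open>map_deg M\<close>, as the clause with \<open>Delta_B\<close> demands.\<close>
      have N1: "N1 = M"
      proof -
        have "insert (root_edge M) EA = edges M"
          using root_in unfolding True edges_K by (simp add: insert_absorb root_edge_def)
        then show ?thesis by (simp only: submap_edges)
      qed
      obtain us where us: "t = Node us" using T(5)[OF more] by blast
      show ?thesis
        using phi is_M0_iff more bl IH1[OF more] T(1,5) N1 ts us by (simp del: lower_labels.simps)
    qed
  next
    case False
    then obtain t' ts' where ts: "ts = t' # ts'" using T(2) by (cases ts) auto
    have nb: "card (blocks K) \<noteq> 1" "\<not> is_M0 M" using False single_block_iff is_M0_iff by blast+
    show ?thesis
    proof (cases "card EA = 1")
      case one: True
      then show ?thesis using phi nb single_edge_iff IH2[OF False] T(1,4) ts by simp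
    next
      case more: False
      obtain us where us: "t = Node us" using T(5)[OF more] by blast
      show ?thesis
        using phi nb single_edge_iff more IH1[OF more] IH2[OF False] T(1,5) ts us by (simp del: lower_labels.simps)
    qed
  qed
qed

end
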